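(* Let $X_1,\dots,X_n$ be a piecewise locally stationary process, let $H:\mathbb{R}^2\to\mathbb{R}$ and $W_n:[0,1]^2\to\mathbb{R}$ be symmetric Borel functions, and let $N_n$, $W_{j,\cdot}$, $W^{(n)}$, $\delta_X$ be as defined in the context. Assume: (1) For some $\eta\in(0,1]$ and some function $L:\mathbb{R}\to\mathbb{R}$, the function $H^*(t,s):=H(t,s)/[L(t)L(s)]$ belongs to $W_0^{\eta}(\mathbb{R}^2)$. (2) $L$ is differentiable with derivative $L'$; there is a finite constant $C$ such that $\max_{a\le t\le b}|L'(t)|\le C(|L'(a)|+|L'(b)|+1)$ for all $a\le b$; and for some $\epsilon>0$, $\sup_n\max_{1\le j\le n}\|L(X_j)\|_{4+2\epsilon}<\infty$ and $\sup_n\max_{1\le j\le n}\|L'(X_j)\|_{4+2\epsilon}<\infty$. (3) There exist sequences $l_n,m_n$ of positive integers with $m_n/\log n\to\infty$, $l_n/n\to0$ and $m_n/l_n\to0$ such that, with $s_n=l_n+m_n$ and, for $j=1,\dots,\lceil n/s_n\rceil$, $$A_j=\sum_{k=1}^{l_n}W^2_{s_n(j-1)+k,\cdot},\qquad a_j=\sum_{k=l_n+1}^{s_n}W^2_{s_n(j-1)+k,\cdot},$$ one has $\sum_j a_j/W^{(n)}\to0$ and $\max_jA_j/W^{(n)}\to0$. (4) There is $c>0$ such that $\operatorname{Var}(N_n)/W^{(n)}\ge c$ for all sufficiently large $n$. (5) For some $\rho\in[0,1)$ and $\epsilon>0$, $\delta_X(k,4+2\epsilon)=O(\rho^k)$ as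 $k\to\infty$. Then $N_n/\sqrt{\operatorname{Var}(N_n)}\Rightarrow N(0,1)$ as $n\to\infty$.
   Context: Notation: $t_k=k/n$; $\|Y\|_p=(E|Y|^p)^{1/p}$; $\Rightarrow$ denotes weak convergence. Piecewise locally stationary model: there are a fixed integer $r\ge0$ and fixed points $0=d_0<d_1<\dots<d_r<d_{r+1}=1$ such that, for each $n$, $$X_k=\sum_{j=0}^rG_j(t_k,\mathcal F_k)\mathbf 1\{d_j<t_k\le d_{j+1}\},\qquad k=1,\dots,n,$$ where $\mathcal F_k=(\dots,\varepsilon_{k-1},\varepsilon_k)$, $(\varepsilon_k)_{k\in\mathbb Z}$ are i.i.d. random variables and $G_j:(d_j,d_{j+1}]\times\mathbb{R}^{\mathbb N}\to\mathbb{R}$ are measurable. Dependence measures: $\delta_X(k,p)=\max_{0\le l\le r}\sup_{t\in(d_l,d_{l+1}]}\|G_l(t,\mathcal F_0)-G_l(t,\mathcal F_{0,-k})\|_p$, where $\mathcal F_{0,-k}$ is $\mathcal F_0$ with $\varepsilon_{-k}$ replaced by $\varepsilon'_{-k}$, and $(\varepsilon'_j)$ is an independent i.i.d. copy of $(\varepsilon_j)$. Wiener ring: for $\eta\ge0$, $f:\mathbb{R}^2\to\mathbb{R}$ belongs to $W_0^\eta(\mathbb{R}^2)$ if there is $g\in L^1(\mathbb{R}^2)$, complex valued, with $f(x,y)=\int_{\mathbb{R}^2}g(t,s)e^{itx+isy}\,dt\,ds$ and $\int_{\mathbb{R}^2}|(t,s)|^{\eta}|g(t,s)|\,dt\,ds<\infty$.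 Definitions: $H_j(x)=E[H(x,X_j)]$ for non-random $x$; $$N_n=\sum_{k=1}^n\sum_{j=1}^nW_n(t_k,t_j)\{H_j(X_k)-E[H_j(X_k)]\};$$ $W_{j,\cdot}=\sum_{r=1}^n|W_n(t_j,t_r)|$ for $1\le j\le n$, $W_{j,\cdot}=0$ for $j>n$; $W^{(n)}=\sum_{j=1}^nW_{j,\cdot}^2$. ($N_n$ is half of the nondegenerate part in the Hoeffding decomposition of $V_n=\sum_{k,j=1}^nW_n(t_k,t_j)H(X_k,X_j)$.) *)

theory Defs
  imports "HOL-Probability.Probability"
begin

text \<open>Extended-real valued: the value is infinite if \<open>Y\<close> has no finite absolute \<open>p\<close>-th moment,
  where the Bochner integral would return \<open>0\<close>.\<close>

definition Lp_norm :: "'a measure \<Rightarrow> real \<Rightarrow> ('a \<Rightarrow> real) \<Rightarrow> ennreal" where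
  "Lp_norm M p Y =
     (let I = (\<integral>\<^sup>+ \<omega>. ennreal (\<bar>Y \<omega>\<bar> powr p) \<partial>M)
      in if I = \<infinity> then \<infinity> else ennreal (enn2real I powr (1 / p)))"

definition wiener_ring :: "real \<Rightarrow> (real \<Rightarrow> real \<Rightarrow> real) set" where
  "wiener_ring \<eta> = {f. \<exists>g :: real \<times> real \<Rightarrow> complex.
     integrable lborel g \<and>
     (\<forall>x y. complex_of_real (f x y) =
        (LINT z|lborel. g z * exp (\<i> * complex_of_real (fst z * x + snd z * y)))) \<and>
     integrable lborel (\<lambda>z. norm z powr \<eta> * norm (g z))}"

text \<open>The past \<open>(\<dots>, \<epsilon> (k - 1), \<epsilon> k)\<close> is indexed backwards in time: coordinate \<open>i\<close> is \<open>\<epsilon> (k - i)\<close>.\<close>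

definition past :: "(int \<Rightarrow> 'a \<Rightarrow> real) \<Rightarrow> int \<Rightarrow> 'a \<Rightarrow> nat \<Rightarrow> real" where
  "past \<epsilon> k \<omega> = (\<lambda>i. \<epsilon> (k - int i) \<omega>)"

text \<open>Joint independence of the family indexed by \<open>int + int\<close> says that the innovations \<open>\<epsilon>\<close> are
  independent, that \<open>\<epsilon>'\<close> are independent, and that the two sequences are independent of each other.\<close>

locale piecewise_locally_stationary = prob_space M
  for M :: "'a measure" and \<epsilon> \<epsilon>' :: "int \<Rightarrow> 'a \<Rightarrow> real"
    and r :: nat and d :: "nat \<Rightarrow> real" and G :: "nat \<Rightarrow> real \<Rightarrow> (nat \<Rightarrow> real) \<Rightarrow> real" +
  assumes innovations_indep: "indep_vars (\<lambda>_. borel) (case_sum \<epsilon> \<epsilon>') (UNIV :: (int + int) set)"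
    and innovations_law: "\<And>k. distr M borel (\<epsilon> k) = distr M borel (\<epsilon> 0)"
    and copy_law: "\<And>k. distr M borel (\<epsilon>' k) = distr M borel (\<epsilon> 0)"
    and breaks_first: "d 0 = 0"
    and breaks_last: "d (Suc r) = 1"
    and breaks_less: "\<And>j. j \<le> r \<Longrightarrow> d j < d (Suc j)"
    and G_measurable: "\<And>j. j \<le> r \<Longrightarrow> (\<lambda>(t, x). G j t x) \<in> borel_measurable
          (restrict_space borel {d j<..d (Suc j)} \<Otimes>\<^sub>M (\<Pi>\<^sub>M i\<in>(UNIV :: nat set). borel))"

definition pls_process ::
  "(int \<Rightarrow> 'a \<Rightarrow> real) \<Rightarrow> nat \<Rightarrow> (nat \<Rightarrow> real) \<Rightarrow> (nat \<Rightarrow> real \<Rightarrow> (nat \<Rightarrow> real) \<Rightarrow> real)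
     \<Rightarrow> nat \<Rightarrow> nat \<Rightarrow> 'a \<Rightarrow> real" where
  "pls_process \<epsilon> r d G n k \<omega> =
     (\<Sum>j=0..r. G j (real k / real n) (past \<epsilon> (int k) \<omega>)
        * indicator {d j<..d (Suc j)} (real k / real n))"

definition dep_measure ::
  "'a measure \<Rightarrow> (int \<Rightarrow> 'a \<Rightarrow> real) \<Rightarrow> (int \<Rightarrow> 'a \<Rightarrow> real) \<Rightarrow> nat \<Rightarrow> (nat \<Rightarrow> real)
     \<Rightarrow> (nat \<Rightarrow> real \<Rightarrow> (nat \<Rightarrow> real) \<Rightarrow> real) \<Rightarrow> nat \<Rightarrow> real \<Rightarrow> ennreal" where
  "dep_measure M \<epsilon> \<epsilon>' r d G k p =
     (MAX l\<in>{0..r}. SUP t\<in>{d l<..d (Suc l)}.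
        Lp_norm M p (\<lambda>\<omega>. G l t (past \<epsilon> 0 \<omega>)
                        - G l t (past (\<epsilon>(- int k := \<epsilon>' (- int k))) 0 \<omega>)))"

definition H_proj ::
  "'a measure \<Rightarrow> (nat \<Rightarrow> nat \<Rightarrow> 'a \<Rightarrow> real) \<Rightarrow> (real \<Rightarrow> real \<Rightarrow> real) \<Rightarrow> nat \<Rightarrow> nat \<Rightarrow> real \<Rightarrow> real" where
  "H_proj M X H n j x = (LINT \<omega>|M. H x (X n j \<omega>))"

definition N_stat ::
  "'a measure \<Rightarrow> (nat \<Rightarrow> nat \<Rightarrow> 'a \<Rightarrow> real) \<Rightarrow> (real \<Rightarrow> real \<Rightarrow> real)
     \<Rightarrow> (nat \<Rightarrow> real \<Rightarrow> real \<Rightarrow> real) \<Rightarrow> nat \<Rightarrow> 'a \<Rightarrow> real" where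
  "N_stat M X H W n \<omega> =
     (\<Sum>k=1..n. \<Sum>j=1..n. W n (real k / real n) (real j / real n)
        * (H_proj M X H n j (X n k \<omega>) - (LINT \<omega>'|M. H_proj M X H n j (X n k \<omega>'))))"

definition W_row :: "(nat \<Rightarrow> real \<Rightarrow> real \<Rightarrow> real) \<Rightarrow> nat \<Rightarrow> nat \<Rightarrow> real" where
  "W_row W n j =
     (if 1 \<le> j \<and> j \<le> n then \<Sum>i=1..n. \<bar>W n (real j / real n) (real i / real n)\<bar> else 0)"

definition W_total :: "(nat \<Rightarrow> real \<Rightarrow> real \<Rightarrow> real) \<Rightarrow> nat \<Rightarrow> real" where
  "W_total W n = (\<Sum>j=1..n. (W_row W n j)\<^sup>2)"

definition big_block :: "(nat \<Rightarrow> real \<Rightarrow> real \<Rightarrow> real) \<Rightarrow> (nat \<Rightarrow> nat) \<Rightarrow> (nat \<Rightarrow> nat) \<Rightarrow> nat \<Rightarrow> nat \<Rightarrow> real" where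
  "big_block W l m n j = (\<Sum>k=1..l n. (W_row W n ((l n + m n) * (j - 1) + k))\<^sup>2)"

definition small_block :: "(nat \<Rightarrow> real \<Rightarrow> real \<Rightarrow> real) \<Rightarrow> (nat \<Rightarrow> nat) \<Rightarrow> (nat \<Rightarrow> nat) \<Rightarrow> nat \<Rightarrow> nat \<Rightarrow> real" where
  "small_block W l m n j = (\<Sum>k=l n + 1..l n + m n. (W_row W n ((l n + m n) * (j - 1) + k))\<^sup>2)"

definition block_count :: "(nat \<Rightarrow> nat) \<Rightarrow> (nat \<Rightarrow> nat) \<Rightarrow> nat \<Rightarrow> nat" where
  "block_count l m n = nat \<lceil>real n / real (l n + m n)\<rceil>"

end

theory Submission
  imports Defs
begin

text \<open>
  Grouping the terms of the statistic by \<open>k\<close> writes it as \<open>\<Sum>k. w k * Z k\<close>, where \<open>w k\<close> is the row sum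
  \<^term>\<open>W_row W n k\<close> of the absolute weights and \<open>Z k\<close> is a centred function of the single variable \<open>X k\<close>.
  Since \<open>H x y = L x * L y * H\<^sup>* x y\<close> with \<open>H\<^sup>*\<close> bounded and \<open>\<eta>\<close>-Hoelder continuous, being in the Wiener
  ring (\<open>wiener_ring_bounded_hoelder\<close>), these functions have moments of an order \<open>p > 2\<close>, and a small change of
  \<open>X k\<close> changes them by a small amount in \<open>L\<^sup>p\<close>, uniformly in \<open>k\<close> and \<open>n\<close>. The proof is therefore one of a
  central limit theorem for weighted sums of short range dependent variables, with bounds in terms of
  \<open>\<Sum>k. (w k)\<^sup>2\<close> only.

  The dependence is handled by one coupling throughout. Renew all innovations up to time \<open>i\<close>, that is,
  replace them by their independent copies. The variables after time \<open>i\<close> then become independent of those up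
  to time \<open>i\<close> and keep their joint law, while geometric decay of the dependence measure implies
  that \<open>Z k\<close> moves by \<open>O (\<rho> ^ (k - i))\<close> in \<open>L\<^sup>p\<close> for some \<open>\<rho> < 1\<close> (\<open>renewal_moment_bound\<close>,
  \<open>coupled_array_of_smooth_functions\<close>). The locale \<open>coupled_array\<close> records these facts. They have
  three consequences:

  \<^item> covariances decay geometrically, so that the variance of a weighted sum is \<open>O (\<Sum>k. (w k)\<^sup>2)\<close>
    (\<open>covariance_le\<close>, \<open>wsum_variance_le\<close>);
  \<^item> the \<open>p\<close>-th absolute moment of a weighted sum is \<open>O ((\<Sum>k. (w k)\<^sup>2) powr (p / 2))\<close>
    (\<open>wsum_moment\<close>), proved by following a smooth version of the \<open>p\<close>-th power along the partial sums;
  \<^item> the characteristic function of a sum of blocks that are \<open>m\<close> apart is the product of the characteristic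
    functions of the blocks, up to \<open>O (\<rho> ^ m * (\<Sum>k. w k))\<close> (\<open>cf_bigs\<close>).

  Cut \<open>{1..n}\<close> into big blocks separated by small ones of length \<open>m\<close>, where \<open>m\<close> is large compared with \<open>ln n\<close>,
  so that even \<open>n\<^sup>2 * \<rho> ^ m\<close> vanishes. The small blocks are negligible in mean square. The big blocks
  are nearly independent, no single one of them carries a positive fraction of \<open>\<Sum>k. (w k)\<^sup>2\<close>, and that sum is
  of the order of the variance; hence Lyapunov's condition holds with exponent \<open>p\<close>. The characteristic functions
  converge, and the theorem is Levy's continuity theorem (\<open>block_clt\<close>).
\<close>

section \<open>A smooth substitute for the absolute power\<close>

text \<open>The function \<open>x \<mapsto> (1 + x\<^sup>2) powr (p / 2)\<close> is comparable with \<open>1 + \<bar>x\<bar> powr p\<close>, but it is twice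
  differentiable everywhere, so that Taylor expansions need no special treatment of the origin.\<close>

definition bracket_pow :: "real \<Rightarrow> real \<Rightarrow> real" where
  "bracket_pow p x = (1 + x\<^sup>2) powr (p / 2)"

definition bracket_pow' :: "real \<Rightarrow> real \<Rightarrow> real" where
  "bracket_pow' p x = p * x * (1 + x\<^sup>2) powr (p / 2 - 1)"

lemma bracket_pow_measurable [measurable]:
  "bracket_pow p \<in> borel_measurable borel" "bracket_pow' p \<in> borel_measurable borel"
  unfolding bracket_pow_def bracket_pow'_def by measurable

lemma one_plus_square_pos: "0 < 1 + (x::real)\<^sup>2"
  by (simp add: add_pos_nonneg)

lemma bracket_pow_derivative:
  "(bracket_pow p has_real_derivative bracket_pow' p x) (at x)"
  unfolding bracket_pow_def bracket_pow'_def
  using one_plus_square_pos[of x]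
  by (auto intro!: derivative_eq_intros simp: powr_diff field_simps)

lemma bracket_pow'_derivative:
  "(bracket_pow' p has_real_derivative
     (p * (1 + x\<^sup>2) powr (p / 2 - 1) + p * (p - 2) * x\<^sup>2 * (1 + x\<^sup>2) powr (p / 2 - 2))) (at x)"
proof -
  have "(1 + x\<^sup>2) powr (p / 2 - 1 - 1) = (1 + x\<^sup>2) powr (p / 2 - 2)"
    by (intro arg_cong2[where f="(powr)"]) auto
  then show ?thesis
    unfolding bracket_pow'_def
    using one_plus_square_pos[of x]
    by (auto intro!: derivative_eq_intros simp: powr_diff field_simps power2_eq_square)
qed

lemma bracket_pow_nonneg: "0 \<le> bracket_pow p x"
  by (simp add: bracket_pow_def)

lemma powr_le_bracket_pow:
  assumes "0 \<le> p" shows "\<bar>x\<bar> powr p \<le> bracket_pow p x"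
proof -
  have "\<bar>x\<bar> powr p = (x\<^sup>2) powr (p / 2)"
  proof (cases "x = 0")
    case False
    then have "x\<^sup>2 = \<bar>x\<bar> powr 2" by (simp add: powr_numeral)
    then have "(x\<^sup>2) powr (p / 2) = (\<bar>x\<bar> powr 2) powr (p / 2)" by simp
    then show ?thesis unfolding powr_powr by simp
  qed simp
  also have "\<dots> \<le> (1 + x\<^sup>2) powr (p / 2)"
    using assms by (intro powr_mono2) auto
  finally show ?thesis by (simp add: bracket_pow_def)
qed

lemma bracket_pow_le:
  assumes "0 \<le> p" shows "bracket_pow p x \<le> 2 powr p * (1 + \<bar>x\<bar> powr p)"
proof -
  have "1 + x\<^sup>2 \<le> (2 * max 1 \<bar>x\<bar>)\<^sup>2"
  proof -
    have "x\<^sup>2 \<le> (max 1 \<bar>x\<bar>)\<^sup>2" by (auto simp: abs_le_square_iff[symmetric])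
    moreover have "1 \<le> (max 1 \<bar>x\<bar>)\<^sup>2" by (rule one_le_power) simp
    moreover have "(2 * max 1 \<bar>x\<bar>)\<^sup>2 = 4 * (max 1 \<bar>x\<bar>)\<^sup>2" by (simp add: power_mult_distrib)
    ultimately show ?thesis by linarith
  qed
  then have "bracket_pow p x \<le> ((2 * max 1 \<bar>x\<bar>)\<^sup>2) powr (p / 2)"
    unfolding bracket_pow_def using assms by (intro powr_mono2) auto
  also have "\<dots> = ((2 * max 1 \<bar>x\<bar>) powr 2) powr (p / 2)"
    by (subst powr_numeral) auto
  also have "\<dots> = 2 powr p * max 1 \<bar>x\<bar> powr p"
    by (subst powr_powr) (simp add: powr_mult)
  also have "\<dots> \<le> 2 powr p * (1 + \<bar>x\<bar> powr p)"
    by (intro mult_left_mono) (auto simp: max_def)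
  finally show ?thesis .
qed

lemma abs_bracket_pow'_le:
  assumes "0 \<le> p" shows "\<bar>bracket_pow' p x\<bar> \<le> p * bracket_pow p x"
proof -
  have "\<bar>x\<bar> \<le> 1 + x\<^sup>2"
    using sum_power2_ge_zero[of "\<bar>x\<bar> - 1/2" 0] by (simp add: power2_eq_square algebra_simps)
  then have "p * (\<bar>x\<bar> * (1 + x\<^sup>2) powr (p / 2 - 1)) \<le> p * ((1 + x\<^sup>2) powr 1 * (1 + x\<^sup>2) powr (p / 2 - 1))"
    using assms by (intro mult_left_mono mult_right_mono) auto
  also have "\<dots> = p * bracket_pow p x"
    by (subst powr_add[symmetric]) (simp add: bracket_pow_def)
  finally show ?thesis using assms by (simp add: bracket_pow'_def abs_mult mult.assoc)
qed

text \<open>For \<open>2 < p \<le> 3\<close> the second derivative of \<^term>\<open>bracket_pow p\<close> between \<open>x\<close> and \<open>x + y\<close> is of the order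
  of this maximum to the power \<open>p - 2\<close>.\<close>

definition max1 :: "real \<Rightarrow> real \<Rightarrow> real" where
  "max1 x y = max 1 (max \<bar>x\<bar> \<bar>y\<bar>)"

lemma bracket_pow''_bound:
  assumes p: "2 < p" "p \<le> 3" and z: "\<bar>z\<bar> \<le> \<bar>x\<bar> + \<bar>y\<bar>"
  shows "\<bar>p * (1 + z\<^sup>2) powr (p / 2 - 1) + p * (p - 2) * z\<^sup>2 * (1 + z\<^sup>2) powr (p / 2 - 2)\<bar>
    \<le> 30 * max1 x y powr (p - 2)"
proof -
  let ?b = "(1 + z\<^sup>2) powr (p / 2 - 1)"
  have m: "1 \<le> max1 x y" by (simp add: max1_def)
  have "z\<^sup>2 * (1 + z\<^sup>2) powr (p / 2 - 2) \<le> (1 + z\<^sup>2) powr 1 * (1 + z\<^sup>2) powr (p / 2 - 2)"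
    by (intro mult_right_mono) auto
  also have "\<dots> = ?b" by (subst powr_add[symmetric]) simp
  finally have "p * (p - 2) * (z\<^sup>2 * (1 + z\<^sup>2) powr (p / 2 - 2)) \<le> p * (p - 2) * ?b"
    using p by (intro mult_left_mono) auto
  then have "p * ?b + p * (p - 2) * z\<^sup>2 * (1 + z\<^sup>2) powr (p / 2 - 2) \<le> (p * (p - 1)) * ?b"
    by (simp add: algebra_simps)
  moreover have "0 \<le> p * ?b + p * (p - 2) * z\<^sup>2 * (1 + z\<^sup>2) powr (p / 2 - 2)"
    using p by (intro add_nonneg_nonneg mult_nonneg_nonneg) auto
  ultimately have "\<bar>p * ?b + p * (p - 2) * z\<^sup>2 * (1 + z\<^sup>2) powr (p / 2 - 2)\<bar> \<le> (p * (p - 1)) * ?b"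
    by linarith
  also have "\<dots> \<le> 6 * ?b"
    using p mult_mono[of p 3 "p - 1" 2] by (intro mult_right_mono) auto
  also have "?b \<le> (5 * (max1 x y)\<^sup>2) powr (p / 2 - 1)"
  proof (intro powr_mono2)
    have "\<bar>z\<bar> \<le> 2 * max1 x y" using z by (auto simp: max1_def)
    then have "\<bar>z\<bar>\<^sup>2 \<le> (2 * max1 x y)\<^sup>2" by (intro power_mono) auto
    moreover have "1 \<le> (max1 x y)\<^sup>2" using m by (simp add: one_le_power)
    ultimately show "1 + z\<^sup>2 \<le> 5 * (max1 x y)\<^sup>2" by (simp add: power_mult_distrib)
  qed (use p in auto)
  also have "\<dots> = 5 powr (p / 2 - 1) * (max1 x y powr 2) powr (p / 2 - 1)"
    using m by (subst powr_numeral) (auto simp: powr_mult)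
  also have "\<dots> = 5 powr (p / 2 - 1) * max1 x y powr (p - 2)"
    by (subst powr_powr) (simp add: algebra_simps)
  also have "\<dots> \<le> 5 powr 1 * max1 x y powr (p - 2)"
    using p by (intro mult_right_mono powr_mono) auto
  finally show ?thesis by simp
qed

text \<open>The mean value theorem. With \<open>x\<close> a partial sum and \<open>y\<close> its next summand, this is what makes the
  telescoped drift in the moment inequality below linear in the summand.\<close>

lemma bracket_pow'_increment:
  assumes p: "2 < p" "p \<le> 3"
  shows "\<bar>bracket_pow' p (x + y) - bracket_pow' p x\<bar> \<le> 30 * max1 x y powr (p - 2) * \<bar>y\<bar>"
proof -
  let ?f' = "\<lambda>x. p * (1 + x\<^sup>2) powr (p / 2 - 1) + p * (p - 2) * x\<^sup>2 * (1 + x\<^sup>2) powr (p / 2 - 2)"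
  have "norm (bracket_pow' p (x + y) - bracket_pow' p x)
      \<le> 30 * max1 x y powr (p - 2) * norm (x + y - x)"
  proof (rule field_differentiable_bound[where S="{min x (x+y)..max x (x+y)}"])
    fix z assume z: "z \<in> {min x (x+y)..max x (x+y)}"
    show "(bracket_pow' p has_field_derivative ?f' z) (at z within {min x (x+y)..max x (x+y)})"
      using bracket_pow'_derivative by (rule has_field_derivative_at_within)
    show "norm (?f' z) \<le> 30 * max1 x y powr (p - 2)"
      unfolding real_norm_def by (rule bracket_pow''_bound[OF p]) (use z in auto)
  qed auto
  then show ?thesis by simp
qed

lemma bracket_pow_taylor:
  assumes p: "2 < p" "p \<le> 3"
  shows "bracket_pow p (x + y) \<le> bracket_pow p x + bracket_pow' p x * y + 30 * max1 x y powr (p - 2) * y\<^sup>2"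
proof -
  obtain \<theta> where \<theta>: "0 \<le> \<theta>" "\<theta> \<le> 1"
    and mvt: "bracket_pow p (x + y) - bracket_pow p x = y * bracket_pow' p (x + \<theta> * y)"
  proof -
    define g where "g t = bracket_pow p (x + t * y)" for t
    have "(g has_real_derivative (y * bracket_pow' p (x + t * y))) (at t)" for t
    proof -
      have "((\<lambda>t. x + t * y) has_real_derivative y) (at t)"
        by (auto intro!: derivative_eq_intros)
      from DERIV_chain2[OF bracket_pow_derivative this] show ?thesis
        unfolding g_def by (simp add: mult.commute)
    qed
    then obtain t where "0 < t" "t < 1" "g 1 - g 0 = (1 - 0) * (y * bracket_pow' p (x + t * y))"
      using MVT2[of 0 1 g "\<lambda>t. y * bracket_pow' p (x + t * y)"] by auto
    then show ?thesis using that[of t] by (auto simp: g_def)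
  qed
  have "\<bar>bracket_pow' p (x + \<theta> * y) - bracket_pow' p x\<bar> \<le> 30 * max1 x (\<theta> * y) powr (p - 2) * \<bar>\<theta> * y\<bar>"
    by (rule bracket_pow'_increment[OF p])
  also have "\<dots> \<le> 30 * max1 x y powr (p - 2) * \<bar>y\<bar>"
  proof -
    have "\<bar>\<theta> * y\<bar> \<le> \<bar>y\<bar>" using \<theta> by (simp add: abs_mult mult_left_le_one_le)
    then show ?thesis
      using p by (intro mult_mono powr_mono2) (auto simp: max1_def)
  qed
  finally have "\<bar>y * (bracket_pow' p (x + \<theta> * y) - bracket_pow' p x)\<bar>
      \<le> \<bar>y\<bar> * (30 * max1 x y powr (p - 2) * \<bar>y\<bar>)"
    unfolding abs_mult[of y] by (intro mult_left_mono) auto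
  also have "\<dots> = 30 * max1 x y powr (p - 2) * y\<^sup>2" by (simp add: power2_eq_square)
  finally show ?thesis using mvt by (auto simp: algebra_simps)
qed

text \<open>Young's inequality for the exponents \<open>p / (p - 2)\<close>, \<open>p\<close>, \<open>p\<close>, with the weight of \<open>x\<close> as small as desired.
  The small multiple of the moment of \<open>x\<close> is absorbed into the left-hand side of the moment inequality.\<close>

lemma max1_young:
  assumes p: "2 < p" and \<tau>: "0 < \<tau>"
  shows "\<exists>K\<ge>0. \<forall>x y z. max1 x y powr (p - 2) * (\<bar>y\<bar> * \<bar>z\<bar>)
           \<le> \<tau> * \<bar>x\<bar> powr p + K * (1 + \<bar>y\<bar> powr p + \<bar>z\<bar> powr p)"
proof -
  \<comment> \<open>If \<open>\<bar>x\<bar>\<close> exceeds \<open>K\<close> times the other two and \<open>K\<close> itself, then \<open>\<bar>y\<bar> * \<bar>z\<bar> \<le> (\<bar>x\<bar> / K)\<^sup>2 \<le> \<tau> * \<bar>x\<bar>\<^sup>2\<close>;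
      otherwise the left-hand side is bounded in terms of \<open>y\<close> and \<open>z\<close> alone.\<close>
  define K where "K = max 1 (1 / sqrt \<tau>)"
  have K: "1 \<le> K" "1 \<le> \<tau> * K\<^sup>2"
  proof -
    show "1 \<le> K" by (simp add: K_def)
    have "(1 / sqrt \<tau>)\<^sup>2 \<le> K\<^sup>2" using \<tau> by (intro power_mono) (auto simp: K_def)
    moreover have "(1 / sqrt \<tau>)\<^sup>2 = 1 / \<tau>" using \<tau> by (simp add: power_divide)
    ultimately show "1 \<le> \<tau> * K\<^sup>2" using \<tau> by (simp add: field_simps)
  qed
  have "max1 x y powr (p - 2) * (\<bar>y\<bar> * \<bar>z\<bar>)
      \<le> \<tau> * \<bar>x\<bar> powr p + K powr (p - 2) * (1 + \<bar>y\<bar> powr p + \<bar>z\<bar> powr p)" for x y z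
  proof -
    define u where "u = max 1 (max \<bar>y\<bar> \<bar>z\<bar>)"
    have u: "1 \<le> u" "\<bar>y\<bar> \<le> u" "\<bar>z\<bar> \<le> u" by (auto simp: u_def)
    have yz: "\<bar>y\<bar> * \<bar>z\<bar> \<le> u powr 2"
      using u by (simp add: powr_numeral power2_eq_square mult_mono)
    have up: "u powr p \<le> 1 + \<bar>y\<bar> powr p + \<bar>z\<bar> powr p"
      by (auto simp: u_def max_def)
    show ?thesis
    proof (cases "\<bar>x\<bar> \<le> K * u")
      case True
      have "max1 x y \<le> K * u"
        using True u K mult_mono[of 1 K 1 u] mult_mono[of 1 K "\<bar>y\<bar>" u] by (auto simp: max1_def)
      then have "max1 x y powr (p - 2) * (\<bar>y\<bar> * \<bar>z\<bar>) \<le> (K * u) powr (p - 2) * u powr 2"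
        using yz p by (intro mult_mono powr_mono2) (auto simp: max1_def)
      also have "\<dots> = K powr (p - 2) * u powr p"
        using K u by (simp add: powr_mult mult.assoc powr_add[symmetric] del: powr_numeral)
      also have "\<dots> \<le> K powr (p - 2) * (1 + \<bar>y\<bar> powr p + \<bar>z\<bar> powr p)"
        using up by (intro mult_left_mono) auto
      finally have "max1 x y powr (p - 2) * (\<bar>y\<bar> * \<bar>z\<bar>)
          \<le> K powr (p - 2) * (1 + \<bar>y\<bar> powr p + \<bar>z\<bar> powr p)" .
      moreover have "0 \<le> \<tau> * \<bar>x\<bar> powr p" using \<tau> by simp
      ultimately show ?thesis by linarith
    next
      case False
      have x: "u \<le> \<bar>x\<bar>" using False K u mult_right_mono[of 1 K u] by linarith
      have "u powr 2 * K\<^sup>2 = (K * u)\<^sup>2" using u by (simp add: powr_numeral power_mult_distrib)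
      also have "\<dots> \<le> \<bar>x\<bar>\<^sup>2" using False u K by (intro power_mono) auto
      also have "\<dots> = \<bar>x\<bar> powr 2" using x u by (simp add: powr_numeral)
      finally have ux: "u powr 2 * K\<^sup>2 \<le> \<bar>x\<bar> powr 2" .
      have "u powr 2 \<le> (\<tau> * K\<^sup>2) * u powr 2"
        using K(2) mult_right_mono[of 1 "\<tau> * K\<^sup>2" "u powr 2"] by simp
      also have "\<dots> \<le> \<tau> * \<bar>x\<bar> powr 2" using mult_left_mono[OF ux, of \<tau>] \<tau> by (simp add: mult_ac)
      finally have "\<bar>y\<bar> * \<bar>z\<bar> \<le> \<tau> * \<bar>x\<bar> powr 2" using yz by linarith
      moreover have "max1 x y powr (p - 2) \<le> \<bar>x\<bar> powr (p - 2)"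
        using p x u by (intro powr_mono2) (auto simp: max1_def)
      ultimately have "max1 x y powr (p - 2) * (\<bar>y\<bar> * \<bar>z\<bar>) \<le> \<bar>x\<bar> powr (p - 2) * (\<tau> * \<bar>x\<bar> powr 2)"
        by - (rule mult_mono, auto)
      also have "\<dots> = \<tau> * \<bar>x\<bar> powr p"
        using x u by (simp add: powr_add[symmetric] mult.left_commute del: powr_numeral)
      finally have "max1 x y powr (p - 2) * (\<bar>y\<bar> * \<bar>z\<bar>) \<le> \<tau> * \<bar>x\<bar> powr p" .
      moreover have "0 \<le> K powr (p - 2) * (1 + \<bar>y\<bar> powr p + \<bar>z\<bar> powr p)" by simp
      ultimately show ?thesis by linarith
    qed
  qed
  moreover have "0 \<le> K powr (p - 2)" by simp
  ultimately show ?thesis by blast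
qed

lemma powr_add_le:
  fixes x y p :: real assumes "0 \<le> p"
  shows "\<bar>x + y\<bar> powr p \<le> 2 powr p * (\<bar>x\<bar> powr p + \<bar>y\<bar> powr p)"
proof -
  have "\<bar>x + y\<bar> powr p \<le> (2 * max \<bar>x\<bar> \<bar>y\<bar>) powr p"
    using assms by (intro powr_mono2) auto
  also have "\<dots> = 2 powr p * max \<bar>x\<bar> \<bar>y\<bar> powr p" by (simp add: powr_mult)
  also have "\<dots> \<le> 2 powr p * (\<bar>x\<bar> powr p + \<bar>y\<bar> powr p)"
    by (intro mult_left_mono) (auto simp: max_def)
  finally show ?thesis .
qed

lemma powr_le_1_plus_powr:
  fixes x a b :: real assumes "0 \<le> x" "0 \<le> a" "a \<le> b"
  shows "x powr a \<le> 1 + x powr b"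
proof (cases "x \<le> 1")
  case True
  then have "x powr a \<le> 1" using assms by (intro powr_le1) auto
  moreover have "0 \<le> x powr b" by simp
  ultimately show ?thesis by linarith
next
  case False
  then have "x powr a \<le> x powr b" using assms by (intro powr_mono) auto
  then show ?thesis by linarith
qed

section \<open>Innovations renewed up to a given time\<close>

locale innovations = prob_space M
  for M :: "'a measure" and \<epsilon> \<epsilon>' :: "int \<Rightarrow> 'a \<Rightarrow> real" +
  assumes indep: "indep_vars (\<lambda>_. borel) (case_sum \<epsilon> \<epsilon>') (UNIV :: (int + int) set)"
    and law: "\<And>k. distr M borel (\<epsilon> k) = distr M borel (\<epsilon> 0)"
    and copy: "\<And>k. distr M borel (\<epsilon>' k) = distr M borel (\<epsilon> 0)"

sublocale piecewise_locally_stationary \<subseteq> innovations M \<epsilon> \<epsilon>'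
  by unfold_locales (fact innovations_indep innovations_law copy_law)+

abbreviation seq_borel :: "('i \<Rightarrow> real) measure" where
  "seq_borel \<equiv> PiM UNIV (\<lambda>_. borel)"

context innovations
begin

definition renewed :: "int set \<Rightarrow> int \<Rightarrow> 'a \<Rightarrow> real" where
  "renewed A j = (if j \<in> A then \<epsilon>' j else \<epsilon> j)"

text \<open>The index, in the joint family of innovations and copies, of the variable that is used at time
  \<open>j\<close> once the innovations at the times in \<open>A\<close> have been renewed.\<close>

definition renewed_index :: "int set \<Rightarrow> int \<Rightarrow> int + int" where
  "renewed_index A j = (if j \<in> A then Inr j else Inl j)"

lemma renewed_eq_index: "renewed A j = case_sum \<epsilon> \<epsilon>' (renewed_index A j)"
  by (simp add: renewed_def renewed_index_def)

lemma renewed_empty [simp]: "renewed {} = \<epsilon>"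
  by (simp add: renewed_def fun_eq_iff)

lemma inj_renewed_index: "inj (renewed_index A)"
  by (auto simp: inj_def renewed_index_def split: if_splits)

lemma innovation_measurable [measurable]: "case_sum \<epsilon> \<epsilon>' s \<in> borel_measurable M"
  using indep by (auto simp: indep_vars_def)

lemma renewed_measurable [measurable]: "renewed A j \<in> borel_measurable M"
  by (simp add: renewed_eq_index)

lemma past_measurable [measurable]: "past (renewed A) k \<in> measurable M seq_borel"
  unfolding past_def by (rule measurable_PiM_single') auto

lemma past_innovations_measurable [measurable]: "past \<epsilon> k \<in> measurable M seq_borel"
  using past_measurable[of "{}"] by simp

text \<open>Any choice of pairwise different variables from the two sequences has the same law. All the
  equalities in law below are instances of this.\<close>

lemma law_reindex:
  fixes \<phi> :: "'j \<Rightarrow> int + int"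
  assumes "inj \<phi>"
  shows "distr M seq_borel (\<lambda>\<omega> s. case_sum \<epsilon> \<epsilon>' (\<phi> s) \<omega>) = PiM UNIV (\<lambda>_. distr M borel (\<epsilon> 0))"
proof -
  let ?E = "\<lambda>\<omega> s. case_sum \<epsilon> \<epsilon>' s \<omega>" and ?\<nu> = "distr M borel (\<epsilon> 0)"
  have one: "distr M borel (case_sum \<epsilon> \<epsilon>' s) = ?\<nu>" for s
    using law copy by (cases s) auto
  have E: "?E \<in> measurable M seq_borel"
    by (rule measurable_PiM_single') auto
  have "distr M seq_borel (\<lambda>\<omega>. \<lambda>s\<in>UNIV. case_sum \<epsilon> \<epsilon>' s \<omega>)
      = PiM UNIV (\<lambda>s. distr M borel (case_sum \<epsilon> \<epsilon>' s))"
    using indep by (subst (asm) indep_vars_iff_distr_eq_PiM') auto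
  then have all: "distr M seq_borel ?E = PiM UNIV (\<lambda>_. ?\<nu>)"
    by (simp add: one restrict_def)
  have innovations_law_prob: "prob_space ?\<nu>"
    using innovation_measurable[of "Inl 0"] by (intro prob_space_distr) simp
  have "distr M seq_borel (\<lambda>\<omega> s. ?E \<omega> (\<phi> s)) = distr (distr M seq_borel ?E) seq_borel (\<lambda>y s. y (\<phi> s))"
    using E by (subst distr_distr) (auto simp: comp_def intro!: measurable_PiM_single')
  also have "\<dots> = distr (PiM UNIV (\<lambda>_. ?\<nu>)) (PiM UNIV (\<lambda>_. ?\<nu>)) (\<lambda>y. \<lambda>s\<in>UNIV. y (\<phi> s))"
    unfolding all by (rule distr_cong) (auto intro!: sets_PiM_cong)
  also have "\<dots> = PiM UNIV (\<lambda>_. ?\<nu>)"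
    by (rule distr_PiM_reindex) (use assms innovations_law_prob in auto)
  finally show ?thesis .
qed

lemma past_law: "distr M seq_borel (past (renewed A) k) = PiM UNIV (\<lambda>_. distr M borel (\<epsilon> 0))"
proof -
  have "inj (\<lambda>i. renewed_index A (k - int i))"
    by (auto simp: inj_def renewed_index_def split: if_splits)
  from law_reindex[OF this] show ?thesis
    by (simp add: past_def[abs_def] renewed_eq_index)
qed

text \<open>The joint law of two renewed pasts depends only on the lags at which they disagree: each past is
  an i.i.d. sequence, the two share a coordinate where they agree, and use independent variables where
  they differ. This covers shifts in time as well as the removal of common renewals.\<close>

lemma past_pair_law:
  assumes agree: "\<And>i. (k - int i \<in> A \<longleftrightarrow> k - int i \<in> B) \<longleftrightarrow> (k' - int i \<in> A' \<longleftrightarrow> k' - int i \<in> B')"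
  shows "distr M (seq_borel \<Otimes>\<^sub>M seq_borel) (\<lambda>\<omega>. (past (renewed A) k \<omega>, past (renewed B) k \<omega>))
       = distr M (seq_borel \<Otimes>\<^sub>M seq_borel) (\<lambda>\<omega>. (past (renewed A') k' \<omega>, past (renewed B') k' \<omega>))"
proof -
  define S where "S = {i. k - int i \<in> A \<longleftrightarrow> k - int i \<in> B}"
  \<comment> \<open>The left summand carries the first past, the right one the opposite variables, which the second
      past uses exactly at the lags outside \<open>S\<close>.\<close>
  define \<Phi> :: "(nat + nat \<Rightarrow> real) \<Rightarrow> (nat \<Rightarrow> real) \<times> (nat \<Rightarrow> real)"
    where "\<Phi> y = (\<lambda>i. y (Inl i), \<lambda>i. if i \<in> S then y (Inl i) else y (Inr i))" for y
  define \<phi> where "\<phi> A k = case_sum (\<lambda>i. renewed_index A (k - int i)) (\<lambda>i. renewed_index (- A) (k - int i))" for A k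
  have \<Phi>: "\<Phi> \<in> measurable seq_borel (seq_borel \<Otimes>\<^sub>M seq_borel)"
    unfolding \<Phi>_def
    by (intro measurable_Pair measurable_PiM_single') auto
  have inj: "inj (\<phi> A k)" for A k
    by (auto simp: inj_def \<phi>_def renewed_index_def split: sum.splits if_splits)
  have key: "distr M (seq_borel \<Otimes>\<^sub>M seq_borel) (\<lambda>\<omega>. (past (renewed A) k \<omega>, past (renewed B) k \<omega>))
      = distr (PiM UNIV (\<lambda>_. distr M borel (\<epsilon> 0))) (seq_borel \<Otimes>\<^sub>M seq_borel) \<Phi>"
    if S: "S = {i. k - int i \<in> A \<longleftrightarrow> k - int i \<in> B}" for A B k
  proof -
    have "(\<lambda>\<omega>. (past (renewed A) k \<omega>, past (renewed B) k \<omega>))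
        = \<Phi> \<circ> (\<lambda>\<omega> s. case_sum \<epsilon> \<epsilon>' (\<phi> A k s) \<omega>)"
      by (auto simp: fun_eq_iff \<Phi>_def \<phi>_def S past_def renewed_def renewed_index_def)
    moreover have "(\<lambda>\<omega> s. case_sum \<epsilon> \<epsilon>' (\<phi> A k s) \<omega>) \<in> measurable M seq_borel"
      by (rule measurable_PiM_single') auto
    ultimately show ?thesis
      using distr_distr[OF \<Phi>, of "\<lambda>\<omega> s. case_sum \<epsilon> \<epsilon>' (\<phi> A k s) \<omega>" M]
      by (simp add: law_reindex[OF inj])
  qed
  show ?thesis
    using key[OF S_def] key[of k' A' B'] agree by (simp add: S_def)
qed

lemma past_pair_nn_integral:
  assumes agree: "\<And>i. (k - int i \<in> A \<longleftrightarrow> k - int i \<in> B) \<longleftrightarrow> (k' - int i \<in> A' \<longleftrightarrow> k' - int i \<in> B')"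
    and F [measurable]: "(\<lambda>(x, y). F x y) \<in> borel_measurable (seq_borel \<Otimes>\<^sub>M seq_borel)"
  shows "(\<integral>\<^sup>+\<omega>. F (past (renewed A) k \<omega>) (past (renewed B) k \<omega>) \<partial>M)
       = (\<integral>\<^sup>+\<omega>. F (past (renewed A') k' \<omega>) (past (renewed B') k' \<omega>) \<partial>M)"
proof -
  have "(\<integral>\<^sup>+\<omega>. F (past (renewed A) k \<omega>) (past (renewed B) k \<omega>) \<partial>M)
     = (\<integral>\<^sup>+z. (case z of (x, y) \<Rightarrow> F x y) \<partial>distr M (seq_borel \<Otimes>\<^sub>M seq_borel) (\<lambda>\<omega>. (past (renewed A) k \<omega>, past (renewed B) k \<omega>)))"
    for A B k
    by (subst nn_integral_distr) auto
  then show ?thesis by (simp add: past_pair_law[OF agree])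
qed

lemma past_integral:
  fixes f :: "(nat \<Rightarrow> real) \<Rightarrow> real"
  assumes [measurable]: "f \<in> borel_measurable seq_borel"
  shows "(\<integral>\<omega>. f (past (renewed A) k \<omega>) \<partial>M) = (\<integral>x. f x \<partial>PiM UNIV (\<lambda>_. distr M borel (\<epsilon> 0)))"
    and "integrable M (\<lambda>\<omega>. f (past (renewed A) k \<omega>)) \<longleftrightarrow> integrable (PiM UNIV (\<lambda>_. distr M borel (\<epsilon> 0))) f"
  unfolding past_law[of A k, symmetric]
  by (simp_all add: integral_distr integrable_distr_eq)


section \<open>Forgetting the remote past\<close>

abbreviation law_past :: "(nat \<Rightarrow> real) measure" where
  "law_past \<equiv> PiM UNIV (\<lambda>_. distr M borel (\<epsilon> 0))"

lemma prob_space_law_past: "prob_space law_past"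
  unfolding past_law[of "{}" 0, symmetric] by (rule prob_space_distr) simp

text \<open>A function of the whole past forgets the tail if renewing all innovations that are at least \<open>J\<close> steps
  old changes it, on average, by an amount that vanishes as \<open>J\<close> grows. For cylinder functions the
  change is eventually zero, and the property passes to limits in mean, hence to all integrable
  functions.\<close>

definition forgets_tail :: "((nat \<Rightarrow> real) \<Rightarrow> real) \<Rightarrow> bool" where
  "forgets_tail f \<longleftrightarrow>
     (\<forall>k. (\<lambda>J. \<integral>\<omega>. \<bar>f (past \<epsilon> k \<omega>) - f (past (renewed {..k - int J}) k \<omega>)\<bar> \<partial>M) \<longlonglongrightarrow> 0)"

lemma measurable_law_past: "f \<in> borel_measurable law_past \<longleftrightarrow> f \<in> borel_measurable seq_borel"
  by (intro arg_cong2[where f="(\<in>)"] refl measurable_cong_sets sets_PiM_cong) auto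

lemma past_integrable:
  fixes f :: "(nat \<Rightarrow> real) \<Rightarrow> real"
  assumes "integrable law_past f"
  shows "integrable M (\<lambda>\<omega>. f (past (renewed A) k \<omega>))"
  using assms past_integral(2)[of f A k] borel_measurable_integrable[OF assms]
  by (simp add: measurable_law_past)

text \<open>The renewed past has the same law as the original one, so that the
  error of the approximation is the same before and after the renewal.\<close>

lemma forgets_tail_lim:
  assumes s: "\<And>i. forgets_tail (s i)" "\<And>i. integrable law_past (s i)"
    and f: "integrable law_past f"
    and lim: "(\<lambda>i. \<integral>x. \<bar>f x - s i x\<bar> \<partial>law_past) \<longlonglongrightarrow> 0"
  shows "forgets_tail f"
  unfolding forgets_tail_def
proof (intro allI LIMSEQ_I)
  fix k and e :: real assume e: "0 < e"
  let ?g = "\<lambda>f J \<omega>. \<bar>f (past \<epsilon> k \<omega>) - f (past (renewed {..k - int J}) k \<omega>)\<bar>"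
  obtain i where i: "(\<integral>x. \<bar>f x - s i x\<bar> \<partial>law_past) < e / 3"
    using LIMSEQ_D[OF lim, of "e / 3"] e by force
  obtain J0 where J0: "\<And>J. J \<ge> J0 \<Longrightarrow> (\<integral>\<omega>. ?g (s i) J \<omega> \<partial>M) < e / 3"
    using LIMSEQ_D[OF s(1)[unfolded forgets_tail_def, rule_format, of i k], of "e / 3"] e by force
  have d: "integrable law_past (\<lambda>x. \<bar>f x - s i x\<bar>)"
    using f s(2)[of i] by auto
  have [simp]: "integrable M (\<lambda>\<omega>. f (past (renewed A) k \<omega>))" "integrable M (\<lambda>\<omega>. s i (past (renewed A) k \<omega>))"
    "integrable M (\<lambda>\<omega>. f (past \<epsilon> k \<omega>))" "integrable M (\<lambda>\<omega>. s i (past \<epsilon> k \<omega>))" for A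
    using past_integrable[OF f] past_integrable[OF s(2)]
      past_integrable[OF f, of "{}"] past_integrable[OF s(2), of i "{}"] by simp_all
  have de: "(\<integral>\<omega>. \<bar>f (past (renewed A) k \<omega>) - s i (past (renewed A) k \<omega>)\<bar> \<partial>M) < e / 3" for A
    using i past_integral(1)[of "\<lambda>x. \<bar>f x - s i x\<bar>" A k] borel_measurable_integrable[OF d]
    by (simp add: measurable_law_past)
  show "\<exists>J0. \<forall>J\<ge>J0. norm ((\<integral>\<omega>. ?g f J \<omega> \<partial>M) - 0) < e"
  proof (intro exI allI impI)
    fix J assume "J0 \<le> J"
    let ?A = "{..k - int J}"
    have "(\<integral>\<omega>. ?g f J \<omega> \<partial>M) \<le> (\<integral>\<omega>. \<bar>f (past \<epsilon> k \<omega>) - s i (past \<epsilon> k \<omega>)\<bar> + ?g (s i) J \<omega>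
        + \<bar>f (past (renewed ?A) k \<omega>) - s i (past (renewed ?A) k \<omega>)\<bar> \<partial>M)"
      by (rule integral_mono) auto
    also have "\<dots> = (\<integral>\<omega>. \<bar>f (past \<epsilon> k \<omega>) - s i (past \<epsilon> k \<omega>)\<bar> \<partial>M) + (\<integral>\<omega>. ?g (s i) J \<omega> \<partial>M)
        + (\<integral>\<omega>. \<bar>f (past (renewed ?A) k \<omega>) - s i (past (renewed ?A) k \<omega>)\<bar> \<partial>M)"
      by simp
    also have "\<dots> < e"
      using J0[OF \<open>J0 \<le> J\<close>] de[of ?A] de[of "{}"] by simp
    finally show "norm ((\<integral>\<omega>. ?g f J \<omega> \<partial>M) - 0) < e"
      by simp
  qed
qed

lemma forgets_tail_dominated_lim:
  assumes s: "\<And>i. forgets_tail (s i)" "\<And>i. integrable law_past (s i)"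
    and f: "integrable law_past f" and w: "integrable law_past w"
    and lim: "\<And>x. (\<lambda>i. s i x) \<longlonglongrightarrow> f x" and dom: "\<And>i x. \<bar>s i x\<bar> \<le> w x"
  shows "forgets_tail f"
proof (rule forgets_tail_lim[OF s f])
  have "(\<lambda>i. \<integral>x. \<bar>f x - s i x\<bar> \<partial>law_past) \<longlonglongrightarrow> (\<integral>x. 0 \<partial>law_past)"
  proof (rule integral_dominated_convergence[where w="\<lambda>x. \<bar>f x\<bar> + w x"])
    show "AE x in law_past. (\<lambda>i. \<bar>f x - s i x\<bar>) \<longlonglongrightarrow> 0"
    proof (rule AE_I2)
      show "(\<lambda>i. \<bar>f x - s i x\<bar>) \<longlonglongrightarrow> 0" for x
        using tendsto_rabs[OF tendsto_diff[OF tendsto_const[of "f x"] lim[of x]]] by simp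
    qed
    show "AE x in law_past. norm \<bar>f x - s i x\<bar> \<le> \<bar>f x\<bar> + w x" for i
      using dom[of i] by (auto intro!: AE_I2 order_trans[OF abs_triangle_ineq4] add_left_mono)
    show "(\<lambda>x. \<bar>f x - s i x\<bar>) \<in> borel_measurable law_past" for i
      using f s(2)[of i] by measurable
  qed (use f w in auto)
  then show "(\<lambda>i. \<integral>x. \<bar>f x - s i x\<bar> \<partial>law_past) \<longlonglongrightarrow> 0" by simp
qed

lemma indicator_integrable_law_past:
  assumes "A \<in> sets seq_borel"
  shows "integrable law_past (indicator A :: _ \<Rightarrow> real)"
proof -
  interpret L: prob_space law_past by (rule prob_space_law_past)
  have "sets law_past = sets seq_borel" by (intro sets_PiM_cong) auto
  then show ?thesis using assms by (intro L.integrable_const_bound[of _ 1]) (auto simp: indicator_def)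
qed

lemma forgets_tail_comparison:
  assumes "finite I" "\<And>i. i \<in> I \<Longrightarrow> forgets_tail (g i)" "\<And>i. i \<in> I \<Longrightarrow> integrable law_past (g i)"
    and f: "f \<in> borel_measurable seq_borel"
    and le: "\<And>x y. \<bar>f x - f y\<bar> \<le> (\<Sum>i\<in>I. \<bar>g i x - g i y\<bar>)"
  shows "forgets_tail f"
  unfolding forgets_tail_def
proof
  fix k
  let ?g = "\<lambda>f J \<omega>. \<bar>f (past \<epsilon> k \<omega>) - f (past (renewed {..k - int J}) k \<omega>)\<bar>"
  note f[measurable]
  have g: "integrable M (?g (g i) J)" if "i \<in> I" for i J
    using past_integrable[OF assms(3)[OF that], of "{}"] past_integrable[OF assms(3)[OF that]] by auto
  show "(\<lambda>J. \<integral>\<omega>. ?g f J \<omega> \<partial>M) \<longlonglongrightarrow> 0"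
  proof (rule tendsto_sandwich[where f="\<lambda>_. 0"])
    show "(\<lambda>J. \<Sum>i\<in>I. \<integral>\<omega>. ?g (g i) J \<omega> \<partial>M) \<longlonglongrightarrow> 0"
      using assms(2) by (intro tendsto_null_sum) (auto simp: forgets_tail_def)
    show "\<forall>\<^sub>F J in sequentially. (\<integral>\<omega>. ?g f J \<omega> \<partial>M) \<le> (\<Sum>i\<in>I. \<integral>\<omega>. ?g (g i) J \<omega> \<partial>M)"
    proof (intro always_eventually allI)
      fix J
      have "integrable M (\<lambda>\<omega>. \<Sum>i\<in>I. ?g (g i) J \<omega>)" using g by auto
      then have "(\<integral>\<omega>. ?g f J \<omega> \<partial>M) \<le> (\<integral>\<omega>. (\<Sum>i\<in>I. ?g (g i) J \<omega>) \<partial>M)"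
        by (rule integral_mono[rotated]) (use le in \<open>auto intro: Bochner_Integration.integrable_bound[OF \<open>integrable M (\<lambda>\<omega>. \<Sum>i\<in>I. ?g (g i) J \<omega>)\<close>]\<close>)
      then show "(\<integral>\<omega>. ?g f J \<omega> \<partial>M) \<le> (\<Sum>i\<in>I. \<integral>\<omega>. ?g (g i) J \<omega> \<partial>M)"
        using g by simp
    qed
  qed auto
qed

lemma indicator_forgets_tail:
  assumes A: "A \<in> sets seq_borel"
  shows "forgets_tail (indicator A)"
  using A unfolding sets_PiM_single
proof induction
  case (Basic A)
  then obtain i B where B: "B \<in> sets borel" and A: "A = {f \<in> \<Pi>\<^sub>E i\<in>UNIV. space borel. f i \<in> B}" by auto
  show ?case
    unfolding forgets_tail_def
  proof
    fix k
    have "\<forall>\<^sub>F J in sequentially. (\<integral>\<omega>. \<bar>indicator A (past \<epsilon> k \<omega>) - indicator A (past (renewed {..k - int J}) k \<omega>)\<bar> \<partial>M) = (0::real)"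
      using eventually_gt_at_top[of i]
    proof eventually_elim
      case (elim J)
      have "indicator A (past \<epsilon> k \<omega>) = (indicator A (past (renewed {..k - int J}) k \<omega>) :: real)" for \<omega>
        using elim by (auto simp: A past_def renewed_def indicator_def)
      then show ?case by simp
    qed
    then show "(\<lambda>J. \<integral>\<omega>. \<bar>indicator A (past \<epsilon> k \<omega>) - indicator A (past (renewed {..k - int J}) k \<omega>)\<bar> \<partial>M) \<longlonglongrightarrow> (0::real)"
      by (rule tendsto_eventually)
  qed
next
  case Empty
  show ?case by (simp add: forgets_tail_def)
next
  case (Compl A)
  then have A: "A \<in> sets seq_borel" by (simp add: sets_PiM_single)
  then have "indicator (space seq_borel - A) \<in> borel_measurable seq_borel" by simp
  then have "forgets_tail (indicator (space seq_borel - A))"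
    by (rule forgets_tail_comparison[where I="{()}" and g="\<lambda>_. indicator A", rotated 3])
       (use Compl indicator_integrable_law_past[OF A] in \<open>auto simp: space_PiM split: split_indicator\<close>)
  then show ?case by (simp add: space_PiM)
next
  case (Union A)
  then have A: "A i \<in> sets seq_borel" for i by (simp add: sets_PiM_single)
  define B where "B N = (\<Union>i<N. A i)" for N :: nat
  have B: "B N \<in> sets seq_borel" for N unfolding B_def using A by auto
  show ?case
  proof (rule forgets_tail_dominated_lim[where s="\<lambda>N. indicator (B N)" and w="\<lambda>_. 1"])
    show "forgets_tail (indicator (B N))" for N
    proof (rule forgets_tail_comparison[where I="{..<N}" and g="\<lambda>i. indicator (A i)"])
      fix x y :: "nat \<Rightarrow> real"
      show "\<bar>indicator (B N) x - indicator (B N) y :: real\<bar> \<le> (\<Sum>i\<in>{..<N}. \<bar>indicator (A i) x - indicator (A i) y\<bar>)"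
      proof (cases "\<exists>i<N. (x \<in> A i) \<noteq> (y \<in> A i)")
        case True
        then obtain i where i: "i < N" "(x \<in> A i) \<noteq> (y \<in> A i)" by auto
        have "\<bar>indicator (B N) x - indicator (B N) y :: real\<bar> \<le> 1" by (simp add: indicator_def)
        also have "1 = \<bar>indicator (A i) x - indicator (A i) y :: real\<bar>" using i by (auto simp: indicator_def)
        also have "\<dots> \<le> (\<Sum>i\<in>{..<N}. \<bar>indicator (A i) x - indicator (A i) y\<bar>)"
          using i by (intro member_le_sum) auto
        finally show ?thesis .
      next
        case False
        then show ?thesis by (auto simp: B_def indicator_def intro!: sum_nonneg)
      qed
    qed (use Union A B indicator_integrable_law_past in auto)
    show "(\<lambda>N. indicator (B N) x :: real) \<longlonglongrightarrow> indicator (\<Union> (range A)) x" for x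
    proof (cases "x \<in> \<Union> (range A)")
      case True
      then obtain i where i: "x \<in> A i" by auto
      have "\<forall>\<^sub>F N in sequentially. indicator (B N) x = (indicator (\<Union> (range A)) x :: real)"
        using eventually_gt_at_top[of i] by eventually_elim (use i in \<open>auto simp: B_def indicator_def\<close>)
      then show ?thesis by (rule tendsto_eventually)
    qed (auto simp: B_def indicator_def)
    show "integrable law_past (\<lambda>_. 1::real)"
      by (rule finite_measure.integrable_const[OF prob_space.finite_measure[OF prob_space_law_past]])
    show "integrable law_past (indicator (\<Union> (range A)) :: _ \<Rightarrow> real)"
      using A by (intro indicator_integrable_law_past) auto
  qed (use B indicator_integrable_law_past in \<open>auto split: split_indicator\<close>)
qed

lemma integrable_forgets_tail:
  assumes "integrable law_past f"
  shows "forgets_tail f"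
  using assms
proof induction
  case (base A c)
  have A: "A \<in> sets seq_borel" using base(1) by (simp cong: sets_PiM_cong)
  note [measurable] = A
  show ?case
  \<comment> \<open>A constant factor is handled by summing sufficiently many copies of the indicator.\<close>
  proof (rule forgets_tail_comparison[where I="{..<nat \<lceil>\<bar>c\<bar>\<rceil>}" and g="\<lambda>_. indicator A"])
    fix x y
    have "\<bar>c\<bar> * \<bar>indicator A x - indicator A y\<bar> \<le> real (nat \<lceil>\<bar>c\<bar>\<rceil>) * \<bar>indicator A x - indicator A y :: real\<bar>"
      by (intro mult_right_mono) linarith+
    then show "\<bar>indicator A x *\<^sub>R c - indicator A y *\<^sub>R c\<bar> \<le> (\<Sum>i\<in>{..<nat \<lceil>\<bar>c\<bar>\<rceil>}. \<bar>indicator A x - indicator A y\<bar>)"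
      unfolding scaleR_left_diff_distrib[symmetric] by (simp add: abs_mult mult.commute)
  qed (use indicator_forgets_tail[OF A] indicator_integrable_law_past[OF A] in auto)
next
  case (add f g)
  show ?case
    by (rule forgets_tail_comparison[where I="UNIV" and g="\<lambda>b. if b then f else g"])
       (use add borel_measurable_integrable[OF add.hyps(1)] borel_measurable_integrable[OF add.hyps(2)] in
         \<open>auto simp: UNIV_bool measurable_law_past\<close>)
next
  case (lim f s)
  show ?case
    by (rule forgets_tail_dominated_lim[where s=s and w="\<lambda>x. 2 * \<bar>f x\<bar>"])
       (use lim in \<open>auto simp: space_PiM\<close>)
qed


section \<open>Renewing the whole past\<close>

text \<open>A measurable function of the past need not be integrable; its arctangent is, and forgets the tail.
  Taking the tangent turns almost sure convergence along a subsequence back into that of the function.\<close>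

lemma past_tail_subseq:
  fixes x :: "(nat \<Rightarrow> real) \<Rightarrow> real"
  assumes x [measurable]: "x \<in> borel_measurable seq_borel"
  obtains \<sigma> :: "nat \<Rightarrow> nat" where "strict_mono \<sigma>"
    "AE \<omega> in M. (\<lambda>J. x (past (renewed {i - int (\<sigma> J)<..i}) k \<omega>)) \<longlonglongrightarrow> x (past (renewed {..i}) k \<omega>)"
proof -
  interpret L: prob_space law_past by (rule prob_space_law_past)
  define f where "f y = arctan (x y)" for y
  have f [measurable]: "f \<in> borel_measurable seq_borel"
    unfolding f_def by measurable
  have f_bound: "\<bar>f y\<bar> \<le> pi / 2" for y
    using arctan_bounded[of "x y"] by (auto simp: f_def)
  have "integrable law_past f"
    using f_bound f by (intro L.integrable_const_bound[of _ "pi / 2"]) (auto simp: measurable_law_past)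
  then have tail: "(\<lambda>J. \<integral>\<omega>. \<bar>f (past \<epsilon> k \<omega>) - f (past (renewed {..k - int J}) k \<omega>)\<bar> \<partial>M) \<longlonglongrightarrow> 0" for k
    using integrable_forgets_tail unfolding forgets_tail_def by blast
  define u where "u J \<omega> = f (past (renewed {i - int J<..i}) k \<omega>) - f (past (renewed {..i}) k \<omega>)" for J \<omega>
  define S where "S J = (\<integral>\<omega>. \<bar>f (past \<epsilon> k \<omega>) - f (past (renewed {..k - int J}) k \<omega>)\<bar> \<partial>M)" for J
  have integral_u: "(\<integral>\<omega>. \<bar>u J \<omega>\<bar> \<partial>M) = S (nat (k - i + int J))" if "k - i + int J \<ge> 0" for J
  proof -
    let ?J = "nat (k - i + int J)"
    \<comment> \<open>Both pasts have been renewed at the times in \<open>{i - J<..i}\<close>, so that in law only the tail differs.\<close>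
    have eq: "(\<integral>\<^sup>+\<omega>. ennreal \<bar>f (past (renewed {i - int J<..i}) k \<omega>) - f (past (renewed {..i}) k \<omega>)\<bar> \<partial>M)
       = (\<integral>\<^sup>+\<omega>. ennreal \<bar>f (past (renewed {}) k \<omega>) - f (past (renewed {..k - int ?J}) k \<omega>)\<bar> \<partial>M)"
      by (rule past_pair_nn_integral[where F="\<lambda>x y. ennreal \<bar>f x - f y\<bar>"]) (use that in \<open>auto\<close>)
    have "(\<integral>\<omega>. \<bar>u J \<omega>\<bar> \<partial>M) = enn2real (\<integral>\<^sup>+\<omega>. ennreal \<bar>u J \<omega>\<bar> \<partial>M)"
      unfolding u_def by (intro integral_eq_nn_integral) auto
    also have "\<dots> = S ?J"
      unfolding S_def u_def eq by (subst integral_eq_nn_integral) auto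
    finally show ?thesis .
  qed
  have "(\<lambda>J. \<integral>\<omega>. norm (u J \<omega>) \<partial>M) \<longlonglongrightarrow> 0"
  proof -
    have "filterlim (\<lambda>J. nat (k - i + int J)) sequentially sequentially"
      unfolding filterlim_at_top
    proof
      fix Z
      show "\<forall>\<^sub>F J in sequentially. Z \<le> nat (k - i + int J)"
        using eventually_ge_at_top[of "nat \<bar>k - i\<bar> + Z"] by eventually_elim auto
    qed
    then have "(\<lambda>J. S (nat (k - i + int J))) \<longlonglongrightarrow> 0"
      using tail unfolding S_def by (rule filterlim_compose[rotated])
    moreover have "\<forall>\<^sub>F J in sequentially. S (nat (k - i + int J)) = (\<integral>\<omega>. norm (u J \<omega>) \<partial>M)"
      using eventually_ge_at_top[of "nat \<bar>k - i\<bar>"] by eventually_elim (simp add: integral_u)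
    ultimately show ?thesis by (rule Lim_transform_eventually)
  qed
  moreover have "integrable M (u J)" for J
    unfolding u_def using f_bound by (intro Bochner_Integration.integrable_diff integrable_const_bound[of _ "pi / 2"]) auto
  ultimately obtain \<sigma> where \<sigma>: "strict_mono \<sigma>" "AE \<omega> in M. (\<lambda>J. u (\<sigma> J) \<omega>) \<longlonglongrightarrow> 0"
    using tendsto_L1_AE_subseq[of M u] by blast
  have "AE \<omega> in M. (\<lambda>J. x (past (renewed {i - int (\<sigma> J)<..i}) k \<omega>)) \<longlonglongrightarrow> x (past (renewed {..i}) k \<omega>)"
    using \<sigma>(2)
  proof eventually_elim
    case (elim \<omega>)
    let ?y = "f (past (renewed {..i}) k \<omega>)"
    have "(\<lambda>J. f (past (renewed {i - int (\<sigma> J)<..i}) k \<omega>)) \<longlonglongrightarrow> ?y"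
      using elim unfolding u_def by (rule LIM_zero_cancel)
    moreover have "cos ?y \<noteq> 0"
      unfolding f_def by (rule cos_arctan_not_zero)
    ultimately have "(\<lambda>J. tan (f (past (renewed {i - int (\<sigma> J)<..i}) k \<omega>))) \<longlonglongrightarrow> tan ?y"
      by (rule isCont_tendsto_compose[OF isCont_tan, rotated])
    then show ?case by (simp add: f_def tan_arctan)
  qed
  with \<sigma>(1) show ?thesis by (rule that)
qed

text \<open>If renewing the single innovation at time \<open>j\<close> moves \<open>x\<close> by a multiple of \<open>\<rho> ^ (k - j)\<close> in \<open>L\<^sup>q\<close>, then
  so does renewing all innovations up to time \<open>i\<close>, with \<open>k - i\<close> as exponent. Finitely many renewals are made one after
  another, each step having the law of a single renewal; the infinite past is reached by Fatou's lemma.\<close>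

lemma renewal_moment_bound:
  fixes x :: "(nat \<Rightarrow> real) \<Rightarrow> real"
  assumes x [measurable]: "x \<in> borel_measurable seq_borel"
    and q: "1 \<le> q" and \<rho>: "0 < \<rho>" "\<rho> < 1" and K: "0 \<le> K"
    and single: "\<And>j. j \<le> i \<Longrightarrow>
      (\<integral>\<^sup>+\<omega>. ennreal (\<bar>x (past \<epsilon> k \<omega>) - x (past (renewed {j}) k \<omega>)\<bar> powr q) \<partial>M) \<le> ennreal ((K * \<rho> ^ nat (k - j)) powr q)"
    and ik: "i \<le> k"
  shows "(\<integral>\<^sup>+\<omega>. ennreal (\<bar>x (past \<epsilon> k \<omega>) - x (past (renewed {..i}) k \<omega>)\<bar> powr q) \<partial>M)
    \<le> ennreal ((K / (1 - sqrt \<rho>)\<^sup>2 * \<rho> ^ nat (k - i)) powr q)"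
proof -
  define \<theta> where "\<theta> = sqrt \<rho>"
  have \<theta>: "0 < \<theta>" "\<theta> < 1" "\<rho> = \<theta> * \<theta>" using \<rho> by (auto simp: \<theta>_def)
  define D where "D = K * \<rho> ^ nat (k - i)"
  have D: "0 \<le> D" using K \<rho> by (simp add: D_def)
  define a where "a J \<omega> = x (past (renewed {i - int J<..i}) k \<omega>)" for J \<omega>
  define b where "b J \<omega> = \<bar>a J \<omega> - a (Suc J) \<omega>\<bar>" for J \<omega>
  have [measurable]: "a J \<in> borel_measurable M" "b J \<in> borel_measurable M" for J
    unfolding a_def b_def by measurable
  have b_moment: "(\<integral>\<^sup>+\<omega>. ennreal (b J \<omega> powr q) \<partial>M) \<le> ennreal ((D * \<rho> ^ J) powr q)" for J
  proof -
    have "(\<integral>\<^sup>+\<omega>. ennreal (b J \<omega> powr q) \<partial>M)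
        = (\<integral>\<^sup>+\<omega>. ennreal (\<bar>x (past (renewed {}) k \<omega>) - x (past (renewed {i - int J}) k \<omega>)\<bar> powr q) \<partial>M)"
      unfolding b_def a_def
      by (rule past_pair_nn_integral[where F="\<lambda>y z. ennreal (\<bar>x y - x z\<bar> powr q)"]) auto
    also have "\<dots> \<le> ennreal ((K * \<rho> ^ nat (k - (i - int J))) powr q)"
      using single[of "i - int J"] by simp
    also have "nat (k - (i - int J)) = nat (k - i) + J" using ik by auto
    finally show ?thesis by (simp add: D_def power_add mult.assoc)
  qed
  have geom: "(\<Sum>j<J. t ^ j) \<le> 1 / (1 - t)" if "0 \<le> t" "t < 1" for t :: real and J
    using that by (simp add: sum_gp_strict divide_right_mono)
  have partial: "(\<integral>\<^sup>+\<omega>. ennreal (\<bar>a 0 \<omega> - a J \<omega>\<bar> powr q) \<partial>M) \<le> ennreal ((K / (1 - sqrt \<rho>)\<^sup>2 * \<rho> ^ nat (k - i)) powr q)" for J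
  proof -
    \<comment> \<open>Each increment is at most \<open>\<theta> ^ j\<close> times the largest rescaled increment, whose power is bounded by
        the sum \<open>Q\<close> of all powers; it remains to sum the geometric series.\<close>
    have pw: "\<bar>a 0 \<omega> - a J \<omega>\<bar> powr q \<le> (1 / (1 - \<theta>)) powr q * (\<Sum>j<J. (b j \<omega> / \<theta> ^ j) powr q)" for \<omega>
    proof -
      define Q where "Q = (\<Sum>j<J. (b j \<omega> / \<theta> ^ j) powr q)"
      have Q: "0 \<le> Q" unfolding Q_def by (intro sum_nonneg) auto
      have bj: "b j \<omega> \<le> \<theta> ^ j * Q powr (1 / q)" if "j < J" for j
      proof -
        have nn: "0 \<le> b j \<omega> / \<theta> ^ j" using \<theta> by (simp add: b_def)
        have "(b j \<omega> / \<theta> ^ j) powr q \<le> Q"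
          unfolding Q_def using that by (intro member_le_sum) auto
        then have "((b j \<omega> / \<theta> ^ j) powr q) powr (1 / q) \<le> Q powr (1 / q)"
          using q by (intro powr_mono2) auto
        then have "b j \<omega> / \<theta> ^ j \<le> Q powr (1 / q)"
          using q nn by (simp add: powr_powr del: abs_divide)
        then show ?thesis using \<theta> by (simp add: field_simps)
      qed
      have "\<bar>a 0 \<omega> - a J \<omega>\<bar> \<le> (\<Sum>j<J. b j \<omega>)"
        by (induction J) (auto simp: b_def)
      also have "\<dots> \<le> (\<Sum>j<J. \<theta> ^ j * Q powr (1 / q))"
        by (intro sum_mono) (use bj in auto)
      also have "\<dots> = (\<Sum>j<J. \<theta> ^ j) * Q powr (1 / q)"
        by (simp add: sum_distrib_right)
      also have "\<dots> \<le> 1 / (1 - \<theta>) * Q powr (1 / q)"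
        using \<theta> by (intro mult_right_mono geom) auto
      finally have "\<bar>a 0 \<omega> - a J \<omega>\<bar> powr q \<le> (1 / (1 - \<theta>) * Q powr (1 / q)) powr q"
        using q by (intro powr_mono2) auto
      also have "\<dots> = (1 / (1 - \<theta>)) powr q * Q"
        using \<theta> q Q by (subst powr_mult) (auto simp: powr_powr)
      finally show ?thesis by (simp add: Q_def)
    qed
    have "(\<integral>\<^sup>+\<omega>. ennreal (\<bar>a 0 \<omega> - a J \<omega>\<bar> powr q) \<partial>M)
        \<le> (\<integral>\<^sup>+\<omega>. ennreal ((1 / (1 - \<theta>)) powr q) * (\<Sum>j<J. ennreal ((1 / \<theta> ^ j) powr q) * ennreal (b j \<omega> powr q)) \<partial>M)"
    proof (rule nn_integral_mono)
      fix \<omega>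
      have "ennreal ((b j \<omega> / \<theta> ^ j) powr q) = ennreal ((1 / \<theta> ^ j) powr q) * ennreal (b j \<omega> powr q)" for j
      proof -
        have "(b j \<omega> / \<theta> ^ j) powr q = (1 / \<theta> ^ j * b j \<omega>) powr q" by simp
        also have "\<dots> = (1 / \<theta> ^ j) powr q * b j \<omega> powr q"
          by (rule powr_mult)
        finally show ?thesis by (simp add: ennreal_mult)
      qed
      then have "ennreal ((1 / (1 - \<theta>)) powr q) * (\<Sum>j<J. ennreal ((1 / \<theta> ^ j) powr q) * ennreal (b j \<omega> powr q))
         = ennreal ((1 / (1 - \<theta>)) powr q * (\<Sum>j<J. (b j \<omega> / \<theta> ^ j) powr q))"
        by (simp only: ennreal_mult'[OF powr_ge_zero] sum_ennreal[symmetric] powr_ge_zero)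
      then show "ennreal (\<bar>a 0 \<omega> - a J \<omega>\<bar> powr q)
          \<le> ennreal ((1 / (1 - \<theta>)) powr q) * (\<Sum>j<J. ennreal ((1 / \<theta> ^ j) powr q) * ennreal (b j \<omega> powr q))"
        using pw[of \<omega>] by (simp add: ennreal_leI)
    qed
    also have "\<dots> = ennreal ((1 / (1 - \<theta>)) powr q) * (\<Sum>j<J. ennreal ((1 / \<theta> ^ j) powr q) * (\<integral>\<^sup>+\<omega>. ennreal (b j \<omega> powr q) \<partial>M))"
      by (simp add: nn_integral_cmult nn_integral_sum)
    also have "\<dots> \<le> ennreal ((1 / (1 - \<theta>)) powr q) * (\<Sum>j<J. ennreal ((1 / \<theta> ^ j) powr q) * ennreal ((D * \<rho> ^ j) powr q))"
      by (intro mult_left_mono sum_mono b_moment) auto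
    also have "\<dots> = ennreal ((1 / (1 - \<theta>)) powr q * (\<Sum>j<J. (1 / \<theta> ^ j) powr q * (D * \<rho> ^ j) powr q))"
      by (simp only: ennreal_mult'[OF powr_ge_zero] sum_ennreal[symmetric] powr_ge_zero mult_nonneg_nonneg)
    also have "\<dots> \<le> ennreal ((1 / (1 - \<theta>)) powr q * (D powr q * (1 / (1 - \<theta>)) powr q))"
    proof (intro ennreal_leI mult_left_mono)
      have "(1 / \<theta> ^ j) powr q * (D * \<rho> ^ j) powr q = D powr q * (\<theta> powr q) ^ j" for j
      proof -
        have "(1 / \<theta> ^ j) powr q * (D * \<rho> ^ j) powr q = (1 / \<theta> ^ j * (D * \<rho> ^ j)) powr q"
          using \<theta> D by (subst powr_mult) auto
        also have "1 / \<theta> ^ j * (D * \<rho> ^ j) = D * \<theta> ^ j"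
          using \<theta> by (simp add: power_mult_distrib)
        also have "(D * \<theta> ^ j) powr q = D powr q * (\<theta> ^ j) powr q"
          using \<theta> D by (subst powr_mult) auto
        also have "(\<theta> ^ j) powr q = (\<theta> powr q) ^ j"
          using \<theta> by (simp add: powr_realpow[symmetric] powr_powr mult.commute)
        finally show ?thesis .
      qed
      then have "(\<Sum>j<J. (1 / \<theta> ^ j) powr q * (D * \<rho> ^ j) powr q) = D powr q * (\<Sum>j<J. (\<theta> powr q) ^ j)"
        by (simp add: sum_distrib_left)
      also have "\<dots> \<le> D powr q * (\<Sum>j<J. \<theta> ^ j)"
      proof (intro mult_left_mono sum_mono power_mono)
        show "\<theta> powr q \<le> \<theta>" using powr_mono'[of 1 q \<theta>] \<theta> q by simp
      qed auto
      also have "\<dots> \<le> D powr q * (1 / (1 - \<theta>)) powr 1"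
        using \<theta> by (intro mult_left_mono) (simp_all add: geom)
      also have "\<dots> \<le> D powr q * (1 / (1 - \<theta>)) powr q"
        using \<theta> q by (intro mult_left_mono powr_mono) auto
      finally show "(\<Sum>j<J. (1 / \<theta> ^ j) powr q * (D * \<rho> ^ j) powr q) \<le> D powr q * (1 / (1 - \<theta>)) powr q" .
    qed auto
    also have "(1 / (1 - \<theta>)) powr q * (D powr q * (1 / (1 - \<theta>)) powr q)
        = (1 / (1 - \<theta>) * (D * (1 / (1 - \<theta>)))) powr q"
      by (simp only: powr_mult)
    also have "1 / (1 - \<theta>) * (D * (1 / (1 - \<theta>))) = K / (1 - sqrt \<rho>)\<^sup>2 * \<rho> ^ nat (k - i)"
      unfolding D_def \<theta>_def by (simp add: power2_eq_square)
    finally show ?thesis .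
  qed
  obtain \<sigma> where \<sigma>: "strict_mono \<sigma>"
    "AE \<omega> in M. (\<lambda>J. x (past (renewed {i - int (\<sigma> J)<..i}) k \<omega>)) \<longlonglongrightarrow> x (past (renewed {..i}) k \<omega>)"
    using past_tail_subseq[OF x] by blast
  have "(\<integral>\<^sup>+\<omega>. ennreal (\<bar>x (past \<epsilon> k \<omega>) - x (past (renewed {..i}) k \<omega>)\<bar> powr q) \<partial>M)
      = (\<integral>\<^sup>+\<omega>. liminf (\<lambda>J. ennreal (\<bar>a 0 \<omega> - a (\<sigma> J) \<omega>\<bar> powr q)) \<partial>M)"
  proof (rule nn_integral_cong_AE)
    show "AE \<omega> in M. ennreal (\<bar>x (past \<epsilon> k \<omega>) - x (past (renewed {..i}) k \<omega>)\<bar> powr q)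
        = liminf (\<lambda>J. ennreal (\<bar>a 0 \<omega> - a (\<sigma> J) \<omega>\<bar> powr q))"
      using \<sigma>(2)
    proof eventually_elim
      case (elim \<omega>)
      have "(\<lambda>J. ennreal (\<bar>a 0 \<omega> - a (\<sigma> J) \<omega>\<bar> powr q))
          \<longlonglongrightarrow> ennreal (\<bar>x (past \<epsilon> k \<omega>) - x (past (renewed {..i}) k \<omega>)\<bar> powr q)"
        unfolding a_def using q elim
        by (intro tendsto_ennrealI tendsto_powr' tendsto_rabs tendsto_diff) auto
      then show ?case
        by (intro lim_imp_Liminf[symmetric]) auto
    qed
  qed
  also have "\<dots> \<le> liminf (\<lambda>J. \<integral>\<^sup>+\<omega>. ennreal (\<bar>a 0 \<omega> - a (\<sigma> J) \<omega>\<bar> powr q) \<partial>M)"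
    by (rule nn_integral_liminf) measurable
  also have "\<dots> \<le> limsup (\<lambda>J. \<integral>\<^sup>+\<omega>. ennreal (\<bar>a 0 \<omega> - a (\<sigma> J) \<omega>\<bar> powr q) \<partial>M)"
    by (rule Liminf_le_Limsup) simp
  also have "\<dots> \<le> ennreal ((K / (1 - sqrt \<rho>)\<^sup>2 * \<rho> ^ nat (k - i)) powr q)"
    by (rule Limsup_bounded) (use partial in auto)
  finally show ?thesis .
qed

end

section \<open>Sums with geometric weights\<close>

lemma sum_power_inj_le:
  fixes \<rho> :: real
  assumes "0 < \<rho>" "\<rho> < 1" "finite J" "inj_on f J"
  shows "(\<Sum>k\<in>J. \<rho> ^ f k) \<le> 1 / (1 - \<rho>)"
proof -
  have "(\<Sum>k\<in>J. \<rho> ^ f k) = (\<Sum>i\<in>f ` J. \<rho> ^ i)"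
    using assms by (simp add: sum.reindex)
  also have "\<dots> \<le> (\<Sum>i. \<rho> ^ i)"
    using assms by (intro sum_le_suminf) auto
  also have "\<dots> = 1 / (1 - \<rho>)"
    using assms by (intro suminf_geometric) auto
  finally show ?thesis .
qed

lemma sum_power_distance_le:
  fixes \<rho> :: real
  assumes \<rho>: "0 < \<rho>" "\<rho> < 1" and J: "finite J"
  shows "(\<Sum>k\<in>J. \<rho> ^ ((k - i) + (i - k))) \<le> 2 / (1 - \<rho>)"
proof -
  have "(\<Sum>k\<in>J. \<rho> ^ ((k - i) + (i - k)))
      = (\<Sum>k\<in>J \<inter> {..i}. \<rho> ^ ((k - i) + (i - k))) + (\<Sum>k\<in>J - {..i}. \<rho> ^ ((k - i) + (i - k)))"
    using J by (simp add: sum.Int_Diff[of J _ "{..i}"])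
  also have "\<dots> = (\<Sum>k\<in>J \<inter> {..i}. \<rho> ^ (i - k)) + (\<Sum>k\<in>J - {..i}. \<rho> ^ (k - i))"
    by (intro arg_cong2[where f="(+)"] sum.cong) auto
  also have "\<dots> \<le> 1 / (1 - \<rho>) + 1 / (1 - \<rho>)"
    using J by (intro add_mono sum_power_inj_le[OF \<rho>]) (auto simp: inj_on_def)
  finally show ?thesis by simp
qed

text \<open>Schur's test for the matrix \<open>\<rho> ^ \<bar>i - k\<bar>\<close>; the exponent is the distance of two natural numbers,
  written with truncated differences.\<close>

lemma schur_bound:
  fixes \<rho> :: real and w :: "nat \<Rightarrow> real"
  assumes \<rho>: "0 < \<rho>" "\<rho> < 1" and I: "finite I"
  shows "(\<Sum>i\<in>I. \<Sum>k\<in>I. w i * w k * \<rho> ^ ((k - i) + (i - k))) \<le> 2 / (1 - \<rho>) * (\<Sum>i\<in>I. (w i)\<^sup>2)"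
proof -
  let ?r = "\<lambda>i k. \<rho> ^ ((k - i) + (i - k))"
  have "(\<Sum>i\<in>I. \<Sum>k\<in>I. w i * w k * ?r i k) \<le> (\<Sum>i\<in>I. \<Sum>k\<in>I. ((w i)\<^sup>2 * ?r i k + (w k)\<^sup>2 * ?r k i) / 2)"
  proof (intro sum_mono)
    fix i k
    have "w i * w k \<le> ((w i)\<^sup>2 + (w k)\<^sup>2) / 2"
      using sum_squares_bound[of "w i" "w k"] by simp
    then have "w i * w k * ?r i k \<le> ((w i)\<^sup>2 + (w k)\<^sup>2) / 2 * ?r i k"
      using \<rho> by (intro mult_right_mono) auto
    then show "w i * w k * ?r i k \<le> ((w i)\<^sup>2 * ?r i k + (w k)\<^sup>2 * ?r k i) / 2"
      by (simp add: algebra_simps)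
  qed
  also have "\<dots> = ((\<Sum>i\<in>I. \<Sum>k\<in>I. (w i)\<^sup>2 * ?r i k) + (\<Sum>i\<in>I. \<Sum>k\<in>I. (w k)\<^sup>2 * ?r k i)) / 2"
    by (simp only: sum_divide_distrib[symmetric] sum.distrib)
  also have "(\<Sum>i\<in>I. \<Sum>k\<in>I. (w k)\<^sup>2 * ?r k i) = (\<Sum>i\<in>I. \<Sum>k\<in>I. (w i)\<^sup>2 * ?r i k)"
    by (rule sum.swap)
  also have "((\<Sum>i\<in>I. \<Sum>k\<in>I. (w i)\<^sup>2 * ?r i k) + (\<Sum>i\<in>I. \<Sum>k\<in>I. (w i)\<^sup>2 * ?r i k)) / 2
      = (\<Sum>i\<in>I. \<Sum>k\<in>I. (w i)\<^sup>2 * ?r i k)"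
    by simp
  also have "\<dots> = (\<Sum>i\<in>I. (w i)\<^sup>2 * (\<Sum>k\<in>I. ?r i k))"
    by (simp only: sum_distrib_left)
  also have "\<dots> \<le> (\<Sum>i\<in>I. (w i)\<^sup>2 * (2 / (1 - \<rho>)))"
    using sum_power_distance_le[OF \<rho> I] by (intro sum_mono mult_left_mono) auto
  also have "\<dots> = 2 / (1 - \<rho>) * (\<Sum>i\<in>I. (w i)\<^sup>2)"
    by (simp only: sum_distrib_left mult.commute)
  finally show ?thesis .
qed

lemma mult_le_powr:
  fixes x y p :: real
  assumes "2 \<le> p"
  shows "\<bar>x\<bar> * \<bar>y\<bar> \<le> 1 + \<bar>x\<bar> powr p + \<bar>y\<bar> powr p"
proof -
  define u where "u = max \<bar>x\<bar> \<bar>y\<bar>"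
  have u: "0 \<le> u" by (simp add: u_def)
  have "\<bar>x\<bar> * \<bar>y\<bar> \<le> u * u" by (intro mult_mono) (auto simp: u_def)
  also have "\<dots> = u powr 2" using u by (simp add: power2_eq_square)
  also have "\<dots> \<le> 1 + u powr p" using assms u by (intro powr_le_1_plus_powr) auto
  also have "u powr p \<le> \<bar>x\<bar> powr p + \<bar>y\<bar> powr p" by (auto simp: u_def max_def)
  finally show ?thesis by simp
qed

section \<open>Coupled arrays\<close>

text \<open>The dependence of the process in abstract form. The variable \<open>Z' n i k\<close> is \<open>Z n k\<close> recomputed after
  everything up to time \<open>i\<close> has been replaced by an independent copy: the recomputed variables after time \<open>i\<close> are
  jointly independent of the row up to time \<open>i\<close>, have their original joint law, and are
  geometrically close to the original variables in \<open>L\<^sup>p\<close>. All constants are shared by the rows \<open>n\<close>.\<close>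

locale coupled_array = prob_space M for M :: "'a measure" +
  fixes Z :: "nat \<Rightarrow> nat \<Rightarrow> 'a \<Rightarrow> real" and Z' :: "nat \<Rightarrow> nat \<Rightarrow> nat \<Rightarrow> 'a \<Rightarrow> real"
    and p \<rho> B :: real
  assumes p: "2 < p" "p \<le> 3" and \<rho>: "0 < \<rho>" "\<rho> < 1"
    and Z_measurable [measurable]: "\<And>n k. Z n k \<in> borel_measurable M"
    and copy_measurable [measurable]: "\<And>n i k. Z' n i k \<in> borel_measurable M"
    and Z_moment: "\<And>n k. integrable M (\<lambda>\<omega>. \<bar>Z n k \<omega>\<bar> powr p)" "\<And>n k. (\<integral>\<omega>. \<bar>Z n k \<omega>\<bar> powr p \<partial>M) \<le> B"
    and Z_mean: "\<And>n k. (\<integral>\<omega>. Z n k \<omega> \<partial>M) = 0"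
    and normalized_gap_moment:
      "\<And>n i k. i < k \<Longrightarrow> integrable M (\<lambda>\<omega>. (\<bar>Z n k \<omega> - Z' n i k \<omega>\<bar> / \<rho> ^ (k - i)) powr p)"
      "\<And>n i k. i < k \<Longrightarrow> (\<integral>\<omega>. (\<bar>Z n k \<omega> - Z' n i k \<omega>\<bar> / \<rho> ^ (k - i)) powr p \<partial>M) \<le> B"
    and copy_indep: "\<And>n i. indep_var (PiM {..i} (\<lambda>_. borel)) (\<lambda>\<omega>. \<lambda>k\<in>{..i}. Z n k \<omega>)
            (PiM {i<..} (\<lambda>_. borel)) (\<lambda>\<omega>. \<lambda>k\<in>{i<..}. Z' n i k \<omega>)"
    and copy_law: "\<And>n i. distr M (PiM {i<..} (\<lambda>_. borel)) (\<lambda>\<omega>. \<lambda>k\<in>{i<..}. Z' n i k \<omega>)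
            = distr M (PiM {i<..} (\<lambda>_. borel)) (\<lambda>\<omega>. \<lambda>k\<in>{i<..}. Z n k \<omega>)"
begin

text \<open>Normalized by its geometric decay, the coupling error has moments bounded uniformly in all indices.\<close>

definition gap :: "nat \<Rightarrow> nat \<Rightarrow> nat \<Rightarrow> 'a \<Rightarrow> real" where
  "gap n i k \<omega> = \<bar>Z n k \<omega> - Z' n i k \<omega>\<bar> / \<rho> ^ (k - i)"

lemma gap_measurable [measurable]: "gap n i k \<in> borel_measurable M"
  unfolding gap_def[abs_def] by measurable

lemma gap_nonneg [simp]: "0 \<le> gap n i k \<omega>" "\<bar>gap n i k \<omega>\<bar> = gap n i k \<omega>"
  using \<rho> by (auto simp: gap_def)

lemma abs_diff_copy: "\<bar>Z n k \<omega> - Z' n i k \<omega>\<bar> = \<rho> ^ (k - i) * gap n i k \<omega>"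
  using \<rho> by (simp add: gap_def)

lemma gap_moment:
  assumes "i < k"
  shows "integrable M (\<lambda>\<omega>. gap n i k \<omega> powr p)" "(\<integral>\<omega>. gap n i k \<omega> powr p \<partial>M) \<le> B"
  using normalized_gap_moment[OF assms, of n] by (simp_all add: gap_def)

lemma B_nonneg: "0 \<le> B"
proof -
  have "0 \<le> (\<integral>\<omega>. \<bar>Z 0 0 \<omega>\<bar> powr p \<partial>M)" by (rule integral_nonneg_AE) simp
  then show ?thesis using Z_moment(2)[of 0 0] by linarith
qed

lemma Lp_product_integrable:
  assumes [measurable]: "X \<in> borel_measurable M" "Y \<in> borel_measurable M"
    and "integrable M (\<lambda>\<omega>. \<bar>X \<omega>\<bar> powr p)" "integrable M (\<lambda>\<omega>. \<bar>Y \<omega>\<bar> powr p)"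
  shows "integrable M (\<lambda>\<omega>. X \<omega> * Y \<omega>)"
    and "(\<integral>\<omega>. \<bar>X \<omega>\<bar> * \<bar>Y \<omega>\<bar> \<partial>M) \<le> 1 + (\<integral>\<omega>. \<bar>X \<omega>\<bar> powr p \<partial>M) + (\<integral>\<omega>. \<bar>Y \<omega>\<bar> powr p \<partial>M)"
proof -
  have i: "integrable M (\<lambda>\<omega>. 1 + \<bar>X \<omega>\<bar> powr p + \<bar>Y \<omega>\<bar> powr p)"
    using assms by auto
  have le: "\<bar>X \<omega>\<bar> * \<bar>Y \<omega>\<bar> \<le> 1 + \<bar>X \<omega>\<bar> powr p + \<bar>Y \<omega>\<bar> powr p" for \<omega>
    using p by (intro mult_le_powr) auto
  show 1: "integrable M (\<lambda>\<omega>. X \<omega> * Y \<omega>)"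
    using le by (intro Bochner_Integration.integrable_bound[OF i]) (auto simp: abs_mult intro: order_trans)
  have "(\<integral>\<omega>. \<bar>X \<omega>\<bar> * \<bar>Y \<omega>\<bar> \<partial>M) \<le> (\<integral>\<omega>. 1 + \<bar>X \<omega>\<bar> powr p + \<bar>Y \<omega>\<bar> powr p \<partial>M)"
    using integrable_abs[OF 1] le by (intro integral_mono i) (auto simp: abs_mult)
  then show "(\<integral>\<omega>. \<bar>X \<omega>\<bar> * \<bar>Y \<omega>\<bar> \<partial>M) \<le> 1 + (\<integral>\<omega>. \<bar>X \<omega>\<bar> powr p \<partial>M) + (\<integral>\<omega>. \<bar>Y \<omega>\<bar> powr p \<partial>M)"
    using assms by (simp add: prob_space)
qed

lemma Lp_integrable:
  assumes [measurable]: "X \<in> borel_measurable M" and "integrable M (\<lambda>\<omega>. \<bar>X \<omega>\<bar> powr p)"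
  shows "integrable M X"
  using Lp_product_integrable(1)[OF assms(1) borel_measurable_const[of 1] assms(2)] p by simp

lemma Z_integrable [simp]: "integrable M (Z n k)"
  by (rule Lp_integrable) (auto intro: Z_moment)

text \<open>A common bound for the means of the products of two variables with \<open>p\<close>-th moment at most \<open>B\<close>, and of a
  single gap.\<close>

definition V :: real where "V = 2 + 2 * B"

lemma V_ge: "1 \<le> V" "0 \<le> V" using B_nonneg by (simp_all add: V_def)

lemma gap_mean:
  assumes "i < k" shows "integrable M (gap n i k)" "(\<integral>\<omega>. gap n i k \<omega> \<partial>M) \<le> V"
proof -
  have i: "integrable M (\<lambda>\<omega>. \<bar>gap n i k \<omega>\<bar> powr p)" using gap_moment(1)[OF assms] by simp
  show "integrable M (gap n i k)" by (rule Lp_integrable[OF _ i]) simp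
  have "(\<integral>\<omega>. \<bar>gap n i k \<omega>\<bar> * \<bar>1\<bar> \<partial>M) \<le> 1 + (\<integral>\<omega>. \<bar>gap n i k \<omega>\<bar> powr p \<partial>M) + (\<integral>\<omega>. \<bar>1\<bar> powr p \<partial>M)"
    by (rule Lp_product_integrable) (use i in auto)
  also have "\<dots> \<le> V" using gap_moment(2)[OF assms, of n] B_nonneg by (simp add: prob_space V_def)
  finally show "(\<integral>\<omega>. gap n i k \<omega> \<partial>M) \<le> V" by simp
qed

lemma copy_mean:
  assumes "i < k"
  shows "integrable M (Z' n i k)" "(\<integral>\<omega>. Z' n i k \<omega> \<partial>M) = 0"
proof -
  let ?N = "PiM {i<..} (\<lambda>_. borel) :: (nat \<Rightarrow> real) measure"
  let ?X = "\<lambda>\<omega>. \<lambda>k\<in>{i<..}. Z n k \<omega>" and ?X' = "\<lambda>\<omega>. \<lambda>k\<in>{i<..}. Z' n i k \<omega>"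
  have c [measurable]: "(\<lambda>y. y k) \<in> borel_measurable ?N"
    using assms by (intro measurable_component_singleton) auto
  have [measurable]: "?X \<in> measurable M ?N" "?X' \<in> measurable M ?N" by measurable
  have "distr M borel (\<lambda>\<omega>. Z' n i k \<omega>) = distr (distr M ?N ?X') borel (\<lambda>y. y k)"
    using assms by (subst distr_distr) (auto simp: comp_def)
  also have "\<dots> = distr M borel (\<lambda>\<omega>. Z n k \<omega>)"
    unfolding copy_law using assms by (subst distr_distr) (auto simp: comp_def)
  finally have eq: "distr M borel (Z' n i k) = distr M borel (Z n k)" by simp
  have "integrable (distr M borel (Z' n i k)) (\<lambda>x. x)"
    unfolding eq by (subst integrable_distr_eq) auto
  then show "integrable M (Z' n i k)" by (subst (asm) integrable_distr_eq) auto
  have "(\<integral>\<omega>. Z' n i k \<omega> \<partial>M) = (\<integral>x. x \<partial>distr M borel (Z' n i k))"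
    by (subst integral_distr) auto
  also have "\<dots> = (\<integral>\<omega>. Z n k \<omega> \<partial>M)"
    unfolding eq by (subst integral_distr) auto
  finally show "(\<integral>\<omega>. Z' n i k \<omega> \<partial>M) = 0" by (simp add: Z_mean)
qed

text \<open>A function \<open>U\<close> of the row up to time \<open>i\<close> is independent of the
  centred variable \<open>Z' n i k\<close>, so that only the coupling error contributes to the mean of \<open>U\<close> times \<open>Z n k\<close>.\<close>

lemma expectation_times_future:
  assumes ik: "i < k"
    and \<phi> [measurable]: "\<phi> \<in> borel_measurable (PiM {..i} (\<lambda>_. borel))"
    and U: "\<And>\<omega>. U \<omega> = \<phi> (\<lambda>j\<in>{..i}. Z n j \<omega>)"
    and U_int: "integrable M U"
    and U_gap: "integrable M (\<lambda>\<omega>. \<bar>U \<omega>\<bar> * gap n i k \<omega>)"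
  shows "integrable M (\<lambda>\<omega>. U \<omega> * Z n k \<omega>)"
    and "\<bar>\<integral>\<omega>. U \<omega> * Z n k \<omega> \<partial>M\<bar> \<le> \<rho> ^ (k - i) * (\<integral>\<omega>. \<bar>U \<omega>\<bar> * gap n i k \<omega> \<partial>M)"
proof -
  have Um [measurable]: "U \<in> borel_measurable M" using U_int by auto
  have "indep_var borel (\<phi> \<circ> (\<lambda>\<omega>. \<lambda>k\<in>{..i}. Z n k \<omega>)) borel ((\<lambda>y. y k) \<circ> (\<lambda>\<omega>. \<lambda>k\<in>{i<..}. Z' n i k \<omega>))"
    using ik by (intro indep_var_compose[OF copy_indep]) auto
  moreover have "\<phi> \<circ> (\<lambda>\<omega>. \<lambda>k\<in>{..i}. Z n k \<omega>) = U" "(\<lambda>y. y k) \<circ> (\<lambda>\<omega>. \<lambda>k\<in>{i<..}. Z' n i k \<omega>) = Z' n i k"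
    using ik by (auto simp: U fun_eq_iff)
  ultimately have ind: "indep_var borel U borel (Z' n i k)" by simp
  have i1: "integrable M (\<lambda>\<omega>. U \<omega> * Z' n i k \<omega>)"
    using indep_var_integrable[OF ind U_int copy_mean(1)[OF ik]] .
  have e1: "(\<integral>\<omega>. U \<omega> * Z' n i k \<omega> \<partial>M) = 0"
    using indep_var_lebesgue_integral[OF ind U_int copy_mean(1)[OF ik]] copy_mean(2)[OF ik] by simp
  have abs: "\<bar>U \<omega> * (Z n k \<omega> - Z' n i k \<omega>)\<bar> = \<rho> ^ (k - i) * (\<bar>U \<omega>\<bar> * gap n i k \<omega>)" for \<omega>
    by (simp add: abs_mult abs_diff_copy)
  have i3: "integrable M (\<lambda>\<omega>. \<rho> ^ (k - i) * (\<bar>U \<omega>\<bar> * gap n i k \<omega>))"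
    using U_gap by simp
  have i2: "integrable M (\<lambda>\<omega>. U \<omega> * (Z n k \<omega> - Z' n i k \<omega>))"
    by (rule Bochner_Integration.integrable_bound[OF i3]) (use \<rho> in \<open>auto simp: abs_mult abs_diff_copy\<close>)
  have eq: "U \<omega> * Z n k \<omega> = U \<omega> * Z' n i k \<omega> + U \<omega> * (Z n k \<omega> - Z' n i k \<omega>)" for \<omega>
    by (simp add: algebra_simps)
  show "integrable M (\<lambda>\<omega>. U \<omega> * Z n k \<omega>)"
    unfolding eq by (rule Bochner_Integration.integrable_add[OF i1 i2])
  have "(\<integral>\<omega>. U \<omega> * Z n k \<omega> \<partial>M) = (\<integral>\<omega>. U \<omega> * (Z n k \<omega> - Z' n i k \<omega>) \<partial>M)"
    unfolding eq Bochner_Integration.integral_add[OF i1 i2] e1 by simp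
  then have "\<bar>\<integral>\<omega>. U \<omega> * Z n k \<omega> \<partial>M\<bar> \<le> (\<integral>\<omega>. \<bar>U \<omega> * (Z n k \<omega> - Z' n i k \<omega>)\<bar> \<partial>M)"
    using integral_abs_bound by metis
  also have "\<dots> = \<rho> ^ (k - i) * (\<integral>\<omega>. \<bar>U \<omega>\<bar> * gap n i k \<omega> \<partial>M)"
    unfolding abs by simp
  finally show "\<bar>\<integral>\<omega>. U \<omega> * Z n k \<omega> \<partial>M\<bar> \<le> \<rho> ^ (k - i) * (\<integral>\<omega>. \<bar>U \<omega>\<bar> * gap n i k \<omega> \<partial>M)" .
qed

lemma Z_product_integrable [simp]: "integrable M (\<lambda>\<omega>. Z n i \<omega> * Z n k \<omega>)"
  by (rule Lp_product_integrable) (auto intro: Z_moment)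

lemma covariance_le:
  "\<bar>\<integral>\<omega>. Z n i \<omega> * Z n k \<omega> \<partial>M\<bar> \<le> V * \<rho> ^ ((k - i) + (i - k))"
proof -
  have less: "\<bar>\<integral>\<omega>. Z n i \<omega> * Z n k \<omega> \<partial>M\<bar> \<le> V * \<rho> ^ (k - i)" if "i < k" for i k
  proof -
    have g: "integrable M (\<lambda>\<omega>. \<bar>gap n i k \<omega>\<bar> powr p)" using gap_moment(1)[OF that] by simp
    have int: "integrable M (\<lambda>\<omega>. Z n i \<omega> * gap n i k \<omega>)"
      by (rule Lp_product_integrable) (auto intro: Z_moment g simp del: gap_nonneg)
    have "\<bar>\<integral>\<omega>. Z n i \<omega> * Z n k \<omega> \<partial>M\<bar> \<le> \<rho> ^ (k - i) * (\<integral>\<omega>. \<bar>Z n i \<omega>\<bar> * gap n i k \<omega> \<partial>M)"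
      using integrable_abs[OF int]
      by (intro expectation_times_future[OF that, where \<phi>="\<lambda>y. y i"]) (auto simp: abs_mult)
    also have "(\<integral>\<omega>. \<bar>Z n i \<omega>\<bar> * gap n i k \<omega> \<partial>M) \<le> 1 + (\<integral>\<omega>. \<bar>Z n i \<omega>\<bar> powr p \<partial>M) + (\<integral>\<omega>. \<bar>gap n i k \<omega>\<bar> powr p \<partial>M)"
      using Lp_product_integrable(2)[OF _ _ Z_moment(1) g] by simp
    also have "\<dots> \<le> V" using Z_moment(2)[of n i] gap_moment(2)[OF that, of n] by (simp add: V_def)
    finally show ?thesis using \<rho> by (simp add: mult.commute)
  qed
  consider "i < k" | "k < i" | "i = k" by linarith
  then show ?thesis
  proof cases
    case 1 then show ?thesis using less[of i k] by simp
  next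
    case 2 then show ?thesis using less[of k i] by (simp add: mult.commute)
  next
    case 3
    have "\<bar>\<integral>\<omega>. Z n i \<omega> * Z n i \<omega> \<partial>M\<bar> \<le> (\<integral>\<omega>. \<bar>Z n i \<omega>\<bar> * \<bar>Z n i \<omega>\<bar> \<partial>M)"
      unfolding abs_mult[symmetric] by (rule integral_abs_bound)
    also have "\<dots> \<le> 1 + (\<integral>\<omega>. \<bar>Z n i \<omega>\<bar> powr p \<partial>M) + (\<integral>\<omega>. \<bar>Z n i \<omega>\<bar> powr p \<partial>M)"
      by (rule Lp_product_integrable) (auto intro: Z_moment)
    also have "\<dots> \<le> V" using Z_moment(2)[of n i] by (simp add: V_def)
    finally show ?thesis using 3 by simp
  qed
qed

text \<open>The weights are kept apart from the variables, so that all bounds are stated in terms of sums of squared weights.\<close>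

definition wsum :: "nat \<Rightarrow> (nat \<Rightarrow> real) \<Rightarrow> nat set \<Rightarrow> 'a \<Rightarrow> real" where
  "wsum n w I \<omega> = (\<Sum>k\<in>I. w k * Z n k \<omega>)"

lemma wsum_measurable [measurable]: "wsum n w I \<in> borel_measurable M"
  unfolding wsum_def[abs_def] by measurable

lemma wsum_integrable [simp]: "integrable M (wsum n w I)"
  unfolding wsum_def[abs_def] by auto

lemma wsum_mean [simp]: "(\<integral>\<omega>. wsum n w I \<omega> \<partial>M) = 0"
  unfolding wsum_def[abs_def] by (simp add: Z_mean)

lemma wsum_product: "wsum n w I \<omega> * wsum n w J \<omega> = (\<Sum>i\<in>I. \<Sum>k\<in>J. w i * w k * (Z n i \<omega> * Z n k \<omega>))"
  unfolding wsum_def sum_product by (intro sum.cong) auto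

lemma wsum_product_integrable [simp]: "integrable M (\<lambda>\<omega>. wsum n w I \<omega> * wsum n w J \<omega>)"
  unfolding wsum_product by auto

lemma wsum_product_expectation_le:
  assumes w: "\<And>k. 0 \<le> w k"
  shows "\<bar>\<integral>\<omega>. wsum n w I \<omega> * wsum n w J \<omega> \<partial>M\<bar> \<le> V * (\<Sum>i\<in>I. \<Sum>k\<in>J. w i * w k * \<rho> ^ ((k - i) + (i - k)))"
proof -
  have "(\<integral>\<omega>. wsum n w I \<omega> * wsum n w J \<omega> \<partial>M) = (\<Sum>i\<in>I. \<Sum>k\<in>J. w i * w k * (\<integral>\<omega>. Z n i \<omega> * Z n k \<omega> \<partial>M))"
    unfolding wsum_product by (subst Bochner_Integration.integral_sum) auto
  also have "\<bar>\<dots>\<bar> \<le> (\<Sum>i\<in>I. \<Sum>k\<in>J. \<bar>w i * w k * (\<integral>\<omega>. Z n i \<omega> * Z n k \<omega> \<partial>M)\<bar>)"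
    by (intro order_trans[OF sum_abs] sum_mono sum_abs)
  also have "\<dots> \<le> (\<Sum>i\<in>I. \<Sum>k\<in>J. w i * w k * (V * \<rho> ^ ((k - i) + (i - k))))"
    using covariance_le w by (intro sum_mono) (auto simp: abs_mult intro!: mult_left_mono)
  also have "\<dots> = V * (\<Sum>i\<in>I. \<Sum>k\<in>J. w i * w k * \<rho> ^ ((k - i) + (i - k)))"
    by (simp add: sum_distrib_left mult_ac)
  finally show ?thesis .
qed

lemma wsum_variance_le:
  assumes w: "\<And>k. 0 \<le> w k" and I: "finite I"
  shows "(\<integral>\<omega>. (wsum n w I \<omega>)\<^sup>2 \<partial>M) \<le> 2 * V / (1 - \<rho>) * (\<Sum>k\<in>I. (w k)\<^sup>2)"
proof -
  have "(\<integral>\<omega>. (wsum n w I \<omega>)\<^sup>2 \<partial>M) \<le> V * (\<Sum>i\<in>I. \<Sum>k\<in>I. w i * w k * \<rho> ^ ((k - i) + (i - k)))"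
    using wsum_product_expectation_le[OF w, where n=n and I=I and J=I] by (simp add: power2_eq_square)
  also have "\<dots> \<le> V * (2 / (1 - \<rho>) * (\<Sum>k\<in>I. (w k)\<^sup>2))"
    using V_ge by (intro mult_left_mono schur_bound \<rho> I) auto
  finally show ?thesis by (simp add: mult_ac)
qed


section \<open>A moment inequality of order p\<close>

text \<open>A Rosenthal type inequality. Let \<open>T k\<close> be the partial sums, \<open>f\<close> the function \<^term>\<open>bracket_pow p\<close> and \<open>e k\<close> the
  mean of \<open>f (T k)\<close>. By Taylor's formula \<open>e (Suc k) - e k\<close> is at most the mean of \<open>f' (T k)\<close> times
  the next summand, plus a quadratic term. Writing \<open>f' (T k)\<close> as the telescoping sum of the increments
  \<open>f' (T (Suc i)) - f' (T i)\<close>, each of which depends on the row up to time \<open>i\<close> only, bounds the first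
  part by a sum over \<open>i\<close> with weights \<open>\<rho> ^ (k - i)\<close>. Schur's test sums these bounds over \<open>k\<close>. Young's inequality
  leaves a small multiple of the largest \<open>e i\<close>, which is absorbed into the left-hand side.\<close>

lemma wsum_moment_unit:
  "\<exists>C\<ge>0. \<forall>n v N. (\<forall>k. 0 \<le> v k) \<longrightarrow> (\<Sum>k<N. (v k)\<^sup>2) \<le> 1 \<longrightarrow>
     integrable M (\<lambda>\<omega>. \<bar>wsum n v {..<N} \<omega>\<bar> powr p) \<and> (\<integral>\<omega>. \<bar>wsum n v {..<N} \<omega>\<bar> powr p \<partial>M) \<le> C"
proof -
  \<comment> \<open>This makes the factor of the largest \<open>e i\<close> in the final estimate equal to one half: the constant 30 of the
      Taylor bounds is multiplied by \<open>2 / (1 - \<rho>)\<close> from Schur's test.\<close>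
  define \<tau> where "\<tau> = (1 - \<rho>) / 120"
  have \<tau>: "0 < \<tau>" using \<rho> by (simp add: \<tau>_def)
  obtain K where K: "0 \<le> K"
    and young: "\<And>x y z. max1 x y powr (p - 2) * (\<bar>y\<bar> * \<bar>z\<bar>) \<le> \<tau> * \<bar>x\<bar> powr p + K * (1 + \<bar>y\<bar> powr p + \<bar>z\<bar> powr p)"
    using max1_young[OF p(1) \<tau>] by blast
  define C where "C = 2 + 120 * (K * (1 + 2 * B)) / (1 - \<rho>)"
  have "0 \<le> C" using K B_nonneg \<rho> by (simp add: C_def)
  moreover have "integrable M (\<lambda>\<omega>. \<bar>wsum n v {..<N} \<omega>\<bar> powr p) \<and> (\<integral>\<omega>. \<bar>wsum n v {..<N} \<omega>\<bar> powr p \<partial>M) \<le> C"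
    if v: "\<And>k. 0 \<le> v k" and unit: "(\<Sum>k<N. (v k)\<^sup>2) \<le> 1" for n v N
  proof -
    define T where "T k = wsum n v {..<k}" for k
    have T_measurable [measurable]: "T k \<in> borel_measurable M" for k by (simp add: T_def)
    have T_Suc: "T (Suc k) \<omega> = T k \<omega> + v k * Z n k \<omega>" for k \<omega> by (simp add: T_def wsum_def)
    have T_0: "T 0 \<omega> = 0" for \<omega> by (simp add: T_def wsum_def)
    have T_int: "integrable M (\<lambda>\<omega>. \<bar>T k \<omega>\<bar> powr p)" for k
    proof (induction k)
      case 0 then show ?case by (simp add: T_0)
    next
      case (Suc k)
      have "integrable M (\<lambda>\<omega>. 2 powr p * (\<bar>T k \<omega>\<bar> powr p + \<bar>v k * Z n k \<omega>\<bar> powr p))"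
        using Suc Z_moment(1)[of n k] by (auto simp: abs_mult powr_mult)
      then show ?case
        by (rule Bochner_Integration.integrable_bound)
           (use powr_add_le[of p] p in \<open>auto simp: T_Suc intro!: AE_I2 order_trans[OF powr_add_le]\<close>)
    qed
    have f_int: "integrable M (\<lambda>\<omega>. bracket_pow p (T k \<omega>))" for k
    proof -
      have "integrable M (\<lambda>\<omega>. 2 powr p * (1 + \<bar>T k \<omega>\<bar> powr p))" using T_int by auto
      then show ?thesis
        by (rule Bochner_Integration.integrable_bound)
           (use bracket_pow_le[of p] bracket_pow_nonneg p in \<open>auto intro!: AE_I2\<close>)
    qed
    have f'_int: "integrable M (\<lambda>\<omega>. bracket_pow' p (T k \<omega>))" for k
    proof -
      have "integrable M (\<lambda>\<omega>. p * bracket_pow p (T k \<omega>))" using f_int by auto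
      then show ?thesis
        by (rule Bochner_Integration.integrable_bound)
           (use abs_bracket_pow'_le[of p] bracket_pow_nonneg[of p] p in \<open>auto intro!: AE_I2\<close>)
    qed
    define e where "e k = (\<integral>\<omega>. bracket_pow p (T k \<omega>) \<partial>M)" for k
    have T_le_e: "(\<integral>\<omega>. \<bar>T k \<omega>\<bar> powr p \<partial>M) \<le> e k" for k
      unfolding e_def using p by (intro integral_mono T_int f_int powr_le_bracket_pow) auto
    define E where "E = Max (e ` {..N})"
    have e_le_E: "e k \<le> E" if "k \<le> N" for k
      unfolding E_def using that by (intro Max_ge) auto
    have e_0: "e 0 = 1" by (simp add: e_def T_0 bracket_pow_def prob_space)
    define R where "R = \<tau> * E + K * (1 + 2 * B)"
    have R: "0 \<le> R"
      using e_le_E[of 0] e_0 K B_nonneg \<tau> by (simp add: R_def)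
    have v_le: "v k \<le> 1" if "k < N" for k
    proof -
      have "(v k)\<^sup>2 \<le> (\<Sum>k<N. (v k)\<^sup>2)" using that by (intro member_le_sum) auto
      then have "(v k)\<^sup>2 \<le> 1" using unit by simp
      then show ?thesis using v[of k] by (simp add: power_le_one_iff)
    qed
    define m where "m k \<omega> = max1 (T k \<omega>) (Z n k \<omega>) powr (p - 2)" for k \<omega>
    have m_measurable [measurable]: "m k \<in> borel_measurable M" for k
      unfolding m_def[abs_def] max1_def by measurable
    have m_nonneg: "0 \<le> m k \<omega>" for k \<omega> by (simp add: m_def)
    have m_ge: "max1 (T k \<omega>) (v k * Z n k \<omega>) powr (p - 2) \<le> m k \<omega>" if "k < N" for k \<omega>
    proof -
      have "\<bar>v k * Z n k \<omega>\<bar> \<le> \<bar>Z n k \<omega>\<bar>"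
        using v_le[OF that] v[of k] by (simp add: abs_mult mult_left_le_one_le)
      then show ?thesis unfolding m_def using p by (intro powr_mono2) (auto simp: max1_def)
    qed
    have m_young: "integrable M (\<lambda>\<omega>. m k \<omega> * (\<bar>Z n k \<omega>\<bar> * \<bar>Y \<omega>\<bar>))"
        "(\<integral>\<omega>. m k \<omega> * (\<bar>Z n k \<omega>\<bar> * \<bar>Y \<omega>\<bar>) \<partial>M) \<le> R"
      if Y [measurable]: "Y \<in> borel_measurable M" and Yp: "integrable M (\<lambda>\<omega>. \<bar>Y \<omega>\<bar> powr p)"
        "(\<integral>\<omega>. \<bar>Y \<omega>\<bar> powr p \<partial>M) \<le> B" and k: "k < N" for k Y
    proof -
      let ?b = "\<lambda>\<omega>. \<tau> * \<bar>T k \<omega>\<bar> powr p + K * (1 + \<bar>Z n k \<omega>\<bar> powr p + \<bar>Y \<omega>\<bar> powr p)"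
      have b: "integrable M ?b" using T_int[of k] Z_moment(1)[of n k] Yp(1) by auto
      have le: "m k \<omega> * (\<bar>Z n k \<omega>\<bar> * \<bar>Y \<omega>\<bar>) \<le> ?b \<omega>" for \<omega>
        unfolding m_def by (rule young)
      show 1: "integrable M (\<lambda>\<omega>. m k \<omega> * (\<bar>Z n k \<omega>\<bar> * \<bar>Y \<omega>\<bar>))"
        by (rule Bochner_Integration.integrable_bound[OF b])
           (use le m_nonneg in \<open>auto intro!: AE_I2 order_trans[OF le] simp: abs_mult\<close>)
      have "(\<integral>\<omega>. m k \<omega> * (\<bar>Z n k \<omega>\<bar> * \<bar>Y \<omega>\<bar>) \<partial>M) \<le> (\<integral>\<omega>. ?b \<omega> \<partial>M)"
        by (rule integral_mono[OF 1 b]) (rule le)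
      also have "\<dots> = \<tau> * (\<integral>\<omega>. \<bar>T k \<omega>\<bar> powr p \<partial>M)
          + K * (1 + (\<integral>\<omega>. \<bar>Z n k \<omega>\<bar> powr p \<partial>M) + (\<integral>\<omega>. \<bar>Y \<omega>\<bar> powr p \<partial>M))"
        using T_int[of k] Z_moment(1)[of n k] Yp(1) by (simp add: prob_space)
      also have "\<dots> \<le> \<tau> * E + K * (1 + B + B)"
        using \<tau> K Z_moment(2)[of n k] Yp(2) T_le_e[of k] e_le_E[of k] k
        by (intro add_mono mult_left_mono) auto
      finally show "(\<integral>\<omega>. m k \<omega> * (\<bar>Z n k \<omega>\<bar> * \<bar>Y \<omega>\<bar>) \<partial>M) \<le> R" by (simp add: R_def algebra_simps)
    qed
    have drift: "integrable M (\<lambda>\<omega>. bracket_pow' p (T k \<omega>) * Z n k \<omega>)"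
      "(\<integral>\<omega>. bracket_pow' p (T k \<omega>) * Z n k \<omega> \<partial>M) \<le> (\<Sum>i<k. \<rho> ^ (k - i) * (30 * v i * R))"
      if k: "k < N" for k
    proof -
      define U where "U i \<omega> = bracket_pow' p (T (Suc i) \<omega>) - bracket_pow' p (T i \<omega>)" for i \<omega>
      have U_sum: "bracket_pow' p (T k \<omega>) = (\<Sum>i<k. U i \<omega>)" for \<omega>
        using sum_lessThan_telescope[of "\<lambda>i. bracket_pow' p (T i \<omega>)" k]
        by (simp add: U_def T_0) (simp add: bracket_pow'_def)
      have U_measurable [measurable]: "U i \<in> borel_measurable M" for i
        unfolding U_def[abs_def] by measurable
      have U_step: "integrable M (\<lambda>\<omega>. U i \<omega> * Z n k \<omega>)"
        "\<bar>\<integral>\<omega>. U i \<omega> * Z n k \<omega> \<partial>M\<bar> \<le> \<rho> ^ (k - i) * (30 * v i * R)" if i: "i < k" for i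
      proof -
        have gp: "integrable M (\<lambda>\<omega>. \<bar>gap n i k \<omega>\<bar> powr p)" "(\<integral>\<omega>. \<bar>gap n i k \<omega>\<bar> powr p \<partial>M) \<le> B"
          using gap_moment[OF i, of n] by simp_all
        have iN: "i < N" using i k by simp
        note y = m_young[OF gap_measurable gp iN]
        have le: "\<bar>U i \<omega>\<bar> * gap n i k \<omega> \<le> 30 * v i * (m i \<omega> * (\<bar>Z n i \<omega>\<bar> * \<bar>gap n i k \<omega>\<bar>))" for \<omega>
        proof -
          have "\<bar>U i \<omega>\<bar> \<le> 30 * max1 (T i \<omega>) (v i * Z n i \<omega>) powr (p - 2) * \<bar>v i * Z n i \<omega>\<bar>"
            unfolding U_def T_Suc by (rule bracket_pow'_increment[OF p])
          also have "\<dots> \<le> 30 * m i \<omega> * \<bar>v i * Z n i \<omega>\<bar>"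
            using m_ge[OF iN] by (intro mult_mono) (auto simp: m_nonneg)
          finally have "\<bar>U i \<omega>\<bar> * gap n i k \<omega> \<le> 30 * m i \<omega> * \<bar>v i * Z n i \<omega>\<bar> * gap n i k \<omega>"
            by (intro mult_right_mono) auto
          then show ?thesis using v[of i] by (simp add: abs_mult mult_ac)
        qed
        have bi: "integrable M (\<lambda>\<omega>. 30 * v i * (m i \<omega> * (\<bar>Z n i \<omega>\<bar> * \<bar>gap n i k \<omega>\<bar>)))"
          using y(1) by (intro Bochner_Integration.integrable_mult_right)
        have Ug: "integrable M (\<lambda>\<omega>. \<bar>U i \<omega>\<bar> * gap n i k \<omega>)"
          by (rule Bochner_Integration.integrable_bound[OF bi])
             (use v m_nonneg in \<open>auto intro!: AE_I2 order_trans[OF le] simp: abs_mult\<close>)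
        have Ui: "integrable M (U i)" unfolding U_def[abs_def] using f'_int by auto
        define \<phi> where "\<phi> y = bracket_pow' p (\<Sum>j<Suc i. v j * y j) - bracket_pow' p (\<Sum>j<i. v j * y j)" for y :: "nat \<Rightarrow> real"
        have \<phi>: "\<phi> \<in> borel_measurable (PiM {..i} (\<lambda>_. borel))"
        proof -
          have c: "(\<lambda>y. y j) \<in> borel_measurable (PiM {..i} (\<lambda>_. borel) :: (nat \<Rightarrow> real) measure)" if "j \<le> i" for j
            using that by (intro measurable_component_singleton) auto
          have "(\<lambda>y. \<Sum>j<J. v j * y j) \<in> borel_measurable (PiM {..i} (\<lambda>_. borel))" if "J \<le> Suc i" for J
            using c that by (intro borel_measurable_sum borel_measurable_times) auto
          from this[of "Suc i"] this[of i] show ?thesis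
            unfolding \<phi>_def by (intro borel_measurable_diff measurable_compose[OF _ bracket_pow_measurable(2)]) auto
        qed
        have U\<phi>: "U i \<omega> = \<phi> (\<lambda>j\<in>{..i}. Z n j \<omega>)" for \<omega>
          unfolding U_def \<phi>_def T_def wsum_def
          by (intro arg_cong2[where f="(-)"] arg_cong[where f="bracket_pow' p"] sum.cong) auto
        note etf = expectation_times_future[OF i \<phi> U\<phi> Ui Ug]
        show "integrable M (\<lambda>\<omega>. U i \<omega> * Z n k \<omega>)" by (rule etf(1))
        have "(\<integral>\<omega>. \<bar>U i \<omega>\<bar> * gap n i k \<omega> \<partial>M) \<le> (\<integral>\<omega>. 30 * v i * (m i \<omega> * (\<bar>Z n i \<omega>\<bar> * \<bar>gap n i k \<omega>\<bar>)) \<partial>M)"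
          by (rule integral_mono[OF Ug bi]) (rule le)
        also have "\<dots> = 30 * v i * (\<integral>\<omega>. m i \<omega> * (\<bar>Z n i \<omega>\<bar> * \<bar>gap n i k \<omega>\<bar>) \<partial>M)"
          by (rule integral_mult_right_zero)
        also have "\<dots> \<le> 30 * v i * R"
          using y(2) v by (intro mult_left_mono) auto
        finally show "\<bar>\<integral>\<omega>. U i \<omega> * Z n k \<omega> \<partial>M\<bar> \<le> \<rho> ^ (k - i) * (30 * v i * R)"
          using \<rho> by (intro order_trans[OF etf(2)] mult_left_mono) auto
      qed
      have eq: "bracket_pow' p (T k \<omega>) * Z n k \<omega> = (\<Sum>i<k. U i \<omega> * Z n k \<omega>)" for \<omega>
        by (simp add: U_sum sum_distrib_right)
      show "integrable M (\<lambda>\<omega>. bracket_pow' p (T k \<omega>) * Z n k \<omega>)"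
        unfolding eq using U_step(1) by auto
      have "(\<integral>\<omega>. bracket_pow' p (T k \<omega>) * Z n k \<omega> \<partial>M) = (\<Sum>i<k. \<integral>\<omega>. U i \<omega> * Z n k \<omega> \<partial>M)"
        unfolding eq using U_step(1) by (intro Bochner_Integration.integral_sum) auto
      also have "\<dots> \<le> (\<Sum>i<k. \<rho> ^ (k - i) * (30 * v i * R))"
        using U_step(2) by (intro sum_mono) (auto simp: abs_le_iff)
      finally show "(\<integral>\<omega>. bracket_pow' p (T k \<omega>) * Z n k \<omega> \<partial>M) \<le> (\<Sum>i<k. \<rho> ^ (k - i) * (30 * v i * R))" .
    qed
    have step: "e (Suc k) \<le> e k + 30 * R * (\<Sum>i\<le>k. v k * v i * \<rho> ^ (k - i))" if k: "k < N" for k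
    proof -
      note y = m_young[OF Z_measurable Z_moment k, of n k]
      have "e (Suc k) \<le> (\<integral>\<omega>. bracket_pow p (T k \<omega>) + v k * (bracket_pow' p (T k \<omega>) * Z n k \<omega>)
          + 30 * (v k)\<^sup>2 * (m k \<omega> * (\<bar>Z n k \<omega>\<bar> * \<bar>Z n k \<omega>\<bar>)) \<partial>M)"
        unfolding e_def
      proof (intro integral_mono Bochner_Integration.integrable_add f_int Bochner_Integration.integrable_mult_right drift(1)[OF k] y(1))
        fix \<omega>
        have "bracket_pow p (T (Suc k) \<omega>) \<le> bracket_pow p (T k \<omega>) + bracket_pow' p (T k \<omega>) * (v k * Z n k \<omega>)
            + 30 * max1 (T k \<omega>) (v k * Z n k \<omega>) powr (p - 2) * (v k * Z n k \<omega>)\<^sup>2"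
          unfolding T_Suc by (rule bracket_pow_taylor[OF p])
        also have "\<dots> \<le> bracket_pow p (T k \<omega>) + bracket_pow' p (T k \<omega>) * (v k * Z n k \<omega>)
            + 30 * m k \<omega> * (v k * Z n k \<omega>)\<^sup>2"
          using m_ge[OF k] by (intro add_left_mono mult_right_mono mult_left_mono) auto
        also have "\<dots> = bracket_pow p (T k \<omega>) + v k * (bracket_pow' p (T k \<omega>) * Z n k \<omega>)
            + 30 * (v k)\<^sup>2 * (m k \<omega> * (\<bar>Z n k \<omega>\<bar> * \<bar>Z n k \<omega>\<bar>))"
          by (simp add: power2_eq_square mult_ac)
        finally show "bracket_pow p (T (Suc k) \<omega>) \<le> \<dots>" .
      qed
      also have "\<dots> = e k + v k * (\<integral>\<omega>. bracket_pow' p (T k \<omega>) * Z n k \<omega> \<partial>M)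
          + 30 * (v k)\<^sup>2 * (\<integral>\<omega>. m k \<omega> * (\<bar>Z n k \<omega>\<bar> * \<bar>Z n k \<omega>\<bar>) \<partial>M)"
        using f_int[of k] drift(1)[OF k] y(1) by (simp add: e_def)
      also have "\<dots> \<le> e k + v k * (\<Sum>i<k. \<rho> ^ (k - i) * (30 * v i * R)) + 30 * (v k)\<^sup>2 * R"
        using drift(2)[OF k] y(2) v by (intro add_mono mult_left_mono) auto
      also have "\<dots> = e k + 30 * R * (\<Sum>i\<le>k. v k * v i * \<rho> ^ (k - i))"
        by (simp add: lessThan_Suc_atMost[symmetric] sum_distrib_left power2_eq_square algebra_simps)
      finally show ?thesis .
    qed
    have dbl: "(\<Sum>k<J. \<Sum>i\<le>k. v k * v i * \<rho> ^ (k - i)) \<le> 2 / (1 - \<rho>)" if "J \<le> N" for J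
    proof -
      have "(\<Sum>k<J. \<Sum>i\<le>k. v k * v i * \<rho> ^ (k - i)) \<le> (\<Sum>k<N. \<Sum>i\<le>k. v k * v i * \<rho> ^ (k - i))"
        using that v \<rho> by (intro sum_mono2 sum_nonneg) auto
      also have "\<dots> = (\<Sum>k<N. \<Sum>i\<le>k. v k * v i * \<rho> ^ ((i - k) + (k - i)))"
        by (intro sum.cong) auto
      also have "\<dots> \<le> (\<Sum>k<N. \<Sum>i<N. v k * v i * \<rho> ^ ((i - k) + (k - i)))"
        using v \<rho> by (intro sum_mono sum_mono2) auto
      also have "\<dots> \<le> 2 / (1 - \<rho>) * (\<Sum>k<N. (v k)\<^sup>2)"
        by (rule schur_bound[OF \<rho>]) simp
      also have "\<dots> \<le> 2 / (1 - \<rho>) * 1"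
        using unit \<rho> by (intro mult_left_mono) auto
      finally show ?thesis by simp
    qed
    have sum_steps: "e J \<le> 1 + 30 * R * (\<Sum>k<J. \<Sum>i\<le>k. v k * v i * \<rho> ^ (k - i))" if "J \<le> N" for J
      using that
    proof (induction J)
      case 0 then show ?case by (simp add: e_0)
    next
      case (Suc J)
      then show ?case using step[of J] by (simp add: algebra_simps)
    qed
    have e_le: "e J \<le> 1 + 30 * R * (2 / (1 - \<rho>))" if "J \<le> N" for J
      using sum_steps[OF that] mult_left_mono[OF dbl[OF that], of "30 * R"] R by linarith
    have "E \<le> 1 + 30 * R * (2 / (1 - \<rho>))"
      unfolding E_def using e_le by (subst Max_le_iff) auto
    also have "30 * R * (2 / (1 - \<rho>)) = E / 2 + 60 * (K * (1 + 2 * B)) / (1 - \<rho>)"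
      using \<rho> by (simp add: R_def \<tau>_def field_simps)
    finally have "E \<le> C" by (simp add: C_def)
    then have "(\<integral>\<omega>. \<bar>T N \<omega>\<bar> powr p \<partial>M) \<le> C" using T_le_e[of N] e_le_E[of N] by simp
    then show ?thesis using T_int[of N] by (simp add: T_def)
  qed
  ultimately show ?thesis by blast
qed

text \<open>The general case follows by homogeneity from weights whose squares sum to one.\<close>

lemma wsum_moment:
  obtains C where "0 \<le> C"
    "\<And>n w I. (\<And>k. 0 \<le> w k) \<Longrightarrow> finite I \<Longrightarrow> integrable M (\<lambda>\<omega>. \<bar>wsum n w I \<omega>\<bar> powr p)"
    "\<And>n w I. (\<And>k. 0 \<le> w k) \<Longrightarrow> finite I \<Longrightarrow>
       (\<integral>\<omega>. \<bar>wsum n w I \<omega>\<bar> powr p \<partial>M) \<le> C * (\<Sum>k\<in>I. (w k)\<^sup>2) powr (p / 2)"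
proof -
  obtain C where C: "0 \<le> C" and unit: "\<And>n v N. (\<And>k. 0 \<le> v k) \<Longrightarrow> (\<Sum>k<N. (v k)\<^sup>2) \<le> 1 \<Longrightarrow>
     integrable M (\<lambda>\<omega>. \<bar>wsum n v {..<N} \<omega>\<bar> powr p) \<and> (\<integral>\<omega>. \<bar>wsum n v {..<N} \<omega>\<bar> powr p \<partial>M) \<le> C"
    using wsum_moment_unit by blast
  have "integrable M (\<lambda>\<omega>. \<bar>wsum n w I \<omega>\<bar> powr p) \<and>
       (\<integral>\<omega>. \<bar>wsum n w I \<omega>\<bar> powr p \<partial>M) \<le> C * (\<Sum>k\<in>I. (w k)\<^sup>2) powr (p / 2)"
    if w: "\<And>k. 0 \<le> w k" and I: "finite I" for n w I
  proof (cases "(\<Sum>k\<in>I. (w k)\<^sup>2) = 0")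
    case True
    then have "w k = 0" if "k \<in> I" for k
      using that I by (subst (asm) sum_nonneg_eq_0_iff) auto
    then have "wsum n w I \<omega> = 0" for \<omega> by (simp add: wsum_def)
    then show ?thesis using True p by simp
  next
    case False
    define A where "A = (\<Sum>k\<in>I. (w k)\<^sup>2)"
    have A: "0 < A" using False sum_nonneg[of I "\<lambda>k. (w k)\<^sup>2"] by (simp add: A_def order.not_eq_order_implies_strict)
    obtain N where N: "I \<subseteq> {..<N}" using finite_nat_bounded[OF I] by auto
    define v where "v k = (if k \<in> I then w k / sqrt A else 0)" for k
    have v: "0 \<le> v k" for k using w A by (simp add: v_def)
    have "(\<Sum>k<N. (v k)\<^sup>2) = (\<Sum>k\<in>I. (w k / sqrt A)\<^sup>2)"
      using N by (intro sum.mono_neutral_cong_right) (auto simp: v_def)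
    also have "\<dots> = 1" using A by (simp add: power_divide sum_divide_distrib[symmetric] A_def[symmetric])
    finally have vv: "(\<Sum>k<N. (v k)\<^sup>2) \<le> 1" by simp
    have "wsum n v {..<N} \<omega> = wsum n w I \<omega> / sqrt A" for \<omega>
    proof -
      have "wsum n v {..<N} \<omega> = (\<Sum>k\<in>I. w k / sqrt A * Z n k \<omega>)"
        unfolding wsum_def using N by (intro sum.mono_neutral_cong_right) (auto simp: v_def)
      then show ?thesis by (simp add: wsum_def sum_divide_distrib)
    qed
    then have eq: "\<bar>wsum n w I \<omega>\<bar> powr p = A powr (p / 2) * \<bar>wsum n v {..<N} \<omega>\<bar> powr p" for \<omega>
    proof -
      have "\<bar>wsum n w I \<omega>\<bar> = sqrt A * \<bar>wsum n v {..<N} \<omega>\<bar>"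
        using A \<open>wsum n v {..<N} \<omega> = wsum n w I \<omega> / sqrt A\<close> by (simp add: abs_div)
      then have "\<bar>wsum n w I \<omega>\<bar> powr p = (sqrt A) powr p * \<bar>wsum n v {..<N} \<omega>\<bar> powr p"
        by (simp add: powr_mult)
      also have "(sqrt A) powr p = A powr (p / 2)"
        using A by (simp add: powr_half_sqrt[symmetric] powr_powr)
      finally show ?thesis .
    qed
    show ?thesis
      unfolding eq using unit[OF v vv, of n] by (auto simp: A_def mult.commute intro!: mult_right_mono)
  qed
  with C show ?thesis by (intro that) blast+
qed

end

section \<open>Gaussian approximation of characteristic functions\<close>

lemma norm_iexp_diff_le: "cmod (iexp a - iexp b) \<le> \<bar>a - b\<bar>"
proof -
  have "iexp a - iexp b = iexp b * (iexp (a - b) - 1)"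
    by (simp add: algebra_simps exp_add[symmetric])
  then have "cmod (iexp a - iexp b) = cmod (iexp (a - b) - 1)"
    by (simp add: norm_mult)
  also have "\<dots> \<le> \<bar>a - b\<bar>"
    using iexp_approx1[of "a - b" 0] by simp
  finally show ?thesis .
qed

text \<open>The bounds \<open>\<bar>y\<bar>\<^sup>2\<close> and \<open>\<bar>y\<bar>\<^sup>3\<close> for the remainder are interpolated, since the variables have moments of order \<open>p \<le> 3\<close>
  only.\<close>

lemma norm_iexp_taylor2_le:
  assumes p: "2 \<le> p" "p \<le> 3"
  shows "cmod (iexp y - (1 + \<i> * y - y\<^sup>2 / 2)) \<le> \<bar>y\<bar> powr p"
proof -
  have eq: "(\<Sum>k\<le>2. (\<i> * complex_of_real y) ^ k / fact k) = 1 + \<i> * y - y\<^sup>2 / 2"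
    by (simp add: numeral_2_eq_2 power_mult_distrib)
  show ?thesis
  proof (cases "\<bar>y\<bar> \<le> 1")
    case True
    have "cmod (iexp y - (1 + \<i> * y - y\<^sup>2 / 2)) \<le> \<bar>y\<bar> ^ 3 / 6"
      using iexp_approx1[of y 2] unfolding eq by (simp add: numeral_3_eq_3 numeral_2_eq_2 fact_numeral)
    also have "\<dots> \<le> \<bar>y\<bar> ^ 3" by simp
    also have "\<dots> = \<bar>y\<bar> powr 3" by (cases "y = 0") auto
    also have "\<dots> \<le> \<bar>y\<bar> powr p" using p True by (cases "y = 0") (auto intro!: powr_mono' simp del: powr_numeral)
    finally show ?thesis .
  next
    case False
    have "cmod (iexp y - (1 + \<i> * y - y\<^sup>2 / 2)) \<le> \<bar>y\<bar> ^ 2"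
      using iexp_approx2[of y 2] unfolding eq by simp
    also have "\<dots> = \<bar>y\<bar> powr 2" using False by auto
    also have "\<dots> \<le> \<bar>y\<bar> powr p" using p False by (intro powr_mono) auto
    finally show ?thesis .
  qed
qed

lemma exp_minus_linear_le:
  fixes u :: real assumes "0 \<le> u"
  shows "\<bar>exp (- u) - (1 - u)\<bar> \<le> u\<^sup>2"
proof -
  have "exp (- u) \<ge> 1 - u" using exp_ge_add_one_self[of "- u"] by simp
  moreover have "exp (- u) \<le> 1 - u + u\<^sup>2"
  proof -
    have "(1 + u) * exp (- u) \<le> 1"
      using exp_ge_add_one_self[of u] mult_right_mono[of "1 + u" "exp u" "exp (- u)"]
      by (simp add: exp_add[symmetric])
    also have "1 \<le> (1 + u) * (1 - u + u\<^sup>2)"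
      using assms by (simp add: algebra_simps power2_eq_square)
    finally show ?thesis using assms by (simp add: mult_le_cancel_left_pos)
  qed
  ultimately show ?thesis by simp
qed

lemma abs_exp_minus_diff_le:
  fixes a b :: real assumes "0 \<le> a" "0 \<le> b"
  shows "\<bar>exp (- a) - exp (- b)\<bar> \<le> \<bar>a - b\<bar>"
proof -
  have main: "exp (- a) - exp (- b) \<le> b - a" if "0 \<le> a" "a \<le> b" for a b :: real
  proof -
    have "exp (- a) - exp (- b) = exp (- a) * (1 - exp (- (b - a)))"
      by (simp add: algebra_simps exp_add[symmetric])
    also have "\<dots> \<le> 1 * (b - a)"
    proof (rule mult_mono)
      show "1 - exp (- (b - a)) \<le> b - a" using exp_ge_add_one_self[of "- (b - a)"] by linarith
    qed (use that in auto)
    finally show ?thesis by simp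
  qed
  show ?thesis
  proof (cases "a \<le> b")
    case True then show ?thesis using main[of a b] assms by simp
  next
    case False then show ?thesis using main[of b a] assms by simp
  qed
qed

context prob_space
begin

definition cf :: "('a \<Rightarrow> real) \<Rightarrow> real \<Rightarrow> complex" where
  "cf X x = char (distr M borel X) x"

lemma cf_eq: "X \<in> borel_measurable M \<Longrightarrow> cf X x = (CLINT \<omega>|M. iexp (x * X \<omega>))"
  unfolding cf_def char_def by (subst integral_distr) auto

lemma norm_cf_le_1: "X \<in> borel_measurable M \<Longrightarrow> cmod (cf X x) \<le> 1"
  unfolding cf_def by (rule real_distribution.cmod_char_le_1) simp

lemma cf_diff_le:
  assumes [measurable]: "X \<in> borel_measurable M" "Y \<in> borel_measurable M"
    and int: "integrable M (\<lambda>\<omega>. \<bar>X \<omega> - Y \<omega>\<bar>)"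
  shows "cmod (cf X x - cf Y x) \<le> \<bar>x\<bar> * (\<integral>\<omega>. \<bar>X \<omega> - Y \<omega>\<bar> \<partial>M)"
proof -
  have i: "integrable M (\<lambda>\<omega>. iexp (x * X \<omega>))" "integrable M (\<lambda>\<omega>. iexp (x * Y \<omega>))"
    by (auto intro!: integrable_iexp)
  have "cmod (cf X x - cf Y x) = cmod (CLINT \<omega>|M. iexp (x * X \<omega>) - iexp (x * Y \<omega>))"
    using i by (simp add: cf_eq)
  also have "\<dots> \<le> (\<integral>\<omega>. cmod (iexp (x * X \<omega>) - iexp (x * Y \<omega>)) \<partial>M)"
    by (rule integral_norm_bound)
  also have "\<dots> \<le> (\<integral>\<omega>. \<bar>x\<bar> * \<bar>X \<omega> - Y \<omega>\<bar> \<partial>M)"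
  proof (rule integral_mono)
    show "cmod (iexp (x * X \<omega>) - iexp (x * Y \<omega>)) \<le> \<bar>x\<bar> * \<bar>X \<omega> - Y \<omega>\<bar>" for \<omega>
      using norm_iexp_diff_le[of "x * X \<omega>" "x * Y \<omega>"] by (simp add: abs_mult[symmetric] right_diff_distrib)
  qed (use i int in auto)
  finally show ?thesis by simp
qed

lemma cf_gaussian_approx:
  assumes X [measurable]: "X \<in> borel_measurable M" and p: "2 \<le> p" "p \<le> 3"
    and int: "integrable M X" "integrable M (\<lambda>\<omega>. (X \<omega>)\<^sup>2)" "integrable M (\<lambda>\<omega>. \<bar>X \<omega>\<bar> powr p)"
    and mean: "(\<integral>\<omega>. X \<omega> \<partial>M) = 0"
  defines "\<sigma>2 \<equiv> (\<integral>\<omega>. (X \<omega>)\<^sup>2 \<partial>M)"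
  shows "cmod (cf X x - exp (- (x\<^sup>2 * \<sigma>2 / 2))) \<le> \<bar>x\<bar> powr p * (\<integral>\<omega>. \<bar>X \<omega>\<bar> powr p \<partial>M) + (x\<^sup>2 * \<sigma>2 / 2)\<^sup>2"
proof -
  let ?q = "\<lambda>\<omega>. 1 + \<i> * complex_of_real (x * X \<omega>) - complex_of_real ((x * X \<omega>)\<^sup>2) / 2"
  have i1: "integrable M (\<lambda>\<omega>. iexp (x * X \<omega>))" by (auto intro!: integrable_iexp)
  have i2: "integrable M ?q"
    by (intro Bochner_Integration.integrable_diff Bochner_Integration.integrable_add integrable_const
          integrable_mult_right Bochner_Integration.integrable_divide integrable_of_real)
       (use int in \<open>auto simp: power_mult_distrib\<close>)
  have q: "(CLINT \<omega>|M. ?q \<omega>) = 1 - x\<^sup>2 * \<sigma>2 / 2"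
  proof -
    have "(CLINT \<omega>|M. ?q \<omega>) = 1 + \<i> * (CLINT \<omega>|M. complex_of_real (x * X \<omega>)) - (CLINT \<omega>|M. complex_of_real (x\<^sup>2 * (X \<omega>)\<^sup>2)) / 2"
      using int by (simp add: prob_space power_mult_distrib del: of_real_mult of_real_power)
    also have "\<dots> = 1 - x\<^sup>2 * \<sigma>2 / 2"
    proof -
      have "(CLINT \<omega>|M. complex_of_real (x * X \<omega>)) = complex_of_real (\<integral>\<omega>. x * X \<omega> \<partial>M)"
        by (rule integral_of_real) (use int in auto)
      moreover have "(CLINT \<omega>|M. complex_of_real (x\<^sup>2 * (X \<omega>)\<^sup>2)) = complex_of_real (\<integral>\<omega>. x\<^sup>2 * (X \<omega>)\<^sup>2 \<partial>M)"
        by (rule integral_of_real) (use int in auto)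
      ultimately show ?thesis by (simp add: mean \<sigma>2_def del: of_real_mult of_real_power)
    qed
    finally show ?thesis .
  qed
  have "cmod (cf X x - (1 - x\<^sup>2 * \<sigma>2 / 2)) = cmod (CLINT \<omega>|M. iexp (x * X \<omega>) - ?q \<omega>)"
    unfolding q[symmetric] cf_eq[OF X] using i1 i2 by (subst Bochner_Integration.integral_diff) auto
  also have "\<dots> \<le> (\<integral>\<omega>. cmod (iexp (x * X \<omega>) - ?q \<omega>) \<partial>M)"
    by (rule integral_norm_bound)
  also have "\<dots> \<le> (\<integral>\<omega>. \<bar>x\<bar> powr p * \<bar>X \<omega>\<bar> powr p \<partial>M)"
  proof (rule integral_mono)
    show "cmod (iexp (x * X \<omega>) - ?q \<omega>) \<le> \<bar>x\<bar> powr p * \<bar>X \<omega>\<bar> powr p" for \<omega>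
      using norm_iexp_taylor2_le[OF p, of "x * X \<omega>"] by (simp add: abs_mult powr_mult)
  qed (use i1 i2 int in auto)
  also have "\<dots> = \<bar>x\<bar> powr p * (\<integral>\<omega>. \<bar>X \<omega>\<bar> powr p \<partial>M)" by simp
  finally have 1: "cmod (cf X x - complex_of_real (1 - x\<^sup>2 * \<sigma>2 / 2)) \<le> \<bar>x\<bar> powr p * (\<integral>\<omega>. \<bar>X \<omega>\<bar> powr p \<partial>M)"
    by simp
  have "0 \<le> \<sigma>2" by (simp add: \<sigma>2_def)
  then have "\<bar>exp (- (x\<^sup>2 * \<sigma>2 / 2)) - (1 - x\<^sup>2 * \<sigma>2 / 2)\<bar> \<le> (x\<^sup>2 * \<sigma>2 / 2)\<^sup>2"
    by (intro exp_minus_linear_le) auto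
  then have 2: "cmod (complex_of_real (1 - x\<^sup>2 * \<sigma>2 / 2) - complex_of_real (exp (- (x\<^sup>2 * \<sigma>2 / 2)))) \<le> (x\<^sup>2 * \<sigma>2 / 2)\<^sup>2"
    unfolding of_real_diff[symmetric] norm_of_real by (simp add: abs_minus_commute)
  show ?thesis
    using norm_triangle_le[OF add_mono[OF 1 2]] by simp
qed

end

section \<open>Big and small blocks\<close>

context coupled_array
begin

lemma wsum_copy_law:
  assumes J: "finite J" "J \<subseteq> {i<..}"
  shows "distr M borel (\<lambda>\<omega>. \<Sum>k\<in>J. w k * Z' n i k \<omega>) = distr M borel (wsum n w J)"
proof -
  let ?N = "PiM {i<..} (\<lambda>_. borel) :: (nat \<Rightarrow> real) measure"
  have s: "(\<lambda>y. \<Sum>k\<in>J. w k * y k) \<in> borel_measurable ?N"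
    using J by (intro borel_measurable_sum borel_measurable_times measurable_component_singleton) auto
  have "distr M borel (\<lambda>\<omega>. \<Sum>k\<in>J. w k * Z' n i k \<omega>)
     = distr (distr M ?N (\<lambda>\<omega>. \<lambda>k\<in>{i<..}. Z' n i k \<omega>)) borel (\<lambda>y. \<Sum>k\<in>J. w k * y k)"
    by (subst distr_distr[OF s]) (use J in \<open>auto simp: comp_def subset_eq intro!: distr_cong sum.cong\<close>)
  also have "\<dots> = distr M borel (wsum n w J)"
    unfolding copy_law by (subst distr_distr[OF s]) (use J in \<open>auto simp: comp_def wsum_def subset_eq intro!: distr_cong sum.cong\<close>)
  finally show ?thesis .
qed

text \<open>Replacing the sum over \<open>J\<close> by its recomputed version makes it independent of the sum over \<open>I\<close> without changing its
  law, and costs a factor \<open>\<rho> ^ m\<close> when the two index sets are \<open>m\<close> apart.\<close>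

lemma cf_decouple:
  assumes w: "\<And>k. 0 \<le> w k" and I: "finite I" "I \<subseteq> {..i}" and J: "finite J" "J \<subseteq> {i + m..}" and m: "1 \<le> m"
  shows "cmod (cf (wsum n w (I \<union> J)) x - cf (wsum n w I) x * cf (wsum n w J) x) \<le> \<bar>x\<bar> * (V * \<rho> ^ m * (\<Sum>k\<in>J. w k))"
proof -
  define Y where "Y \<omega> = (\<Sum>k\<in>J. w k * Z' n i k \<omega>)" for \<omega>
  have Jgt: "J \<subseteq> {i<..}" using J m by auto
  have Y_measurable [measurable]: "Y \<in> borel_measurable M" unfolding Y_def[abs_def] by measurable
  have "indep_var borel ((\<lambda>y. \<Sum>k\<in>I. w k * y k) \<circ> (\<lambda>\<omega>. \<lambda>k\<in>{..i}. Z n k \<omega>))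
      borel ((\<lambda>y. \<Sum>k\<in>J. w k * y k) \<circ> (\<lambda>\<omega>. \<lambda>k\<in>{i<..}. Z' n i k \<omega>))"
    using I Jgt
    by (intro indep_var_compose[OF copy_indep] borel_measurable_sum borel_measurable_times measurable_component_singleton) auto
  moreover have "(\<lambda>y. \<Sum>k\<in>I. w k * y k) \<circ> (\<lambda>\<omega>. \<lambda>k\<in>{..i}. Z n k \<omega>) = wsum n w I"
    using I by (auto simp: fun_eq_iff wsum_def intro!: sum.cong)
  moreover have "(\<lambda>y. \<Sum>k\<in>J. w k * y k) \<circ> (\<lambda>\<omega>. \<lambda>k\<in>{i<..}. Z' n i k \<omega>) = Y"
    using Jgt by (auto simp: fun_eq_iff Y_def intro!: sum.cong)
  ultimately have "indep_var borel (wsum n w I) borel Y" by simp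
  then have "cf (\<lambda>\<omega>. wsum n w I \<omega> + Y \<omega>) x = cf (wsum n w I) x * cf Y x"
    unfolding cf_def by (rule char_distr_add)
  also have "cf Y x = cf (wsum n w J) x"
    unfolding cf_def Y_def by (simp add: wsum_copy_law[OF J(1) Jgt])
  finally have prod: "cf (\<lambda>\<omega>. wsum n w I \<omega> + Y \<omega>) x = cf (wsum n w I) x * cf (wsum n w J) x" .
  have split: "wsum n w (I \<union> J) \<omega> = wsum n w I \<omega> + wsum n w J \<omega>" for \<omega>
    unfolding wsum_def using I J m by (intro sum.union_disjoint) force+
  have dist: "\<bar>wsum n w (I \<union> J) \<omega> - (wsum n w I \<omega> + Y \<omega>)\<bar> \<le> (\<Sum>k\<in>J. w k * (\<rho> ^ m * gap n i k \<omega>))" for \<omega>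
  proof -
    have "\<bar>wsum n w (I \<union> J) \<omega> - (wsum n w I \<omega> + Y \<omega>)\<bar> = \<bar>\<Sum>k\<in>J. w k * (Z n k \<omega> - Z' n i k \<omega>)\<bar>"
      unfolding split by (simp add: wsum_def Y_def sum_subtractf right_diff_distrib)
    also have "\<dots> \<le> (\<Sum>k\<in>J. \<bar>w k * (Z n k \<omega> - Z' n i k \<omega>)\<bar>)" by (rule sum_abs)
    also have "\<dots> \<le> (\<Sum>k\<in>J. w k * (\<rho> ^ m * gap n i k \<omega>))"
    proof (rule sum_mono)
      fix k assume "k \<in> J"
      then have "m \<le> k - i" using J by auto
      then have "\<rho> ^ (k - i) * gap n i k \<omega> \<le> \<rho> ^ m * gap n i k \<omega>"
        using \<rho> by (intro mult_right_mono power_decreasing) auto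
      then show "\<bar>w k * (Z n k \<omega> - Z' n i k \<omega>)\<bar> \<le> w k * (\<rho> ^ m * gap n i k \<omega>)"
        using w by (auto simp: abs_mult abs_diff_copy intro!: mult_left_mono)
    qed
    finally show ?thesis .
  qed
  have gi: "integrable M (\<lambda>\<omega>. \<Sum>k\<in>J. w k * (\<rho> ^ m * gap n i k \<omega>))"
    using Jgt by (intro Bochner_Integration.integrable_sum integrable_mult_right gap_mean(1)) auto
  have di: "integrable M (\<lambda>\<omega>. \<bar>wsum n w (I \<union> J) \<omega> - (wsum n w I \<omega> + Y \<omega>)\<bar>)"
    by (rule Bochner_Integration.integrable_bound[OF gi]) (auto intro!: AE_I2 order_trans[OF dist])
  have "cmod (cf (wsum n w (I \<union> J)) x - cf (wsum n w I) x * cf (wsum n w J) x)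
      \<le> \<bar>x\<bar> * (\<integral>\<omega>. \<bar>wsum n w (I \<union> J) \<omega> - (wsum n w I \<omega> + Y \<omega>)\<bar> \<partial>M)"
    unfolding prod[symmetric] by (rule cf_diff_le) (use di in auto)
  also have "(\<integral>\<omega>. \<bar>wsum n w (I \<union> J) \<omega> - (wsum n w I \<omega> + Y \<omega>)\<bar> \<partial>M) \<le> (\<integral>\<omega>. (\<Sum>k\<in>J. w k * (\<rho> ^ m * gap n i k \<omega>)) \<partial>M)"
    by (rule integral_mono[OF di gi]) (rule dist)
  also have "\<dots> = (\<Sum>k\<in>J. w k * (\<rho> ^ m * (\<integral>\<omega>. gap n i k \<omega> \<partial>M)))"
    using gap_mean(1)[of i] Jgt by (subst Bochner_Integration.integral_sum) (auto simp: subset_eq)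
  also have "\<dots> \<le> (\<Sum>k\<in>J. w k * (\<rho> ^ m * V))"
    using Jgt w \<rho> by (intro sum_mono mult_left_mono gap_mean(2)) auto
  also have "\<dots> = V * \<rho> ^ m * (\<Sum>k\<in>J. w k)"
    by (simp only: sum_distrib_left sum_distrib_right mult_ac)
  finally show ?thesis by (simp add: mult_left_mono)
qed

lemma product_decouple:
  assumes w: "\<And>k. 0 \<le> w k" and I: "I \<subseteq> {..i}" and J: "J \<subseteq> {i + m..}"
  shows "\<bar>\<integral>\<omega>. wsum n w I \<omega> * wsum n w J \<omega> \<partial>M\<bar> \<le> V * \<rho> ^ m * ((\<Sum>k\<in>I. w k) * (\<Sum>k\<in>J. w k))"
proof -
  have "\<bar>\<integral>\<omega>. wsum n w I \<omega> * wsum n w J \<omega> \<partial>M\<bar> \<le> V * (\<Sum>i\<in>I. \<Sum>k\<in>J. w i * w k * \<rho> ^ ((k - i) + (i - k)))"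
    by (rule wsum_product_expectation_le[OF w])
  also have "\<dots> \<le> V * (\<Sum>i\<in>I. \<Sum>k\<in>J. w i * w k * \<rho> ^ m)"
    using V_ge w I J \<rho>
    by (intro mult_left_mono sum_mono power_decreasing) force+
  also have "\<dots> = V * \<rho> ^ m * ((\<Sum>k\<in>I. w k) * (\<Sum>k\<in>J. w k))"
    unfolding sum_product by (simp add: sum_distrib_left mult_ac)
  finally show ?thesis .
qed


text \<open>Blocks are numbered from \<open>0\<close>, the indices inside the blocks from \<open>1\<close>: the block with number \<open>j\<close> starts right after
  \<open>(l + m) * j\<close> with \<open>l\<close> indices in the big part, followed by \<open>m\<close> in the small part.\<close>

definition big :: "nat \<Rightarrow> nat \<Rightarrow> nat \<Rightarrow> nat set" where
  "big l m j = {(l + m) * j + 1..(l + m) * j + l}"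

definition small :: "nat \<Rightarrow> nat \<Rightarrow> nat \<Rightarrow> nat set" where
  "small l m j = {(l + m) * j + l + 1..(l + m) * j + (l + m)}"

definition bigs :: "nat \<Rightarrow> nat \<Rightarrow> nat \<Rightarrow> nat set" where
  "bigs l m b = (\<Union>j<b. big l m j)"

definition smalls :: "nat \<Rightarrow> nat \<Rightarrow> nat \<Rightarrow> nat set" where
  "smalls l m b = (\<Union>j<b. small l m j)"

lemma finite_blocks [simp]: "finite (big l m j)" "finite (small l m j)" "finite (bigs l m b)" "finite (smalls l m b)"
  by (simp_all add: big_def small_def bigs_def smalls_def)

lemma bigs_Suc: "bigs l m (Suc b) = bigs l m b \<union> big l m b"
  by (auto simp: bigs_def lessThan_Suc)

lemma smalls_Suc: "smalls l m (Suc b) = smalls l m b \<union> small l m b"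
  by (auto simp: smalls_def lessThan_Suc)

lemma blocks_cover: "bigs l m b \<union> smalls l m b = {1..(l + m) * b}"
proof (induction b)
  case (Suc b)
  have "bigs l m (Suc b) \<union> smalls l m (Suc b) = {1..(l + m) * b} \<union> (big l m b \<union> small l m b)"
    using Suc by (auto simp: bigs_Suc smalls_Suc)
  also have "big l m b \<union> small l m b = {(l + m) * b + 1..(l + m) * b + (l + m)}"
    by (auto simp: big_def small_def)
  also have "{1..(l + m) * b} \<union> \<dots> = {1..(l + m) * Suc b}" by auto
  finally show ?case .
qed (auto simp: bigs_def smalls_def)

lemma bigs_le: "bigs l m b \<subseteq> {..(l + m) * b}"
  using blocks_cover[of l m b] by auto

lemma smalls_le: "smalls l m b \<subseteq> {..(l + m) * b}"
  using blocks_cover[of l m b] by auto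

lemma blocks_disjoint: "bigs l m b \<inter> smalls l m b = {}"
proof (induction b)
  case (Suc b)
  have "bigs l m b \<inter> small l m b = {}" using bigs_le[of l m b] by (force simp: small_def)
  moreover have "big l m b \<inter> smalls l m b = {}" using smalls_le[of l m b] by (force simp: big_def)
  moreover have "big l m b \<inter> small l m b = {}" by (auto simp: big_def small_def)
  ultimately show ?case using Suc by (auto simp: bigs_Suc smalls_Suc)
qed (auto simp: bigs_def)

lemma bigs_disjoint: "bigs l m b \<inter> big l m b = {}"
  using bigs_le[of l m b] by (force simp: big_def)

lemma smalls_disjoint: "smalls l m b \<inter> small l m b = {}"
  using smalls_le[of l m b] by (force simp: small_def)

lemma sum_bigs: "(\<Sum>k\<in>bigs l m b. f k) = (\<Sum>j<b. \<Sum>k\<in>big l m j. f k :: real)"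
  by (induction b) (simp_all add: bigs_Suc sum.union_disjoint bigs_disjoint, simp add: bigs_def)

lemma sum_smalls: "(\<Sum>k\<in>smalls l m b. f k) = (\<Sum>j<b. \<Sum>k\<in>small l m j. f k :: real)"
  by (induction b) (simp_all add: smalls_Suc sum.union_disjoint smalls_disjoint, simp add: smalls_def)

lemma bigs_gap:
  assumes "0 < b" "1 \<le> m"
  shows "bigs l m b \<subseteq> {..(l + m) * b - m}" "big l m b \<subseteq> {(l + m) * b - m + m..}"
proof -
  obtain c where c: "b = Suc c" using assms by (cases b) auto
  have "k \<le> (l + m) * b - m" if "k \<in> bigs l m b" for k
    using that bigs_le[of l m c] unfolding c bigs_Suc big_def by (auto simp: subset_eq)
  then show "bigs l m b \<subseteq> {..(l + m) * b - m}" by auto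
  show "big l m b \<subseteq> {(l + m) * b - m + m..}" by (auto simp: big_def c)
qed

text \<open>Induction on the number of blocks. The blocks before number \<open>b\<close> are decoupled at the time \<open>(l + m) * b - m\<close>, which is the last index of the big
  block before.\<close>

lemma cf_bigs:
  assumes w: "\<And>k. 0 \<le> w k" and m: "1 \<le> m"
  shows "cmod (cf (wsum n w (bigs l m b)) x - (\<Prod>j<b. cf (wsum n w (big l m j)) x))
       \<le> \<bar>x\<bar> * (V * \<rho> ^ m * (\<Sum>k\<in>bigs l m b. w k))"
proof (induction b)
  case 0
  have "cf (wsum n w {}) x = 1" by (subst cf_eq) (simp_all add: wsum_def prob_space)
  then show ?case by (simp add: bigs_def)
next
  case (Suc b)
  let ?P = "cf (wsum n w (bigs l m b)) x" and ?S = "cf (wsum n w (big l m b)) x"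
    and ?Q = "\<Prod>j<b. cf (wsum n w (big l m j)) x"
  have step: "cmod (cf (wsum n w (bigs l m b \<union> big l m b)) x - ?P * ?S) \<le> \<bar>x\<bar> * (V * \<rho> ^ m * (\<Sum>k\<in>big l m b. w k))"
  proof (cases "b = 0")
    case True
    have "cf (wsum n w {}) x = 1" by (subst cf_eq) (simp_all add: wsum_def prob_space)
    then show ?thesis using True w V_ge \<rho> by (simp add: bigs_def sum_nonneg)
  next
    case False
    then show ?thesis using bigs_gap[OF _ m, of b l] by (intro cf_decouple[OF w _ _ _ _ m]) auto
  qed
  have "cmod (?P * ?S - ?Q * ?S) = cmod (?P - ?Q) * cmod ?S"
    by (simp add: norm_mult left_diff_distrib[symmetric])
  also have "\<dots> \<le> \<bar>x\<bar> * (V * \<rho> ^ m * (\<Sum>k\<in>bigs l m b. w k)) * 1"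
    using Suc norm_cf_le_1[of "wsum n w (big l m b)" x] by (intro mult_mono) (auto intro: order_trans[OF norm_ge_zero])
  finally have "cmod (cf (wsum n w (bigs l m b \<union> big l m b)) x - ?P * ?S + (?P * ?S - ?Q * ?S))
      \<le> \<bar>x\<bar> * (V * \<rho> ^ m * (\<Sum>k\<in>big l m b. w k)) + \<bar>x\<bar> * (V * \<rho> ^ m * (\<Sum>k\<in>bigs l m b. w k)) * 1"
    using step by (intro norm_triangle_le add_mono) auto
  then show ?case
    by (simp add: bigs_Suc sum.union_disjoint bigs_disjoint algebra_simps)
qed

lemma wsum_union: "finite I \<Longrightarrow> finite J \<Longrightarrow> I \<inter> J = {} \<Longrightarrow> wsum n w (I \<union> J) \<omega> = wsum n w I \<omega> + wsum n w J \<omega>"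
  unfolding wsum_def by (rule sum.union_disjoint)

lemma wsum_square_integrable [simp]: "integrable M (\<lambda>\<omega>. (wsum n w I \<omega>)\<^sup>2)"
  unfolding power2_eq_square by (rule wsum_product_integrable)

lemma wsum_union_square:
  assumes "finite I" "finite J" "I \<inter> J = {}"
  shows "(\<integral>\<omega>. (wsum n w (I \<union> J) \<omega>)\<^sup>2 \<partial>M)
    = (\<integral>\<omega>. (wsum n w I \<omega>)\<^sup>2 \<partial>M) + (\<integral>\<omega>. (wsum n w J \<omega>)\<^sup>2 \<partial>M) + 2 * (\<integral>\<omega>. wsum n w I \<omega> * wsum n w J \<omega> \<partial>M)"
proof -
  have "(\<integral>\<omega>. (wsum n w (I \<union> J) \<omega>)\<^sup>2 \<partial>M)
     = (\<integral>\<omega>. (wsum n w I \<omega>)\<^sup>2 + (wsum n w J \<omega>)\<^sup>2 + 2 * (wsum n w I \<omega> * wsum n w J \<omega>) \<partial>M)"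
    by (rule Bochner_Integration.integral_cong) (auto simp: wsum_union[OF assms] power2_sum)
  then show ?thesis by simp
qed

lemma variance_bigs:
  assumes w: "\<And>k. 0 \<le> w k" and m: "1 \<le> m"
  shows "\<bar>(\<integral>\<omega>. (wsum n w (bigs l m b) \<omega>)\<^sup>2 \<partial>M) - (\<Sum>j<b. \<integral>\<omega>. (wsum n w (big l m j) \<omega>)\<^sup>2 \<partial>M)\<bar>
     \<le> 2 * V * \<rho> ^ m * (\<Sum>k\<in>bigs l m b. w k)\<^sup>2"
proof (induction b)
  case 0 then show ?case by (simp add: bigs_def wsum_def)
next
  case (Suc b)
  let ?a = "\<Sum>k\<in>bigs l m b. w k" and ?c = "\<Sum>k\<in>big l m b. w k"
  have ac: "0 \<le> ?a" "0 \<le> ?c" using w by (auto intro: sum_nonneg)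
  have step: "\<bar>\<integral>\<omega>. wsum n w (bigs l m b) \<omega> * wsum n w (big l m b) \<omega> \<partial>M\<bar> \<le> V * \<rho> ^ m * (?a * ?c)"
  proof (cases "b = 0")
    case True then show ?thesis by (simp add: bigs_def wsum_def)
  next
    case False
    then show ?thesis using bigs_gap[OF _ m, of b l] by (intro product_decouple[OF w]) auto
  qed
  have "V * \<rho> ^ m * (2 * ?a\<^sup>2 + 2 * (?a * ?c)) \<le> V * \<rho> ^ m * (2 * (?a + ?c)\<^sup>2)"
    using V_ge \<rho> ac by (intro mult_left_mono) (auto simp: power2_sum)
  then have "2 * V * \<rho> ^ m * ?a\<^sup>2 + 2 * (V * \<rho> ^ m * (?a * ?c)) \<le> 2 * V * \<rho> ^ m * (?a + ?c)\<^sup>2"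
    by (simp add: algebra_simps)
  with Suc step show ?case
    unfolding bigs_Suc wsum_union_square[OF finite_blocks(3) finite_blocks(1) bigs_disjoint]
    by (simp add: sum.union_disjoint bigs_disjoint)
qed

text \<open>The small blocks enter through their product with the big blocks, which is split by the inequality between the geometric and the
  arithmetic mean; \<open>\<gamma>\<close> will tend to zero more slowly than the small blocks do.\<close>

lemma variance_full:
  assumes w: "\<And>k. 0 \<le> w k" and m: "1 \<le> m" and \<gamma>: "0 < \<gamma>"
  shows "\<bar>(\<integral>\<omega>. (wsum n w {1..(l + m) * b} \<omega>)\<^sup>2 \<partial>M) - (\<Sum>j<b. \<integral>\<omega>. (wsum n w (big l m j) \<omega>)\<^sup>2 \<partial>M)\<bar>
     \<le> 2 * V * \<rho> ^ m * (\<Sum>k\<in>bigs l m b. w k)\<^sup>2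
       + 2 * V / (1 - \<rho>) * (\<gamma> * (\<Sum>k\<in>bigs l m b. (w k)\<^sup>2) + (1 + 1 / \<gamma>) * (\<Sum>k\<in>smalls l m b. (w k)\<^sup>2))"
proof -
  let ?P = "wsum n w (bigs l m b)" and ?R = "wsum n w (smalls l m b)"
  let ?EP = "\<integral>\<omega>. (?P \<omega>)\<^sup>2 \<partial>M" and ?ER = "\<integral>\<omega>. (?R \<omega>)\<^sup>2 \<partial>M" and ?EPR = "\<integral>\<omega>. ?P \<omega> * ?R \<omega> \<partial>M"
  have pt: "2 * \<bar>x * y\<bar> \<le> \<gamma> * x\<^sup>2 + 1 / \<gamma> * y\<^sup>2" for x y :: real
  proof -
    have "0 \<le> (\<gamma> * \<bar>x\<bar> - \<bar>y\<bar>)\<^sup>2 / \<gamma>" using \<gamma> by simp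
    also have "\<dots> = \<gamma> * x\<^sup>2 + 1 / \<gamma> * y\<^sup>2 - 2 * \<bar>x * y\<bar>"
      using \<gamma> by (simp add: power2_diff abs_mult field_simps power2_eq_square)
    finally show ?thesis by simp
  qed
  have "2 * \<bar>?EPR\<bar> \<le> 2 * (\<integral>\<omega>. \<bar>?P \<omega> * ?R \<omega>\<bar> \<partial>M)"
    by (intro mult_left_mono integral_abs_bound) auto
  also have "\<dots> = (\<integral>\<omega>. 2 * \<bar>?P \<omega> * ?R \<omega>\<bar> \<partial>M)" by simp
  also have "\<dots> \<le> (\<integral>\<omega>. \<gamma> * (?P \<omega>)\<^sup>2 + 1 / \<gamma> * (?R \<omega>)\<^sup>2 \<partial>M)"
    by (rule integral_mono) (use pt in auto)
  also have "\<dots> = \<gamma> * ?EP + 1 / \<gamma> * ?ER" by simp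
  finally have cross: "2 * \<bar>?EPR\<bar> \<le> \<gamma> * ?EP + 1 / \<gamma> * ?ER" .
  have vP: "\<gamma> * ?EP \<le> \<gamma> * (2 * V / (1 - \<rho>) * (\<Sum>k\<in>bigs l m b. (w k)\<^sup>2))"
    using \<gamma> by (intro mult_left_mono wsum_variance_le w) auto
  have vR: "(1 + 1 / \<gamma>) * ?ER \<le> (1 + 1 / \<gamma>) * (2 * V / (1 - \<rho>) * (\<Sum>k\<in>smalls l m b. (w k)\<^sup>2))"
    using \<gamma> by (intro mult_left_mono wsum_variance_le w) auto
  have full: "(\<integral>\<omega>. (wsum n w {1..(l + m) * b} \<omega>)\<^sup>2 \<partial>M) = ?EP + ?ER + 2 * ?EPR"
    unfolding blocks_cover[symmetric] by (rule wsum_union_square) (auto simp: blocks_disjoint)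
  have ER: "0 \<le> ?ER" by simp
  have "\<bar>?EP + ?ER + 2 * ?EPR - (\<Sum>j<b. \<integral>\<omega>. (wsum n w (big l m j) \<omega>)\<^sup>2 \<partial>M)\<bar>
     \<le> 2 * V * \<rho> ^ m * (\<Sum>k\<in>bigs l m b. w k)\<^sup>2 + (\<gamma> * ?EP + (1 + 1 / \<gamma>) * ?ER)"
    using variance_bigs[where w=w and n=n and l=l and b=b, OF w m] cross ER distrib_right[of 1 "1 / \<gamma>" ?ER]
    by linarith
  also have "\<dots> \<le> 2 * V * \<rho> ^ m * (\<Sum>k\<in>bigs l m b. w k)\<^sup>2 +
     (\<gamma> * (2 * V / (1 - \<rho>) * (\<Sum>k\<in>bigs l m b. (w k)\<^sup>2)) + (1 + 1 / \<gamma>) * (2 * V / (1 - \<rho>) * (\<Sum>k\<in>smalls l m b. (w k)\<^sup>2)))"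
    using vP vR by (intro add_mono) auto
  also have "\<dots> = 2 * V * \<rho> ^ m * (\<Sum>k\<in>bigs l m b. w k)\<^sup>2
       + 2 * V / (1 - \<rho>) * (\<gamma> * (\<Sum>k\<in>bigs l m b. (w k)\<^sup>2) + (1 + 1 / \<gamma>) * (\<Sum>k\<in>smalls l m b. (w k)\<^sup>2))"
    by (simp only: distrib_left mult_ac)
  finally show ?thesis unfolding full .
qed

lemma abs_expectation_le_sqrt:
  assumes "integrable M X" "integrable M (\<lambda>\<omega>. (X \<omega>)\<^sup>2)"
  shows "(\<integral>\<omega>. \<bar>X \<omega>\<bar> \<partial>M) \<le> sqrt (\<integral>\<omega>. (X \<omega>)\<^sup>2 \<partial>M)"
proof (rule real_le_rsqrt)
  have "0 \<le> variance (\<lambda>\<omega>. \<bar>X \<omega>\<bar>)" by simp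
  also have "\<dots> = (\<integral>\<omega>. \<bar>X \<omega>\<bar>\<^sup>2 \<partial>M) - (\<integral>\<omega>. \<bar>X \<omega>\<bar> \<partial>M)\<^sup>2"
    using assms by (intro variance_eq) auto
  finally show "(\<integral>\<omega>. \<bar>X \<omega>\<bar> \<partial>M)\<^sup>2 \<le> (\<integral>\<omega>. (X \<omega>)\<^sup>2 \<partial>M)" by simp
qed

text \<open>The four errors are, in this order: dropping the small blocks, decoupling the big blocks, the Gaussian approximation of
  each big block (by the moment inequality of order \<open>p\<close>), and the replacement of the sum of the block variances
  by \<open>v\<close>.\<close>

lemma cf_full:
  fixes x v C :: real and w :: "nat \<Rightarrow> real" and n l m b :: nat
  assumes w: "\<And>k. 0 \<le> w k" and m: "1 \<le> m"
    and C: "0 \<le> C" "\<And>n w I. (\<And>k. 0 \<le> w k) \<Longrightarrow> finite I \<Longrightarrow> integrable M (\<lambda>\<omega>. \<bar>wsum n w I \<omega>\<bar> powr p)"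
      "\<And>n w I. (\<And>k. 0 \<le> w k) \<Longrightarrow> finite I \<Longrightarrow> (\<integral>\<omega>. \<bar>wsum n w I \<omega>\<bar> powr p \<partial>M) \<le> C * (\<Sum>k\<in>I. (w k)\<^sup>2) powr (p / 2)"
    and v: "0 \<le> v"
  defines "D \<equiv> 2 * V / (1 - \<rho>)" and "\<sigma>2 \<equiv> (\<lambda>j. \<integral>\<omega>. (wsum n w (big l m j) \<omega>)\<^sup>2 \<partial>M)"
    and "A \<equiv> (\<lambda>j. \<Sum>k\<in>big l m j. (w k)\<^sup>2)"
  shows "cmod (cf (wsum n w {1..(l + m) * b}) x - exp (- (x\<^sup>2 * v / 2)))
    \<le> \<bar>x\<bar> * sqrt (D * (\<Sum>k\<in>smalls l m b. (w k)\<^sup>2)) + \<bar>x\<bar> * (V * \<rho> ^ m * (\<Sum>k\<in>bigs l m b. w k))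
      + (\<Sum>j<b. C * (x\<^sup>2 * A j) powr (p / 2) + (x\<^sup>2 * (D * A j))\<^sup>2)
      + x\<^sup>2 * \<bar>v - (\<Sum>j<b. \<sigma>2 j)\<bar>"
proof -
  let ?N = "wsum n w {1..(l + m) * b}" and ?P = "wsum n w (bigs l m b)" and ?R = "wsum n w (smalls l m b)"
  let ?g = "\<lambda>j. complex_of_real (exp (- (x\<^sup>2 * \<sigma>2 j / 2)))"
  have D: "0 \<le> D" using V_ge \<rho> by (simp add: D_def)
  have N: "?N \<omega> = ?P \<omega> + ?R \<omega>" for \<omega>
    unfolding blocks_cover[symmetric] by (rule wsum_union) (auto simp: blocks_disjoint)
  have "cmod (cf ?N x - cf ?P x) \<le> \<bar>x\<bar> * (\<integral>\<omega>. \<bar>?N \<omega> - ?P \<omega>\<bar> \<partial>M)"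
    by (rule cf_diff_le) auto
  also have "\<dots> \<le> \<bar>x\<bar> * sqrt (D * (\<Sum>k\<in>smalls l m b. (w k)\<^sup>2))"
  proof (intro mult_left_mono)
    have "(\<integral>\<omega>. \<bar>?N \<omega> - ?P \<omega>\<bar> \<partial>M) = (\<integral>\<omega>. \<bar>?R \<omega>\<bar> \<partial>M)" by (simp only: N add_diff_cancel_left')
    also have "\<dots> \<le> sqrt (\<integral>\<omega>. (?R \<omega>)\<^sup>2 \<partial>M)" by (rule abs_expectation_le_sqrt) auto
    also have "\<dots> \<le> sqrt (D * (\<Sum>k\<in>smalls l m b. (w k)\<^sup>2))"
      unfolding D_def by (intro real_sqrt_le_mono wsum_variance_le w) auto
    finally show "(\<integral>\<omega>. \<bar>?N \<omega> - ?P \<omega>\<bar> \<partial>M) \<le> sqrt (D * (\<Sum>k\<in>smalls l m b. (w k)\<^sup>2))" .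
  qed simp
  finally have 1: "cmod (cf ?N x - cf ?P x) \<le> \<bar>x\<bar> * sqrt (D * (\<Sum>k\<in>smalls l m b. (w k)\<^sup>2))" .
  have 2: "cmod (cf ?P x - (\<Prod>j<b. cf (wsum n w (big l m j)) x)) \<le> \<bar>x\<bar> * (V * \<rho> ^ m * (\<Sum>k\<in>bigs l m b. w k))"
    by (rule cf_bigs[OF w m])
  have \<sigma>2: "0 \<le> \<sigma>2 j" "\<sigma>2 j \<le> D * A j" for j
    unfolding \<sigma>2_def D_def A_def by (simp, intro wsum_variance_le w) auto
  have "cmod ((\<Prod>j<b. cf (wsum n w (big l m j)) x) - (\<Prod>j<b. ?g j)) \<le> (\<Sum>j<b. cmod (cf (wsum n w (big l m j)) x - ?g j))"
    using \<sigma>2(1) by (intro norm_prod_diff norm_cf_le_1) auto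
  also have "\<dots> \<le> (\<Sum>j<b. C * (x\<^sup>2 * A j) powr (p / 2) + (x\<^sup>2 * (D * A j))\<^sup>2)"
  proof (rule sum_mono)
    fix j
    let ?S = "wsum n w (big l m j)"
    have "cmod (cf ?S x - ?g j) \<le> \<bar>x\<bar> powr p * (\<integral>\<omega>. \<bar>?S \<omega>\<bar> powr p \<partial>M) + (x\<^sup>2 * \<sigma>2 j / 2)\<^sup>2"
      unfolding \<sigma>2_def using p C(2)[OF w] by (intro cf_gaussian_approx) auto
    also have "\<dots> \<le> \<bar>x\<bar> powr p * (C * A j powr (p / 2)) + (x\<^sup>2 * (D * A j))\<^sup>2"
    proof (intro add_mono mult_left_mono power_mono)
      show "(\<integral>\<omega>. \<bar>?S \<omega>\<bar> powr p \<partial>M) \<le> C * A j powr (p / 2)"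
        unfolding A_def by (intro C(3) w) auto
      show "x\<^sup>2 * \<sigma>2 j / 2 \<le> x\<^sup>2 * (D * A j)"
      proof -
        have "x\<^sup>2 * \<sigma>2 j \<le> x\<^sup>2 * (D * A j)" "0 \<le> x\<^sup>2 * \<sigma>2 j"
          using \<sigma>2[of j] by (auto intro!: mult_left_mono)
        then show ?thesis by linarith
      qed
    qed (use \<sigma>2 in auto)
    also have "\<bar>x\<bar> powr p = (x\<^sup>2) powr (p / 2)"
    proof -
      have "(x\<^sup>2) powr (p / 2) = (\<bar>x\<bar> powr 2) powr (p / 2)" by (cases "x = 0") auto
      then show ?thesis unfolding powr_powr by simp
    qed
    also have "(x\<^sup>2) powr (p / 2) * (C * A j powr (p / 2)) = C * (x\<^sup>2 * A j) powr (p / 2)"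
      unfolding powr_mult by simp
    finally show "cmod (cf ?S x - ?g j) \<le> C * (x\<^sup>2 * A j) powr (p / 2) + (x\<^sup>2 * (D * A j))\<^sup>2" .
  qed
  finally have 3: "cmod ((\<Prod>j<b. cf (wsum n w (big l m j)) x) - (\<Prod>j<b. ?g j))
      \<le> (\<Sum>j<b. C * (x\<^sup>2 * A j) powr (p / 2) + (x\<^sup>2 * (D * A j))\<^sup>2)" .
  have prod: "(\<Prod>j<b. ?g j) = complex_of_real (exp (- (x\<^sup>2 * (\<Sum>j<b. \<sigma>2 j) / 2)))"
    unfolding of_real_prod[symmetric] exp_sum[OF finite_lessThan, symmetric]
    by (simp add: sum_negf sum_distrib_left sum_divide_distrib)
  have "cmod ((\<Prod>j<b. ?g j) - exp (- (x\<^sup>2 * v / 2))) = \<bar>exp (- (x\<^sup>2 * (\<Sum>j<b. \<sigma>2 j) / 2)) - exp (- (x\<^sup>2 * v / 2))\<bar>"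
    unfolding prod by (simp only: of_real_diff[symmetric] norm_of_real)
  also have "\<dots> \<le> \<bar>x\<^sup>2 * (\<Sum>j<b. \<sigma>2 j) / 2 - x\<^sup>2 * v / 2\<bar>"
    using \<sigma>2(1) v by (intro abs_exp_minus_diff_le) (auto intro!: sum_nonneg mult_nonneg_nonneg)
  also have "\<dots> = x\<^sup>2 * \<bar>v - (\<Sum>j<b. \<sigma>2 j)\<bar> / 2"
  proof -
    have "x\<^sup>2 * (\<Sum>j<b. \<sigma>2 j) / 2 - x\<^sup>2 * v / 2 = x\<^sup>2 / 2 * ((\<Sum>j<b. \<sigma>2 j) - v)"
      by (simp add: algebra_simps)
    then show ?thesis unfolding abs_minus_commute[of v] by (simp only: abs_mult) simp
  qed
  also have "\<dots> \<le> x\<^sup>2 * \<bar>v - (\<Sum>j<b. \<sigma>2 j)\<bar>" by simp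
  finally have 4: "cmod ((\<Prod>j<b. ?g j) - exp (- (x\<^sup>2 * v / 2))) \<le> x\<^sup>2 * \<bar>v - (\<Sum>j<b. \<sigma>2 j)\<bar>" .
  show ?thesis
    using norm_triangle_le[OF add_mono[OF norm_triangle_le[OF add_mono[OF norm_triangle_le[OF add_mono[OF 1 2]] 3]] 4]]
    by simp
qed

end

section \<open>The central limit theorem for coupled arrays\<close>

lemma power_beats_square:
  fixes \<rho> :: real and m :: "nat \<Rightarrow> nat"
  assumes \<rho>: "0 < \<rho>" "\<rho> < 1" and m: "filterlim (\<lambda>n. real (m n) / ln (real n)) at_top sequentially"
  shows "(\<lambda>n. (real n)\<^sup>2 * \<rho> ^ m n) \<longlonglongrightarrow> 0"
proof (rule tendsto_sandwich[where f="\<lambda>_. 0"])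
  \<comment> \<open>Once \<open>m n \<ge> \<kappa> * ln n\<close>, the power \<open>\<rho> ^ m n\<close> is at most \<open>n\<close> to the power \<open>-3\<close>.\<close>
  define \<kappa> where "\<kappa> = 3 / (- ln \<rho>)"
  have ln: "ln \<rho> < 0" using \<rho> by simp
  show "\<forall>\<^sub>F n in sequentially. (real n)\<^sup>2 * \<rho> ^ m n \<le> 1 / real n"
    using eventually_ge_at_top[of "3::nat"] filterlim_at_top[THEN iffD1, OF m, rule_format, of \<kappa>]
  proof eventually_elim
    case (elim n)
    have n: "0 < ln (real n)" "0 < real n" using elim by auto
    have "\<kappa> * ln (real n) \<le> real (m n)" using elim n by (simp add: field_simps)
    then have "real (m n) * ln \<rho> \<le> \<kappa> * ln (real n) * ln \<rho>" using ln by (simp add: mult_right_mono_neg)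
    also have "\<dots> = - 3 * ln (real n)" using ln by (simp add: \<kappa>_def)
    finally have "exp (real (m n) * ln \<rho>) \<le> exp (- 3 * ln (real n))" by simp
    also have "exp (real (m n) * ln \<rho>) = \<rho> ^ m n" using \<rho> by (simp add: exp_of_nat_mult)
    also have "exp (- 3 * ln (real n)) = 1 / (real n) ^ 3"
      using n by (simp add: exp_minus exp_of_nat_mult[of 3, simplified] field_simps)
    finally have "(real n)\<^sup>2 * \<rho> ^ m n \<le> (real n)\<^sup>2 * (1 / (real n) ^ 3)"
      by (intro mult_left_mono) auto
    also have "\<dots> = 1 / real n" using n by (simp add: field_simps power2_eq_square power3_eq_cube)
    finally show ?case .
  qed
  show "(\<lambda>n. 1 / real n) \<longlonglongrightarrow> 0" by (rule lim_1_over_n)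
qed (use \<rho> in auto)

context coupled_array
begin

text \<open>Since the variance is at least a constant multiple of the sum \<open>Wt n\<close> of the squared weights, all four errors of the
  previous section become small: the share \<open>\<alpha> n\<close> of the small blocks vanishes, the gaps are long
  enough for \<open>n\<^sup>2 * \<rho> ^ m n\<close> to vanish, and the Lyapunov sum is at most a constant times the largest share \<open>\<beta> n\<close> of a big block to
  the positive power \<open>p / 2 - 1\<close>.\<close>

theorem block_clt:
  fixes w :: "nat \<Rightarrow> nat \<Rightarrow> real" and l m b :: "nat \<Rightarrow> nat" and \<alpha> \<beta> :: "nat \<Rightarrow> real" and c :: real
  defines "Wt \<equiv> (\<lambda>n. \<Sum>k=1..n. (w n k)\<^sup>2)"
    and "v \<equiv> (\<lambda>n. \<integral>\<omega>. (wsum n (w n) {1..n} \<omega>)\<^sup>2 \<partial>M)"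
  assumes w: "\<And>n k. 0 \<le> w n k" and supp: "\<And>n k. k \<notin> {1..n} \<Longrightarrow> w n k = 0"
    and cover: "\<forall>\<^sub>F n in sequentially. n \<le> (l n + m n) * b n"
    and m_pos: "\<forall>\<^sub>F n in sequentially. 1 \<le> m n"
    and m_log: "filterlim (\<lambda>n. real (m n) / ln (real n)) at_top sequentially"
    and \<alpha>: "\<alpha> \<longlonglongrightarrow> 0" "\<And>n. 0 \<le> \<alpha> n"
      "\<forall>\<^sub>F n in sequentially. (\<Sum>k\<in>smalls (l n) (m n) (b n). (w n k)\<^sup>2) \<le> \<alpha> n * Wt n"
    and \<beta>: "\<beta> \<longlonglongrightarrow> 0" "\<And>n. 0 \<le> \<beta> n"
      "\<forall>\<^sub>F n in sequentially. \<forall>j<b n. (\<Sum>k\<in>big (l n) (m n) j. (w n k)\<^sup>2) \<le> \<beta> n * Wt n"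
    and c: "0 < c" "\<forall>\<^sub>F n in sequentially. 0 < Wt n \<and> c * Wt n \<le> v n"
  shows "weak_conv_m (\<lambda>n. distr M borel (\<lambda>\<omega>. wsum n (w n) {1..n} \<omega> / sqrt (v n))) std_normal_distribution"
proof (rule levy_continuity)
  show "real_distribution (distr M borel (\<lambda>\<omega>. wsum n (w n) {1..n} \<omega> / sqrt (v n)))" for n
    by (rule real_distribution_distr) measurable
  show "real_distribution std_normal_distribution" by (rule real_dist_normal_dist)
  fix t :: real
  obtain C where C: "0 \<le> C" "\<And>n w I. (\<And>k. 0 \<le> w k) \<Longrightarrow> finite I \<Longrightarrow> integrable M (\<lambda>\<omega>. \<bar>wsum n w I \<omega>\<bar> powr p)"
      "\<And>n w I. (\<And>k. 0 \<le> w k) \<Longrightarrow> finite I \<Longrightarrow> (\<integral>\<omega>. \<bar>wsum n w I \<omega>\<bar> powr p \<partial>M) \<le> C * (\<Sum>k\<in>I. (w k)\<^sup>2) powr (p / 2)"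
    using wsum_moment by blast
  define D where "D = 2 * V / (1 - \<rho>)"
  have D: "0 \<le> D" using V_ge \<rho> by (simp add: D_def)
  define \<tau> where "\<tau> = t\<^sup>2 / c"
  have \<tau>: "0 \<le> \<tau>" using c by (simp add: \<tau>_def)
  \<comment> \<open>Positive even if \<open>\<alpha> n = 0\<close>, and large enough for \<open>\<alpha> n / \<gamma> n\<close> to vanish as well.\<close>
  define \<gamma> where "\<gamma> n = sqrt (\<alpha> n) + 1 / real n" for n
  define err where "err n = sqrt (\<tau> * D * \<alpha> n) + sqrt \<tau> * V * ((real n)\<^sup>2 * \<rho> ^ m n)
     + (C * (\<tau> * \<beta> n) powr (p / 2 - 1) + D\<^sup>2 * (\<tau> * \<beta> n)) * \<tau>
     + \<tau> * (2 * V * ((real n)\<^sup>2 * \<rho> ^ m n) + D * (\<gamma> n + (\<alpha> n + sqrt (\<alpha> n))))" for n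
  have r: "(\<lambda>n. (real n)\<^sup>2 * \<rho> ^ m n) \<longlonglongrightarrow> 0"
    by (rule power_beats_square[OF \<rho> m_log])
  have sq: "(\<lambda>n. sqrt (\<alpha> n)) \<longlonglongrightarrow> 0"
    using tendsto_real_sqrt[OF \<alpha>(1)] by simp
  have \<gamma>0: "\<gamma> \<longlonglongrightarrow> 0"
    unfolding \<gamma>_def[abs_def] using tendsto_add[OF sq lim_1_over_n] by simp
  have pw: "(\<lambda>n. (\<tau> * \<beta> n) powr (p / 2 - 1)) \<longlonglongrightarrow> 0"
  proof -
    have "(\<lambda>n. \<tau> * \<beta> n) \<longlonglongrightarrow> 0" using tendsto_mult_right_zero[OF \<beta>(1)] by simp
    then show ?thesis
      using p \<tau> \<beta>(2) by (intro tendsto_zero_powrI[where b="p / 2 - 1"]) auto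
  qed
  have "err \<longlonglongrightarrow> sqrt (\<tau> * D * 0) + sqrt \<tau> * V * 0 + (C * 0 + D\<^sup>2 * (\<tau> * 0)) * \<tau>
      + \<tau> * (2 * V * 0 + D * (0 + (0 + 0)))"
    unfolding err_def[abs_def] by (intro tendsto_intros \<alpha> \<beta> r sq \<gamma>0 pw)
  then have err: "err \<longlonglongrightarrow> 0" by simp
  have bound: "\<forall>\<^sub>F n in sequentially.
      norm (char (distr M borel (\<lambda>\<omega>. wsum n (w n) {1..n} \<omega> / sqrt (v n))) t - char std_normal_distribution t) \<le> err n"
    using cover m_pos \<alpha>(3) \<beta>(3) c(2) eventually_ge_at_top[of "1::nat"]
  proof eventually_elim
    case (elim n)
    define x where "x = t / sqrt (v n)"
    let ?P = "bigs (l n) (m n) (b n)" and ?R = "smalls (l n) (m n) (b n)"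
    let ?A = "\<lambda>j. \<Sum>k\<in>big (l n) (m n) j. (w n k)\<^sup>2"
    let ?full = "{1..(l n + m n) * b n}"
    have W: "0 < Wt n" and cv: "c * Wt n \<le> v n" and n: "1 \<le> n" using elim by auto
    have v: "0 < v n" using W cv c(1) by (meson less_le_trans mult_pos_pos)
    have x2: "x\<^sup>2 \<le> \<tau> / Wt n"
    proof -
      have "x\<^sup>2 = t\<^sup>2 / v n" using v by (simp add: x_def power_divide)
      also have "\<dots> \<le> t\<^sup>2 / (c * Wt n)" using cv c W v by (intro divide_left_mono mult_pos_pos) auto
      finally show ?thesis by (simp add: \<tau>_def)
    qed
    have absx: "\<bar>x\<bar> \<le> sqrt \<tau> / sqrt (Wt n)"
      using real_sqrt_le_mono[OF x2] by (simp add: real_sqrt_divide)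
    have x2v: "x\<^sup>2 * v n / 2 = t\<^sup>2 / 2" using v by (simp add: x_def power_divide)
    have full_n: "wsum n (w n) ?full \<omega> = wsum n (w n) {1..n} \<omega>" for \<omega>
      unfolding wsum_def using elim supp[of _ n] by (intro sum.mono_neutral_right) auto
    have ch: "char (distr M borel (\<lambda>\<omega>. wsum n (w n) {1..n} \<omega> / sqrt (v n))) t = cf (wsum n (w n) ?full) x"
    proof -
      have "char (distr M borel (\<lambda>\<omega>. wsum n (w n) {1..n} \<omega> / sqrt (v n))) t
          = cf (\<lambda>\<omega>. wsum n (w n) {1..n} \<omega> / sqrt (v n)) t" by (simp add: cf_def)
      also have "\<dots> = (CLINT \<omega>|M. iexp (t * (wsum n (w n) {1..n} \<omega> / sqrt (v n))))"
        by (rule cf_eq) measurable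
      also have "\<dots> = (CLINT \<omega>|M. iexp (x * wsum n (w n) ?full \<omega>))"
        unfolding full_n by (intro Bochner_Integration.integral_cong) (simp_all add: x_def)
      also have "\<dots> = cf (wsum n (w n) ?full) x" by (rule cf_eq[symmetric]) measurable
      finally show ?thesis .
    qed
    have W_sub: "(\<Sum>k\<in>?P. (w n k)\<^sup>2) \<le> Wt n"
    proof -
      have "(\<Sum>k\<in>?P. (w n k)\<^sup>2) = (\<Sum>k\<in>?P \<inter> {1..n}. (w n k)\<^sup>2)"
        using supp[of _ n] by (intro sum.mono_neutral_right) auto
      also have "\<dots> \<le> Wt n" unfolding Wt_def by (intro sum_mono2) auto
      finally show ?thesis .
    qed
    have s1: "0 \<le> (\<Sum>k\<in>?P. w n k)" "(\<Sum>k\<in>?P. w n k) \<le> real n * sqrt (Wt n)"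
    proof -
      show "0 \<le> (\<Sum>k\<in>?P. w n k)" using w by (intro sum_nonneg) auto
      have "(\<Sum>k\<in>?P. w n k) = (\<Sum>k\<in>?P \<inter> {1..n}. w n k)"
        using supp[of _ n] by (intro sum.mono_neutral_right) auto
      also have "\<dots> \<le> (\<Sum>k\<in>{1..n}. w n k)" using w by (intro sum_mono2) auto
      also have "\<dots> \<le> (\<Sum>k\<in>{1..n}. sqrt (Wt n))"
      proof (rule sum_mono)
        fix k assume "k \<in> {1..n}"
        then have "(w n k)\<^sup>2 \<le> Wt n" unfolding Wt_def by (intro member_le_sum) auto
        then show "w n k \<le> sqrt (Wt n)" by (rule real_le_rsqrt)
      qed
      finally show "(\<Sum>k\<in>?P. w n k) \<le> real n * sqrt (Wt n)" by simp
    qed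
    have \<gamma>n: "0 < \<gamma> n" "sqrt (\<alpha> n) \<le> \<gamma> n" using n \<alpha>(2)[of n] by (auto simp: \<gamma>_def add_nonneg_pos)
    have rn: "0 \<le> \<rho> ^ m n" "real n * \<rho> ^ m n \<le> (real n)\<^sup>2 * \<rho> ^ m n"
      using n \<rho> by (auto simp: power2_eq_square intro!: mult_right_mono)
    have T1: "\<bar>x\<bar> * sqrt (D * (\<Sum>k\<in>?R. (w n k)\<^sup>2)) \<le> sqrt (\<tau> * D * \<alpha> n)"
    proof -
      have "\<bar>x\<bar> * sqrt (D * (\<Sum>k\<in>?R. (w n k)\<^sup>2)) \<le> (sqrt \<tau> / sqrt (Wt n)) * sqrt (D * (\<alpha> n * Wt n))"
        using absx elim D \<tau> W by (intro mult_mono real_sqrt_le_mono mult_left_mono) (auto intro!: sum_nonneg mult_nonneg_nonneg)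
      also have "\<dots> = sqrt (\<tau> * D * \<alpha> n)" using W by (simp add: real_sqrt_mult)
      finally show ?thesis .
    qed
    have T2: "\<bar>x\<bar> * (V * \<rho> ^ m n * (\<Sum>k\<in>?P. w n k)) \<le> sqrt \<tau> * V * ((real n)\<^sup>2 * \<rho> ^ m n)"
    proof -
      have "\<bar>x\<bar> * (V * \<rho> ^ m n * (\<Sum>k\<in>?P. w n k)) \<le> (sqrt \<tau> / sqrt (Wt n)) * (V * \<rho> ^ m n * (real n * sqrt (Wt n)))"
        using absx s1 V_ge rn \<tau> W by (intro mult_mono mult_left_mono mult_nonneg_nonneg) auto
      also have "\<dots> = sqrt \<tau> * V * (real n * \<rho> ^ m n)" using W by (simp add: field_simps)
      also have "\<dots> \<le> sqrt \<tau> * V * ((real n)\<^sup>2 * \<rho> ^ m n)"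
        using rn V_ge \<tau> by (intro mult_left_mono) auto
      finally show ?thesis .
    qed
    have T3: "(\<Sum>j<b n. C * (x\<^sup>2 * ?A j) powr (p / 2) + (x\<^sup>2 * (D * ?A j))\<^sup>2)
        \<le> (C * (\<tau> * \<beta> n) powr (p / 2 - 1) + D\<^sup>2 * (\<tau> * \<beta> n)) * \<tau>"
    proof -
      let ?F = "C * (\<tau> * \<beta> n) powr (p / 2 - 1) + D\<^sup>2 * (\<tau> * \<beta> n)"
      have F: "0 \<le> ?F" using C(1) \<tau> \<beta>(2)[of n] by auto
      have "C * (x\<^sup>2 * ?A j) powr (p / 2) + (x\<^sup>2 * (D * ?A j))\<^sup>2 \<le> ?F * (\<tau> / Wt n * ?A j)" if j: "j < b n" for j
      proof -
        define y where "y = \<tau> / Wt n * ?A j"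
        have A: "0 \<le> ?A j" by (intro sum_nonneg) auto
        have xy: "x\<^sup>2 * ?A j \<le> y" unfolding y_def using x2 A by (rule mult_right_mono)
        have y: "0 \<le> y" using \<tau> W A by (simp add: y_def)
        have y\<beta>: "y \<le> \<tau> * \<beta> n"
        proof -
          have "y \<le> \<tau> / Wt n * (\<beta> n * Wt n)"
            unfolding y_def using elim j \<tau> W by (intro mult_left_mono) auto
          then show ?thesis using W by simp
        qed
        have "(x\<^sup>2 * ?A j) powr (p / 2) \<le> y powr (p / 2)"
          using xy A p by (intro powr_mono2) auto
        also have "\<dots> = y powr (p / 2 - 1) * y"
        proof (cases "y = 0")
          case False
          then show ?thesis using y powr_add[of y "p / 2 - 1" 1] by simp
        qed simp
        also have "\<dots> \<le> (\<tau> * \<beta> n) powr (p / 2 - 1) * y"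
          using y y\<beta> p by (intro mult_right_mono powr_mono2) auto
        finally have 1: "C * (x\<^sup>2 * ?A j) powr (p / 2) \<le> C * ((\<tau> * \<beta> n) powr (p / 2 - 1) * y)"
          using C(1) by (rule mult_left_mono)
        have "(x\<^sup>2 * (D * ?A j))\<^sup>2 = D\<^sup>2 * ((x\<^sup>2 * ?A j) * (x\<^sup>2 * ?A j))"
          by (simp add: power2_eq_square mult_ac)
        also have "\<dots> \<le> D\<^sup>2 * ((\<tau> * \<beta> n) * y)"
          using y y\<beta> A by (intro mult_left_mono mult_mono[OF order_trans[OF xy y\<beta>] xy]) auto
        finally show ?thesis using 1 by (simp add: y_def algebra_simps)
      qed
      then have "(\<Sum>j<b n. C * (x\<^sup>2 * ?A j) powr (p / 2) + (x\<^sup>2 * (D * ?A j))\<^sup>2) \<le> (\<Sum>j<b n. ?F * (\<tau> / Wt n * ?A j))"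
        by (intro sum_mono) auto
      also have "\<dots> = ?F * (\<tau> / Wt n * (\<Sum>k\<in>?P. (w n k)\<^sup>2))"
        by (simp only: sum_bigs sum_distrib_left)
      also have "\<dots> \<le> ?F * (\<tau> / Wt n * Wt n)"
        using F \<tau> W W_sub by (intro mult_left_mono) auto
      finally show ?thesis using W by simp
    qed
    have T4: "x\<^sup>2 * \<bar>v n - (\<Sum>j<b n. \<integral>\<omega>. (wsum n (w n) (big (l n) (m n) j) \<omega>)\<^sup>2 \<partial>M)\<bar>
        \<le> \<tau> * (2 * V * ((real n)\<^sup>2 * \<rho> ^ m n) + D * (\<gamma> n + (\<alpha> n + sqrt (\<alpha> n))))"
    proof -
      have v_eq: "v n = (\<integral>\<omega>. (wsum n (w n) ?full \<omega>)\<^sup>2 \<partial>M)" unfolding v_def full_n ..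
      have ag: "(1 + 1 / \<gamma> n) * \<alpha> n \<le> \<alpha> n + sqrt (\<alpha> n)"
      proof -
        have "\<alpha> n = sqrt (\<alpha> n) * sqrt (\<alpha> n)" using \<alpha>(2)[of n] by simp
        also have "\<dots> \<le> sqrt (\<alpha> n) * \<gamma> n" using \<gamma>n \<alpha>(2)[of n] by (intro mult_left_mono) auto
        finally have "\<alpha> n / \<gamma> n \<le> sqrt (\<alpha> n)" using \<gamma>n by (simp add: field_simps)
        then show ?thesis by (simp add: distrib_right)
      qed
      have "\<bar>v n - (\<Sum>j<b n. \<integral>\<omega>. (wsum n (w n) (big (l n) (m n) j) \<omega>)\<^sup>2 \<partial>M)\<bar>
        \<le> 2 * V * \<rho> ^ m n * (\<Sum>k\<in>?P. w n k)\<^sup>2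
          + D * (\<gamma> n * (\<Sum>k\<in>?P. (w n k)\<^sup>2) + (1 + 1 / \<gamma> n) * (\<Sum>k\<in>?R. (w n k)\<^sup>2))"
        unfolding v_eq D_def using w elim(2) \<gamma>n(1) by (rule variance_full)
      also have "\<dots> \<le> 2 * V * \<rho> ^ m n * (real n * sqrt (Wt n))\<^sup>2
          + D * (\<gamma> n * Wt n + (1 + 1 / \<gamma> n) * (\<alpha> n * Wt n))"
        using s1 V_ge rn D \<gamma>n W_sub elim(3)
        by (intro add_mono mult_left_mono power_mono) auto
      also have "\<dots> = Wt n * (2 * V * ((real n)\<^sup>2 * \<rho> ^ m n) + D * (\<gamma> n + (1 + 1 / \<gamma> n) * \<alpha> n))"
        using W by (simp add: power_mult_distrib algebra_simps)
      also have "\<dots> \<le> Wt n * (2 * V * ((real n)\<^sup>2 * \<rho> ^ m n) + D * (\<gamma> n + (\<alpha> n + sqrt (\<alpha> n))))"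
        using W D ag by (intro mult_left_mono add_left_mono) auto
      finally have "x\<^sup>2 * \<bar>v n - (\<Sum>j<b n. \<integral>\<omega>. (wsum n (w n) (big (l n) (m n) j) \<omega>)\<^sup>2 \<partial>M)\<bar>
        \<le> \<tau> / Wt n * (Wt n * (2 * V * ((real n)\<^sup>2 * \<rho> ^ m n) + D * (\<gamma> n + (\<alpha> n + sqrt (\<alpha> n)))))"
        using x2 \<tau> W by (intro mult_mono) auto
      then show ?thesis using W by simp
    qed
    have "norm (cf (wsum n (w n) ?full) x - exp (- (x\<^sup>2 * v n / 2)))
        \<le> \<bar>x\<bar> * sqrt (D * (\<Sum>k\<in>?R. (w n k)\<^sup>2)) + \<bar>x\<bar> * (V * \<rho> ^ m n * (\<Sum>k\<in>?P. w n k))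
          + (\<Sum>j<b n. C * (x\<^sup>2 * ?A j) powr (p / 2) + (x\<^sup>2 * (D * ?A j))\<^sup>2)
          + x\<^sup>2 * \<bar>v n - (\<Sum>j<b n. \<integral>\<omega>. (wsum n (w n) (big (l n) (m n) j) \<omega>)\<^sup>2 \<partial>M)\<bar>"
      unfolding D_def by (rule cf_full[OF w _ C]) (use elim v in auto)
    also have "\<dots> \<le> err n"
      unfolding err_def by (intro add_mono T1 T2 T3 T4)
    finally show ?case
      unfolding ch char_std_normal_distribution x2v by simp
  qed
  have "(\<lambda>n. char (distr M borel (\<lambda>\<omega>. wsum n (w n) {1..n} \<omega> / sqrt (v n))) t - char std_normal_distribution t) \<longlonglongrightarrow> 0"
    by (rule Lim_null_comparison[OF bound err])
  then show "(\<lambda>n. char (distr M borel (\<lambda>\<omega>. wsum n (w n) {1..n} \<omega> / sqrt (v n))) t) \<longlonglongrightarrow> char std_normal_distribution t"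
    by (rule LIM_zero_cancel)
qed

end

section \<open>Kernels in the Wiener ring\<close>

lemma integrable_of_nn_integral_le:
  fixes f :: "'a \<Rightarrow> real"
  assumes [measurable]: "f \<in> borel_measurable M" and f: "\<And>x. 0 \<le> f x"
    and le: "(\<integral>\<^sup>+x. ennreal (f x) \<partial>M) \<le> ennreal c" and c: "0 \<le> c"
  shows "integrable M f" "(\<integral>x. f x \<partial>M) \<le> c"
proof -
  show i: "integrable M f"
    using f le by (intro integrableI_nonneg) (auto intro: le_less_trans)
  have "ennreal (\<integral>x. f x \<partial>M) = (\<integral>\<^sup>+x. ennreal (f x) \<partial>M)"
    using i f by (intro nn_integral_eq_integral[symmetric]) auto
  with le have "ennreal (\<integral>x. f x \<partial>M) \<le> ennreal c" by (simp only:)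
  then show "(\<integral>x. f x \<partial>M) \<le> c" using c by simp
qed

lemma nn_integral_powr_le_of_Lp_norm_le:
  assumes p: "0 < p" and S: "0 \<le> S" and le: "Lp_norm M p Y \<le> ennreal S"
  shows "(\<integral>\<^sup>+\<omega>. ennreal (\<bar>Y \<omega>\<bar> powr p) \<partial>M) \<le> ennreal (S powr p)"
proof -
  define I where "I = (\<integral>\<^sup>+\<omega>. ennreal (\<bar>Y \<omega>\<bar> powr p) \<partial>M)"
  have fin: "I \<noteq> \<infinity>"
    using le by (auto simp: Lp_norm_def I_def[symmetric] Let_def top_unique)
  then have "ennreal (enn2real I powr (1 / p)) \<le> ennreal S"
    using le by (simp add: Lp_norm_def I_def[symmetric] Let_def)
  then have "enn2real I powr (1 / p) \<le> S" using S by simp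
  then have "(enn2real I powr (1 / p)) powr p \<le> S powr p"
    using p by (intro powr_mono2) auto
  then have "enn2real I \<le> S powr p" using p by (simp add: powr_powr)
  then show ?thesis
    using fin unfolding I_def[symmetric] by (cases I) auto
qed

text \<open>Bounding \<open>\<bar>exp (iu) - exp (iv)\<bar>\<close> by \<open>2 * min 1 \<bar>u - v\<bar>\<close>, and thus by
  \<open>2 * \<bar>u - v\<bar> powr \<eta>\<close>, under the Fourier integral makes the kernel bounded and Hoelder continuous in the first
  argument, uniformly in the second.\<close>

lemma wiener_ring_bounded_hoelder:
  assumes f: "f \<in> wiener_ring \<eta>" and \<eta>: "0 < \<eta>" "\<eta> \<le> 1"
  obtains A where "0 \<le> A" "\<And>x y. \<bar>f x y\<bar> \<le> A" "\<And>x x' y. \<bar>f x y - f x' y\<bar> \<le> A * \<bar>x - x'\<bar> powr \<eta>"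
proof -
  obtain g :: "real \<times> real \<Rightarrow> complex" where g: "integrable lborel g"
    and rep: "\<And>x y. complex_of_real (f x y) = (LINT z|lborel. g z * exp (\<i> * complex_of_real (fst z * x + snd z * y)))"
    and gn: "integrable lborel (\<lambda>z. norm z powr \<eta> * norm (g z))"
    using f unfolding wiener_ring_def by blast
  let ?e = "\<lambda>x y z. iexp (fst z * x + snd z * y)"
  have [measurable]: "g \<in> borel_measurable borel" using borel_measurable_integrable[OF g] by simp
  have e_meas [measurable]: "(\<lambda>z. ?e x y z) \<in> borel_measurable borel" for x y
    by (intro borel_measurable_continuous_onI continuous_intros)
  have ge: "integrable lborel (\<lambda>z. g z * ?e x y z)" for x y
  proof -
    have "(\<lambda>z. g z * ?e x y z) \<in> borel_measurable lborel" by measurable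
    then show ?thesis by (rule Bochner_Integration.integrable_bound[OF g]) (auto simp: norm_mult)
  qed
  define A1 where "A1 = (LINT z|lborel. norm (g z))"
  define A2 where "A2 = 2 * (LINT z|lborel. norm z powr \<eta> * norm (g z))"
  have A: "0 \<le> A1" "0 \<le> A2" by (auto simp: A1_def A2_def)
  have 1: "\<bar>f x y\<bar> \<le> A1" for x y
  proof -
    have "\<bar>f x y\<bar> = cmod (LINT z|lborel. g z * ?e x y z)"
      unfolding rep[symmetric] by simp
    also have "\<dots> \<le> (LINT z|lborel. norm (g z * ?e x y z))" by (rule integral_norm_bound)
    also have "\<dots> = A1" by (simp add: A1_def norm_mult)
    finally show ?thesis .
  qed
  have 2: "\<bar>f x y - f x' y\<bar> \<le> A2 * \<bar>x - x'\<bar> powr \<eta>" for x x' y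
  proof -
    have i: "integrable lborel (\<lambda>z. g z * ?e x y z - g z * ?e x' y z)"
      using ge by (intro Bochner_Integration.integrable_diff)
    have pw: "norm (g z * ?e x y z - g z * ?e x' y z) \<le> 2 * \<bar>x - x'\<bar> powr \<eta> * (norm z powr \<eta> * norm (g z))" for z
    proof -
      define u where "u = \<bar>fst z * x - fst z * x'\<bar>"
      have u0: "0 \<le> u" by (simp add: u_def)
      have "cmod (?e x y z - ?e x' y z) \<le> u"
        using norm_iexp_diff_le[of "fst z * x + snd z * y" "fst z * x' + snd z * y"] by (simp add: u_def)
      moreover have "cmod (?e x y z - ?e x' y z) \<le> 2"
        using norm_triangle_ineq4[of "?e x y z" "?e x' y z"] by simp
      ultimately have "cmod (?e x y z - ?e x' y z) \<le> 2 * min 1 u"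
        using u0 by linarith
      also have "min 1 u \<le> u powr \<eta>"
      proof (cases "u \<le> 1")
        case True
        then show ?thesis using powr_mono'[of \<eta> 1 u] \<eta> u0 by (cases "u = 0") auto
      next
        case False
        then show ?thesis using \<eta> by (simp add: ge_one_powr_ge_zero)
      qed
      also have "u powr \<eta> \<le> (norm z * \<bar>x - x'\<bar>) powr \<eta>"
      proof (intro powr_mono2)
        have "u = \<bar>fst z\<bar> * \<bar>x - x'\<bar>"
          by (simp add: u_def abs_mult[symmetric] right_diff_distrib)
        also have "\<dots> \<le> norm z * \<bar>x - x'\<bar>"
          using norm_fst_le[of "fst z" "snd z"] by (intro mult_right_mono) auto
        finally show "u \<le> norm z * \<bar>x - x'\<bar>" .
      qed (use \<eta> u0 in auto)
      also have "(norm z * \<bar>x - x'\<bar>) powr \<eta> = norm z powr \<eta> * \<bar>x - x'\<bar> powr \<eta>" by (rule powr_mult)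
      finally have "norm (g z) * cmod (?e x y z - ?e x' y z) \<le> norm (g z) * (2 * (norm z powr \<eta> * \<bar>x - x'\<bar> powr \<eta>))"
        by (intro mult_left_mono) auto
      then show ?thesis by (simp add: norm_mult right_diff_distrib[symmetric] mult_ac)
    qed
    have "\<bar>f x y - f x' y\<bar> = cmod (complex_of_real (f x y) - complex_of_real (f x' y))"
      by (simp only: of_real_diff[symmetric] norm_of_real)
    also have "\<dots> = cmod (LINT z|lborel. g z * ?e x y z - g z * ?e x' y z)"
      unfolding rep using ge by (subst Bochner_Integration.integral_diff) auto
    also have "\<dots> \<le> (LINT z|lborel. norm (g z * ?e x y z - g z * ?e x' y z))" by (rule integral_norm_bound)
    also have "\<dots> \<le> (LINT z|lborel. 2 * \<bar>x - x'\<bar> powr \<eta> * (norm z powr \<eta> * norm (g z)))"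
      using i gn pw by (intro integral_mono) auto
    also have "\<dots> = A2 * \<bar>x - x'\<bar> powr \<eta>" by (simp add: A2_def)
    finally show ?thesis .
  qed
  show ?thesis
  proof (rule that[of "A1 + A2"])
    show "\<bar>f x y\<bar> \<le> A1 + A2" for x y using 1[of x y] A by simp
    show "\<bar>f x y - f x' y\<bar> \<le> (A1 + A2) * \<bar>x - x'\<bar> powr \<eta>" for x x' y
      using 2[of x y x'] A mult_right_mono[of A2 "A1 + A2" "\<bar>x - x'\<bar> powr \<eta>"] by simp
  qed (use A in auto)
qed

lemma increment_le_of_derivative_bound:
  fixes L L' :: "real \<Rightarrow> real"
  assumes L: "\<And>x. (L has_real_derivative L' x) (at x)"
    and bound: "\<And>a b t. a \<le> b \<Longrightarrow> t \<in> {a..b} \<Longrightarrow> \<bar>L' t\<bar> \<le> C * (\<bar>L' a\<bar> + \<bar>L' b\<bar> + 1)"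
  shows "\<bar>L x - L y\<bar> \<le> \<bar>C\<bar> * (\<bar>x - y\<bar> * (\<bar>L' x\<bar> + \<bar>L' y\<bar> + 1))"
proof -
  let ?B = "\<bar>C\<bar> * (\<bar>L' x\<bar> + \<bar>L' y\<bar> + 1)"
  have "norm (L x - L y) \<le> ?B * norm (x - y)"
  proof (rule field_differentiable_bound[where S="{min x y..max x y}"])
    fix z assume z: "z \<in> {min x y..max x y}"
    show "(L has_field_derivative L' z) (at z within {min x y..max x y})"
      using L by (rule has_field_derivative_at_within)
    have "\<bar>L' z\<bar> \<le> C * (\<bar>L' (min x y)\<bar> + \<bar>L' (max x y)\<bar> + 1)"
      by (rule bound) (use z in auto)
    also have "\<dots> = C * (\<bar>L' x\<bar> + \<bar>L' y\<bar> + 1)" by (simp add: min_def max_def)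
    also have "\<dots> \<le> ?B" by (intro mult_right_mono) auto
    finally show "norm (L' z) \<le> ?B" by simp
  qed auto
  then show ?thesis by (simp add: mult_ac)
qed

lemma measurable_derivative:
  fixes L L' :: "real \<Rightarrow> real"
  assumes L: "\<And>x. (L has_real_derivative L' x) (at x)"
  shows "L \<in> borel_measurable borel" "L' \<in> borel_measurable borel"
proof -
  show Lm [measurable]: "L \<in> borel_measurable borel"
    using L by (intro borel_measurable_continuous_onI continuous_at_imp_continuous_on) (auto intro: DERIV_isCont)
  show "L' \<in> borel_measurable borel"
  proof (rule borel_measurable_LIMSEQ_real)
    fix x
    have "((\<lambda>h. (L (x + h) - L x) / h) \<longlongrightarrow> L' x) (at 0)"
      using L[of x] by (simp add: DERIV_def)
    moreover have "filterlim (\<lambda>n. 1 / real (Suc n)) (at 0) sequentially"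
      using LIMSEQ_Suc[OF lim_1_over_n] by (auto simp: filterlim_at)
    ultimately show "(\<lambda>n. (L (x + 1 / real (Suc n)) - L x) / (1 / real (Suc n))) \<longlonglongrightarrow> L' x"
      by (rule filterlim_compose)
  qed measurable
qed

section \<open>Coupled arrays from innovations\<close>

context innovations
begin

text \<open>The independence and the joint law hold for any functions of the past: the innovations up to time \<open>i\<close> and the
  variables that build the sequence renewed up to time \<open>i\<close> are disjoint parts of one independent family, and the renewed
  sequence has the law of the original one.\<close>

lemma coupled_arrayI:
  fixes z :: "nat \<Rightarrow> nat \<Rightarrow> (nat \<Rightarrow> real) \<Rightarrow> real"
  assumes p: "2 < p" "p \<le> 3" and \<rho>: "0 < \<rho>" "\<rho> < 1"
    and z [measurable]: "\<And>n k. z n k \<in> borel_measurable seq_borel"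
    and moment: "\<And>n k. integrable M (\<lambda>\<omega>. \<bar>z n k (past \<epsilon> (int k) \<omega>)\<bar> powr p)"
      "\<And>n k. (\<integral>\<omega>. \<bar>z n k (past \<epsilon> (int k) \<omega>)\<bar> powr p \<partial>M) \<le> B"
    and mean: "\<And>n k. (\<integral>\<omega>. z n k (past \<epsilon> (int k) \<omega>) \<partial>M) = 0"
    and gap: "\<And>n i k. i < k \<Longrightarrow> integrable M (\<lambda>\<omega>.
        (\<bar>z n k (past \<epsilon> (int k) \<omega>) - z n k (past (renewed {..int i}) (int k) \<omega>)\<bar> / \<rho> ^ (k - i)) powr p)"
      "\<And>n i k. i < k \<Longrightarrow> (\<integral>\<omega>.
        (\<bar>z n k (past \<epsilon> (int k) \<omega>) - z n k (past (renewed {..int i}) (int k) \<omega>)\<bar> / \<rho> ^ (k - i)) powr p \<partial>M) \<le> B"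
  shows "coupled_array M (\<lambda>n k \<omega>. z n k (past \<epsilon> (int k) \<omega>))
      (\<lambda>n i k \<omega>. z n k (past (renewed {..int i}) (int k) \<omega>)) p \<rho> B"
proof (unfold_locales)
  fix n i :: nat
  let ?E = "case_sum \<epsilon> \<epsilon>'"
  let ?A = "Inl ` {..int i} :: (int + int) set" and ?B = "range (renewed_index {..int i})"
  show "indep_var (PiM {..i} (\<lambda>_. borel)) (\<lambda>\<omega>. \<lambda>k\<in>{..i}. z n k (past \<epsilon> (int k) \<omega>))
     (PiM {i<..} (\<lambda>_. borel)) (\<lambda>\<omega>. \<lambda>k\<in>{i<..}. z n k (past (renewed {..int i}) (int k) \<omega>))"
  proof -
    let ?f = "\<lambda>y. \<lambda>k\<in>{..i}. z n k (\<lambda>m. y (Inl (int k - int m)))"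
    let ?g = "\<lambda>y. \<lambda>k\<in>{i<..}. z n k (\<lambda>m. y (renewed_index {..int i} (int k - int m)))"
    have ind: "indep_var (PiM ?A (\<lambda>_. borel)) (\<lambda>\<omega>. restrict (\<lambda>s. ?E s \<omega>) ?A) (PiM ?B (\<lambda>_. borel)) (\<lambda>\<omega>. restrict (\<lambda>s. ?E s \<omega>) ?B)"
      by (rule indep_var_restrict[OF indep]) (auto simp: renewed_index_def split: if_splits)
    have f: "?f \<in> measurable (PiM ?A (\<lambda>_. borel)) (PiM {..i} (\<lambda>_. borel))"
    proof (rule measurable_restrict)
      fix k assume k: "k \<in> {..i}"
      have "(\<lambda>y m. y (Inl (int k - int m))) \<in> measurable (PiM ?A (\<lambda>_. borel)) seq_borel"
        by (rule measurable_PiM_single') (use k in \<open>auto intro!: measurable_component_singleton\<close>)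
      then show "(\<lambda>y. z n k (\<lambda>m. y (Inl (int k - int m)))) \<in> borel_measurable (PiM ?A (\<lambda>_. borel))"
        by (rule measurable_compose[OF _ z])
    qed
    have g: "?g \<in> measurable (PiM ?B (\<lambda>_. borel)) (PiM {i<..} (\<lambda>_. borel))"
    proof (rule measurable_restrict)
      fix k assume k: "k \<in> {i<..}"
      have "(\<lambda>y m. y (renewed_index {..int i} (int k - int m))) \<in> measurable (PiM ?B (\<lambda>_. borel)) seq_borel"
        by (rule measurable_PiM_single') (auto intro!: measurable_component_singleton)
      then show "(\<lambda>y. z n k (\<lambda>m. y (renewed_index {..int i} (int k - int m)))) \<in> borel_measurable (PiM ?B (\<lambda>_. borel))"
        by (rule measurable_compose[OF _ z])
    qed
    have "?f \<circ> (\<lambda>\<omega>. restrict (\<lambda>s. ?E s \<omega>) ?A) = (\<lambda>\<omega>. \<lambda>k\<in>{..i}. z n k (past \<epsilon> (int k) \<omega>))"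
      by (auto simp: fun_eq_iff past_def restrict_def image_iff intro!: arg_cong[where f="z n _"])
    moreover have "?g \<circ> (\<lambda>\<omega>. restrict (\<lambda>s. ?E s \<omega>) ?B)
        = (\<lambda>\<omega>. \<lambda>k\<in>{i<..}. z n k (past (renewed {..int i}) (int k) \<omega>))"
      by (auto simp: fun_eq_iff past_def restrict_def renewed_eq_index intro!: arg_cong[where f="z n _"])
    ultimately show ?thesis using indep_var_compose[OF ind f g] by simp
  qed
  show "distr M (PiM {i<..} (\<lambda>_. borel)) (\<lambda>\<omega>. \<lambda>k\<in>{i<..}. z n k (past (renewed {..int i}) (int k) \<omega>))
      = distr M (PiM {i<..} (\<lambda>_. borel)) (\<lambda>\<omega>. \<lambda>k\<in>{i<..}. z n k (past \<epsilon> (int k) \<omega>))"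
  proof -
    let ?h = "\<lambda>y :: int \<Rightarrow> real. \<lambda>k\<in>{i<..}. z n k (\<lambda>m. y (int k - int m))"
    have h: "?h \<in> measurable seq_borel (PiM {i<..} (\<lambda>_. borel))"
    proof (rule measurable_restrict)
      fix k
      have "(\<lambda>(y :: int \<Rightarrow> real) m. y (int k - int m)) \<in> measurable seq_borel seq_borel"
        by (rule measurable_PiM_single') auto
      then show "(\<lambda>y. z n k (\<lambda>m. y (int k - int m))) \<in> borel_measurable seq_borel"
        by (rule measurable_compose[OF _ z])
    qed
    have "distr M (PiM {i<..} (\<lambda>_. borel)) (\<lambda>\<omega>. \<lambda>k\<in>{i<..}. z n k (past (renewed A) (int k) \<omega>))
        = distr (PiM UNIV (\<lambda>_. distr M borel (\<epsilon> 0))) (PiM {i<..} (\<lambda>_. borel)) ?h" for A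
    proof -
      have "(\<lambda>\<omega> j. ?E (renewed_index A j) \<omega>) \<in> measurable M seq_borel"
        by (rule measurable_PiM_single') auto
      then show ?thesis
        unfolding law_reindex[OF inj_renewed_index, symmetric, of A]
        by (subst distr_distr[OF h]) (simp_all add: comp_def past_def renewed_eq_index)
    qed
    from this[of "{..int i}"] this[of "{}"] show ?thesis by simp
  qed
qed (use p \<rho> moment mean gap in auto)

end

text \<open>Here \<open>d\<close> is the coupling error of the process, of order \<open>a\<close>. Every product of two factors is bounded by squares of
  \<open>d / a\<close> and of the other factors, which is where twice the exponent \<open>p\<close> is required of the process; the linear and the Hoelder part
  together are of order \<open>a powr \<eta>\<close>.\<close>

lemma kernel_increment_powr:
  fixes a \<eta> p q1 q2 d b1 b2 b0 :: real
  assumes a: "0 < a" "a \<le> 1" and \<eta>: "0 < \<eta>" "\<eta> \<le> 1" and p: "0 < p" "2 * p \<le> q1" "2 * p \<le> q2"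
    and nn: "0 \<le> d" "0 \<le> b1" "0 \<le> b2" "0 \<le> b0"
  shows "((d * (b1 + b2 + 1) + b0 * d powr \<eta>) / a powr \<eta>) powr p
    \<le> 20 powr p * (5 + (d / a) powr q2 + b1 powr q1 + b2 powr q1 + b0 powr q1)"
proof -
  define u where "u = d / a"
  have u: "0 \<le> u" "d = a * u" using a nn by (simp_all add: u_def)
  define s where "s = Max {1, u\<^sup>2, b1\<^sup>2, b2\<^sup>2, b0\<^sup>2}"
  have s: "1 \<le> s" "u\<^sup>2 \<le> s" "b1\<^sup>2 \<le> s" "b2\<^sup>2 \<le> s" "b0\<^sup>2 \<le> s"
    unfolding s_def by (auto intro!: Max_ge)
  have a\<eta>: "0 < a powr \<eta>" "a \<le> a powr \<eta>"
    using a \<eta> powr_mono'[of \<eta> 1 a] by auto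
  have am: "x * y \<le> x\<^sup>2 / 2 + y\<^sup>2 / 2" for x y :: real
    using sum_squares_bound[of x y] by simp
  have u\<eta>: "u powr \<eta> \<le> 1 + u"
    using powr_le_1_plus_powr[of u \<eta> 1] u \<eta> by simp
  have "d * (b1 + b2 + 1) + b0 * d powr \<eta> = a * (u * (b1 + b2 + 1)) + a powr \<eta> * (b0 * u powr \<eta>)"
    by (simp add: u(2) powr_mult algebra_simps)
  also have "\<dots> \<le> a powr \<eta> * (u * (b1 + b2 + 1)) + a powr \<eta> * (b0 * (1 + u))"
    using a\<eta> u u\<eta> nn by (intro add_mono mult_right_mono mult_left_mono) auto
  also have "\<dots> = a powr \<eta> * (u * b1 + u * b2 + u * 1 + b0 * 1 + b0 * u)"
    by (simp add: algebra_simps)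
  also have "\<dots> \<le> a powr \<eta> * (20 * s)"
    using s am[of u b1] am[of u b2] am[of u 1] am[of b0 1] am[of b0 u] by (intro mult_left_mono) auto
  finally have "(d * (b1 + b2 + 1) + b0 * d powr \<eta>) / a powr \<eta> \<le> 20 * s"
    using a\<eta> by (simp add: field_simps)
  then have "((d * (b1 + b2 + 1) + b0 * d powr \<eta>) / a powr \<eta>) powr p \<le> (20 * s) powr p"
    using p nn by (intro powr_mono2) auto
  also have "\<dots> = 20 powr p * s powr p" by (rule powr_mult)
  also have "s powr p \<le> 5 + u powr q2 + b1 powr q1 + b2 powr q1 + b0 powr q1"
  proof -
    have sq: "(y\<^sup>2) powr p \<le> 1 + y powr q" if "0 \<le> y" "2 * p \<le> q" for y q :: real
    proof -
      have "(y\<^sup>2) powr p = (y powr 2) powr p" using that by simp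
      also have "\<dots> = y powr (2 * p)" by (rule powr_powr)
      also have "\<dots> \<le> 1 + y powr q" using that p by (intro powr_le_1_plus_powr) auto
      finally show ?thesis .
    qed
    let ?R = "5 + u powr q2 + b1 powr q1 + b2 powr q1 + b0 powr q1"
    have pos: "0 \<le> u powr q2" "0 \<le> b1 powr q1" "0 \<le> b2 powr q1" "0 \<le> b0 powr q1" by simp_all
    have "1 powr p \<le> ?R" unfolding powr_one_eq_one using pos by linarith
    moreover have "(u\<^sup>2) powr p \<le> ?R" using sq[of u q2] u(1) p(3) pos by linarith
    moreover have "(b1\<^sup>2) powr p \<le> ?R" using sq[of b1 q1] nn(2) p(2) pos by linarith
    moreover have "(b2\<^sup>2) powr p \<le> ?R" using sq[of b2 q1] nn(3) p(2) pos by linarith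
    moreover have "(b0\<^sup>2) powr p \<le> ?R" using sq[of b0 q1] nn(4) p(2) pos by linarith
    moreover have "s \<in> {1, u\<^sup>2, b1\<^sup>2, b2\<^sup>2, b0\<^sup>2}" unfolding s_def by (intro Max_in) auto
    ultimately show ?thesis by blast
  qed
  finally show ?thesis by (simp add: u_def mult_left_mono)
qed

section \<open>Smooth functions of a piecewise locally stationary process\<close>

context piecewise_locally_stationary
begin

definition pls_map :: "nat \<Rightarrow> nat \<Rightarrow> (nat \<Rightarrow> real) \<Rightarrow> real" where
  "pls_map n k \<xi> = (\<Sum>j=0..r. G j (real k / real n) \<xi> * indicator {d j<..d (Suc j)} (real k / real n))"

lemma pls_process_eq: "pls_process \<epsilon> r d G n k \<omega> = pls_map n k (past \<epsilon> (int k) \<omega>)"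
  by (simp add: pls_process_def pls_map_def)

lemma breaks_mono: "i \<le> j \<Longrightarrow> j \<le> Suc r \<Longrightarrow> d i \<le> d j"
proof (induction rule: dec_induct)
  case (step j)
  then show ?case using breaks_less[of j] by simp
qed simp

lemma pls_map_piece:
  assumes k: "1 \<le> k" "k \<le> n"
  obtains l where "l \<le> r" "real k / real n \<in> {d l<..d (Suc l)}" "pls_map n k = G l (real k / real n)"
proof -
  let ?t = "real k / real n"
  have t: "0 < ?t" "?t \<le> 1" using k by auto
  define l where "l = (LEAST j. ?t \<le> d (Suc j))"
  have ex: "?t \<le> d (Suc r)" using t breaks_last by simp
  have l: "?t \<le> d (Suc l)" unfolding l_def using ex by (rule LeastI)
  have lr: "l \<le> r" unfolding l_def using ex by (rule Least_le)
  have dl: "d l < ?t"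
  proof (cases l)
    case 0 then show ?thesis using t breaks_first by simp
  next
    case (Suc j)
    then have "\<not> ?t \<le> d (Suc j)" using not_less_Least[of j "\<lambda>j. ?t \<le> d (Suc j)"] by (simp add: l_def)
    then show ?thesis using Suc by simp
  qed
  have other: "?t \<notin> {d j<..d (Suc j)}" if "j \<le> r" "j \<noteq> l" for j
  proof (cases "j < l")
    case True
    then show ?thesis using breaks_mono[of "Suc j" l] lr dl by auto
  next
    case False
    then show ?thesis using breaks_mono[of "Suc l" j] that l by auto
  qed
  have "pls_map n k \<xi> = G l ?t \<xi>" for \<xi>
  proof -
    have "pls_map n k \<xi> = (\<Sum>j\<in>{l}. G j ?t \<xi> * indicator {d j<..d (Suc j)} ?t)"
      unfolding pls_map_def using other lr by (intro sum.mono_neutral_right) auto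
    then show ?thesis using dl l by simp
  qed
  then show ?thesis using that[OF lr] dl l by auto
qed

lemma pls_map_measurable:
  assumes "1 \<le> k" "k \<le> n"
  shows "pls_map n k \<in> borel_measurable seq_borel"
proof -
  obtain l where l: "l \<le> r" "real k / real n \<in> {d l<..d (Suc l)}" "pls_map n k = G l (real k / real n)"
    using pls_map_piece[OF assms] by blast
  have "Pair (real k / real n) \<in> measurable seq_borel (restrict_space borel {d l<..d (Suc l)} \<Otimes>\<^sub>M seq_borel)"
    using l by (intro measurable_Pair1') (simp add: space_restrict_space)
  from measurable_compose[OF this G_measurable[OF l(1)]] show ?thesis
    by (simp add: l(3))
qed

text \<open>The dependence measure is defined at time \<open>0\<close>; the equality in law of pairs of pasts moves the bound to time \<open>k\<close>.\<close>

lemma single_renewal_moment: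
  assumes k: "1 \<le> k" "k \<le> n" and j: "j \<le> int k" and q: "0 < q" and D: "0 \<le> D"
    and dep: "dep_measure M \<epsilon> \<epsilon>' r d G (nat (int k - j)) q \<le> ennreal D"
  shows "(\<integral>\<^sup>+\<omega>. ennreal (\<bar>pls_map n k (past \<epsilon> (int k) \<omega>) - pls_map n k (past (renewed {j}) (int k) \<omega>)\<bar> powr q) \<partial>M)
    \<le> ennreal (D powr q)"
proof -
  let ?h = "nat (int k - j)" and ?t = "real k / real n"
  obtain l where l: "l \<le> r" "?t \<in> {d l<..d (Suc l)}" "pls_map n k = G l ?t"
    using pls_map_piece[OF k] by blast
  note [measurable] = pls_map_measurable[OF k]
  have upd: "\<epsilon>(- int ?h := \<epsilon>' (- int ?h)) = renewed {- int ?h}"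
    by (auto simp: renewed_def fun_eq_iff)
  let ?N = "\<lambda>l t. Lp_norm M q (\<lambda>\<omega>. G l t (past \<epsilon> 0 \<omega>) - G l t (past (\<epsilon>(- int ?h := \<epsilon>' (- int ?h))) 0 \<omega>))"
  have "?N l ?t \<le> (SUP t\<in>{d l<..d (Suc l)}. ?N l t)"
    using l by (intro SUP_upper) auto
  also have "\<dots> \<le> dep_measure M \<epsilon> \<epsilon>' r d G ?h q"
    unfolding dep_measure_def using l by (intro Max_ge) auto
  finally have "?N l ?t \<le> ennreal D" using dep by simp
  then have "Lp_norm M q (\<lambda>\<omega>. pls_map n k (past \<epsilon> 0 \<omega>) - pls_map n k (past (renewed {- int ?h}) 0 \<omega>)) \<le> ennreal D"
    by (simp only: upd l(3))
  then have "(\<integral>\<^sup>+\<omega>. ennreal (\<bar>pls_map n k (past \<epsilon> 0 \<omega>) - pls_map n k (past (renewed {- int ?h}) 0 \<omega>)\<bar> powr q) \<partial>M)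
      \<le> ennreal (D powr q)"
    by (rule nn_integral_powr_le_of_Lp_norm_le[OF q D])
  moreover have "(\<integral>\<^sup>+\<omega>. ennreal (\<bar>pls_map n k (past (renewed {}) (int k) \<omega>) - pls_map n k (past (renewed {j}) (int k) \<omega>)\<bar> powr q) \<partial>M)
     = (\<integral>\<^sup>+\<omega>. ennreal (\<bar>pls_map n k (past (renewed {}) 0 \<omega>) - pls_map n k (past (renewed {- int ?h}) 0 \<omega>)\<bar> powr q) \<partial>M)"
    by (rule past_pair_nn_integral[where F="\<lambda>x y. ennreal (\<bar>pls_map n k x - pls_map n k y\<bar> powr q)"])
       (use j in auto)
  ultimately show ?thesis by simp
qed

text \<open>The moment order \<open>p = 2 + min (min e1 e2) 1\<close> is at most half of what is assumed of \<open>L\<close>, \<open>L'\<close> and of the dependence measure, because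
  the increment of \<open>h\<close> is bounded by products. The decay rate changes from \<open>\<rho>\<close> to \<open>\<rho> powr \<eta>\<close>, the Hoelder part of the kernel
  being the least regular.\<close>

lemma coupled_array_of_smooth_functions:
  fixes h :: "nat \<Rightarrow> nat \<Rightarrow> real \<Rightarrow> real" and L L' :: "real \<Rightarrow> real" and \<kappa> \<eta> e1 e2 \<Lambda> K \<rho> :: real
  defines "X \<equiv> pls_process \<epsilon> r d G"
  assumes h [measurable]: "\<And>n k. h n k \<in> borel_measurable borel"
    and L [measurable]: "L \<in> borel_measurable borel" "L' \<in> borel_measurable borel"
    and \<kappa>: "0 \<le> \<kappa>" and \<eta>: "0 < \<eta>" "\<eta> \<le> 1"
    and h_le: "\<And>n k x. 1 \<le> k \<Longrightarrow> k \<le> n \<Longrightarrow> \<bar>h n k x\<bar> \<le> \<kappa> * \<bar>L x\<bar>"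
    and h_inc: "\<And>n k x y. 1 \<le> k \<Longrightarrow> k \<le> n \<Longrightarrow>
       \<bar>h n k x - h n k y\<bar> \<le> \<kappa> * (\<bar>x - y\<bar> * (\<bar>L' x\<bar> + \<bar>L' y\<bar> + 1) + \<bar>L y\<bar> * \<bar>x - y\<bar> powr \<eta>)"
    and e: "0 < e1" "0 < e2" and \<Lambda>: "0 \<le> \<Lambda>"
    and L_moment: "\<And>n k. 1 \<le> k \<Longrightarrow> k \<le> n \<Longrightarrow> (\<integral>\<^sup>+\<omega>. ennreal (\<bar>L (X n k \<omega>)\<bar> powr (4 + 2 * e1)) \<partial>M) \<le> ennreal \<Lambda>"
    and L'_moment: "\<And>n k. 1 \<le> k \<Longrightarrow> k \<le> n \<Longrightarrow> (\<integral>\<^sup>+\<omega>. ennreal (\<bar>L' (X n k \<omega>)\<bar> powr (4 + 2 * e1)) \<partial>M) \<le> ennreal \<Lambda>"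
    and \<rho>: "0 \<le> \<rho>" "\<rho> < 1"
    and dep: "\<forall>\<^sub>F k in sequentially. dep_measure M \<epsilon> \<epsilon>' r d G k (4 + 2 * e2) \<le> ennreal (K * \<rho> ^ k)"
  shows "\<exists>Z' p \<rho> B. coupled_array M
     (\<lambda>n k \<omega>. if 1 \<le> k \<and> k \<le> n then h n k (X n k \<omega>) - (\<integral>\<omega>. h n k (X n k \<omega>) \<partial>M) else 0) Z' p \<rho> B"
proof -
  define q1 where "q1 = 4 + 2 * e1"
  define q2 where "q2 = 4 + 2 * e2"
  define p where "p = 2 + min (min e1 e2) 1"
  have p: "2 < p" "p \<le> 3" "2 * p \<le> q1" "2 * p \<le> q2" using e by (auto simp: p_def q1_def q2_def)
  \<comment> \<open>A positive rate is needed to normalize the gaps.\<close>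
  define \<rho>1 where "\<rho>1 = max \<rho> (1 / 2)"
  have \<rho>1: "0 < \<rho>1" "\<rho>1 < 1" "\<rho> \<le> \<rho>1" using \<rho> by (auto simp: \<rho>1_def)
  define \<rho>2 where "\<rho>2 = \<rho>1 powr \<eta>"
  have \<rho>2: "0 < \<rho>2" "\<rho>2 < 1"
    using \<rho>1 \<eta> powr_less_mono2[of \<eta> \<rho>1 1] by (auto simp: \<rho>2_def)
  have \<rho>2_power: "\<rho>2 ^ i = (\<rho>1 ^ i) powr \<eta>" for i
    using \<rho>1 by (simp add: \<rho>2_def powr_realpow[symmetric] powr_powr mult.commute)
  define K1 where "K1 = max K 0"
  define K2 where "K2 = K1 / (1 - sqrt \<rho>1)\<^sup>2"
  have K: "0 \<le> K1" "K \<le> K1" by (auto simp: K1_def)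
  have K2: "0 \<le> K2" using K by (simp add: K2_def)
  obtain i0 where i0: "\<And>k. i0 \<le> k \<Longrightarrow> dep_measure M \<epsilon> \<epsilon>' r d G k q2 \<le> ennreal (K1 * \<rho>1 ^ k)"
  proof -
    obtain i0 where "\<And>k. i0 \<le> k \<Longrightarrow> dep_measure M \<epsilon> \<epsilon>' r d G k q2 \<le> ennreal (K * \<rho> ^ k)"
      using dep unfolding eventually_sequentially q2_def by blast
    moreover have "ennreal (K * \<rho> ^ k) \<le> ennreal (K1 * \<rho>1 ^ k)" for k
      using K \<rho> \<rho>1 by (intro ennreal_leI order_trans[OF mult_right_mono[of K K1] mult_left_mono] power_mono) auto
    ultimately show ?thesis by (intro that[of i0]) (blast intro: order_trans)
  qed
  define Y where "Y A n k \<omega> = pls_map n k (past (renewed A) (int k) \<omega>)" for A n k \<omega>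
  have X_eq: "X n k = Y {} n k" for n k
    by (simp add: X_def Y_def pls_process_eq fun_eq_iff)
  have Y_meas [measurable]: "Y A n k \<in> borel_measurable M" if "1 \<le> k" "k \<le> n" for A n k
  proof -
    note [measurable] = pls_map_measurable[OF that]
    show ?thesis unfolding Y_def[abs_def] by measurable
  qed
  have Y_law: "(\<integral>\<omega>. f (Y A n k \<omega>) \<partial>M) = (\<integral>\<omega>. f (Y {} n k \<omega>) \<partial>M)"
      "integrable M (\<lambda>\<omega>. f (Y A n k \<omega>)) \<longleftrightarrow> integrable M (\<lambda>\<omega>. f (Y {} n k \<omega>))"
    if "1 \<le> k" "k \<le> n" and f: "f \<in> borel_measurable borel" for A n k and f :: "real \<Rightarrow> real"
  proof -
    have m: "(\<lambda>\<xi>. f (pls_map n k \<xi>)) \<in> borel_measurable seq_borel"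
      by (rule measurable_compose[OF pls_map_measurable[OF that(1,2)] f])
    show "(\<integral>\<omega>. f (Y A n k \<omega>) \<partial>M) = (\<integral>\<omega>. f (Y {} n k \<omega>) \<partial>M)"
      unfolding Y_def past_integral(1)[OF m] ..
    show "integrable M (\<lambda>\<omega>. f (Y A n k \<omega>)) \<longleftrightarrow> integrable M (\<lambda>\<omega>. f (Y {} n k \<omega>))"
      unfolding Y_def past_integral(2)[OF m] ..
  qed
  have mom: "integrable M (\<lambda>\<omega>. \<bar>g (Y A n k \<omega>)\<bar> powr q1)" "(\<integral>\<omega>. \<bar>g (Y A n k \<omega>)\<bar> powr q1 \<partial>M) \<le> \<Lambda>"
    if k: "1 \<le> k" "k \<le> n" and g: "g = L \<or> g = L'" for g A n k
  proof -
    note [measurable] = Y_meas[OF k]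
    have gm [measurable]: "g \<in> borel_measurable borel" using g L by auto
    have "(\<integral>\<^sup>+\<omega>. ennreal (\<bar>g (Y {} n k \<omega>)\<bar> powr q1) \<partial>M) \<le> ennreal \<Lambda>"
      using L_moment[OF k] L'_moment[OF k] g by (auto simp: X_eq q1_def)
    then have "integrable M (\<lambda>\<omega>. \<bar>g (Y {} n k \<omega>)\<bar> powr q1)" "(\<integral>\<omega>. \<bar>g (Y {} n k \<omega>)\<bar> powr q1 \<partial>M) \<le> \<Lambda>"
      by (auto intro!: integrable_of_nn_integral_le[OF _ _ _ \<Lambda>])
    then show "integrable M (\<lambda>\<omega>. \<bar>g (Y A n k \<omega>)\<bar> powr q1)" "(\<integral>\<omega>. \<bar>g (Y A n k \<omega>)\<bar> powr q1 \<partial>M) \<le> \<Lambda>"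
      using Y_law[OF k, of "\<lambda>x. \<bar>g x\<bar> powr q1" A] by auto
  qed
  define \<mu> where "\<mu> n k = (\<integral>\<omega>. h n k (Y {} n k \<omega>) \<partial>M)" for n k
  have h_int: "integrable M (\<lambda>\<omega>. h n k (Y A n k \<omega>))" and \<mu>_le: "\<bar>\<mu> n k\<bar> \<le> \<kappa> * (1 + \<Lambda>)"
    if k: "1 \<le> k" "k \<le> n" for A n k
  proof -
    note [measurable] = Y_meas[OF k]
    have le: "\<bar>h n k (Y A n k \<omega>)\<bar> \<le> \<kappa> * (1 + \<bar>L (Y A n k \<omega>)\<bar> powr q1)" for A \<omega>
    proof -
      have "\<bar>L (Y A n k \<omega>)\<bar> powr 1 \<le> 1 + \<bar>L (Y A n k \<omega>)\<bar> powr q1"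
        using e by (intro powr_le_1_plus_powr) (auto simp: q1_def)
      then have "\<kappa> * \<bar>L (Y A n k \<omega>)\<bar> \<le> \<kappa> * (1 + \<bar>L (Y A n k \<omega>)\<bar> powr q1)"
        using \<kappa> by (intro mult_left_mono) auto
      then show ?thesis using h_le[OF k, of "Y A n k \<omega>"] by linarith
    qed
    have bi: "integrable M (\<lambda>\<omega>. \<kappa> * (1 + \<bar>L (Y A n k \<omega>)\<bar> powr q1))" for A
      using mom(1)[OF k, of L A] by auto
    show hi: "integrable M (\<lambda>\<omega>. h n k (Y A n k \<omega>))" for A
      by (rule Bochner_Integration.integrable_bound[OF bi[of A]]) (auto intro!: AE_I2 order_trans[OF le])
    have "\<bar>\<mu> n k\<bar> \<le> (\<integral>\<omega>. \<bar>h n k (Y {} n k \<omega>)\<bar> \<partial>M)"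
      unfolding \<mu>_def by (rule integral_abs_bound)
    also have "\<dots> \<le> (\<integral>\<omega>. \<kappa> * (1 + \<bar>L (Y {} n k \<omega>)\<bar> powr q1) \<partial>M)"
      by (rule integral_mono[OF integrable_abs[OF hi] bi]) (rule le)
    also have "\<dots> = \<kappa> * (1 + (\<integral>\<omega>. \<bar>L (Y {} n k \<omega>)\<bar> powr q1 \<partial>M))"
      using mom(1)[OF k, of L "{}"] by (simp add: prob_space)
    also have "\<dots> \<le> \<kappa> * (1 + \<Lambda>)"
      using mom(2)[OF k, of L "{}"] \<kappa> by (intro mult_left_mono) auto
    finally show "\<bar>\<mu> n k\<bar> \<le> \<kappa> * (1 + \<Lambda>)" .
  qed
  define z where "z n k \<xi> = (if 1 \<le> k \<and> k \<le> n then h n k (pls_map n k \<xi>) - \<mu> n k else 0)" for n k \<xi>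
  have z_meas: "z n k \<in> borel_measurable seq_borel" for n k
  proof (cases "1 \<le> k \<and> k \<le> n")
    case True
    note [measurable] = pls_map_measurable[of k n]
    show ?thesis using True unfolding z_def[abs_def] by simp
  next
    case False
    then have "z n k = (\<lambda>_. 0)" by (auto simp: z_def fun_eq_iff)
    then show ?thesis by simp
  qed
  have z_Y: "z n k (past (renewed A) (int k) \<omega>) = h n k (Y A n k \<omega>) - \<mu> n k" if "1 \<le> k" "k \<le> n" for A n k \<omega>
    using that by (simp add: z_def Y_def)
  have z_0: "z n k \<xi> = 0" if "\<not> (1 \<le> k \<and> k \<le> n)" for n k \<xi>
    using that by (auto simp: z_def)
  \<comment> \<open>\<open>B0\<close> bounds the moments, \<open>B1\<close> the gaps at the finitely many lags below \<open>i0\<close>, where the dependence measure may be infinite, and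
      \<open>B2\<close> the gaps at all larger lags.\<close>
  define B0 where "B0 = 2 powr p * (\<kappa> powr p * (1 + \<Lambda>) + (\<kappa> * (1 + \<Lambda>)) powr p)"
  define B1 where "B1 = (1 / \<rho>2 ^ i0) powr p * (2 powr p * (B0 + B0))"
  define B2 where "B2 = \<kappa> powr p * (20 powr p * (5 + K2 powr q2 + \<Lambda> + \<Lambda> + \<Lambda>))"
  have B_nonneg: "0 \<le> B0" "0 \<le> B1" "0 \<le> B2"
    using \<Lambda> by (auto simp: B0_def B1_def B2_def)
  have z_moment: "integrable M (\<lambda>\<omega>. \<bar>z n k (past (renewed A) (int k) \<omega>)\<bar> powr p)"
      "(\<integral>\<omega>. \<bar>z n k (past (renewed A) (int k) \<omega>)\<bar> powr p \<partial>M) \<le> B0" for n k A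
  proof -
    have "integrable M (\<lambda>\<omega>. \<bar>z n k (past (renewed A) (int k) \<omega>)\<bar> powr p) \<and>
      (\<integral>\<omega>. \<bar>z n k (past (renewed A) (int k) \<omega>)\<bar> powr p \<partial>M) \<le> B0"
    proof (cases "1 \<le> k \<and> k \<le> n")
      case True
      then have k: "1 \<le> k" "k \<le> n" by auto
      note [measurable] = Y_meas[OF k]
      let ?b = "\<lambda>\<omega>. 2 powr p * (\<kappa> powr p * (1 + \<bar>L (Y A n k \<omega>)\<bar> powr q1) + (\<kappa> * (1 + \<Lambda>)) powr p)"
      have le: "\<bar>h n k (Y A n k \<omega>) - \<mu> n k\<bar> powr p \<le> ?b \<omega>" for \<omega>
      proof -
        have "\<bar>h n k (Y A n k \<omega>) - \<mu> n k\<bar> powr p \<le> 2 powr p * (\<bar>h n k (Y A n k \<omega>)\<bar> powr p + \<bar>- \<mu> n k\<bar> powr p)"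
          using powr_add_le[of p "h n k (Y A n k \<omega>)" "- \<mu> n k"] p by simp
        also have "\<dots> \<le> 2 powr p * ((\<kappa> * \<bar>L (Y A n k \<omega>)\<bar>) powr p + (\<kappa> * (1 + \<Lambda>)) powr p)"
          using h_le[OF k, of "Y A n k \<omega>"] \<mu>_le[OF k] p by (intro mult_left_mono add_mono powr_mono2) auto
        also have "\<dots> \<le> ?b \<omega>"
          unfolding powr_mult[of \<kappa> "\<bar>L (Y A n k \<omega>)\<bar>"] using p
          by (intro mult_left_mono add_mono order_refl powr_le_1_plus_powr) auto
        finally show ?thesis .
      qed
      have bi: "integrable M ?b" using mom(1)[OF k, of L A] by auto
      have zi: "integrable M (\<lambda>\<omega>. \<bar>h n k (Y A n k \<omega>) - \<mu> n k\<bar> powr p)"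
        by (rule Bochner_Integration.integrable_bound[OF bi]) (auto intro!: AE_I2 order_trans[OF le])
      have "(\<integral>\<omega>. \<bar>h n k (Y A n k \<omega>) - \<mu> n k\<bar> powr p \<partial>M) \<le> (\<integral>\<omega>. ?b \<omega> \<partial>M)"
        by (rule integral_mono[OF zi bi]) (rule le)
      also have "\<dots> = 2 powr p * (\<kappa> powr p * (1 + (\<integral>\<omega>. \<bar>L (Y A n k \<omega>)\<bar> powr q1 \<partial>M)) + (\<kappa> * (1 + \<Lambda>)) powr p)"
        using mom(1)[OF k, of L A] by (simp add: prob_space)
      also have "\<dots> \<le> B0"
        unfolding B0_def using mom(2)[OF k, of L A] by (intro mult_left_mono add_mono) auto
      finally show ?thesis using zi by (simp add: z_Y[OF k])
    next
      case False
      then show ?thesis using B_nonneg by (simp add: z_0)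
    qed
    then show "integrable M (\<lambda>\<omega>. \<bar>z n k (past (renewed A) (int k) \<omega>)\<bar> powr p)"
      "(\<integral>\<omega>. \<bar>z n k (past (renewed A) (int k) \<omega>)\<bar> powr p \<partial>M) \<le> B0" by auto
  qed
  have gap: "integrable M (\<lambda>\<omega>. (\<bar>z n k (past \<epsilon> (int k) \<omega>) - z n k (past (renewed {..int i}) (int k) \<omega>)\<bar> / \<rho>2 ^ (k - i)) powr p) \<and>
      (\<integral>\<omega>. (\<bar>z n k (past \<epsilon> (int k) \<omega>) - z n k (past (renewed {..int i}) (int k) \<omega>)\<bar> / \<rho>2 ^ (k - i)) powr p \<partial>M) \<le> B0 + B1 + B2"
    if ik: "i < k" for n i k
  proof (cases "1 \<le> k \<and> k \<le> n")
    case False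
    then show ?thesis using B_nonneg p by (simp add: z_0)
  next
    case True
    then have k: "1 \<le> k" "k \<le> n" by auto
    note [measurable] = Y_meas[OF k] z_meas
    let ?A = "{..int i}"
    let ?g = "\<lambda>\<omega>. (\<bar>z n k (past \<epsilon> (int k) \<omega>) - z n k (past (renewed ?A) (int k) \<omega>)\<bar> / \<rho>2 ^ (k - i)) powr p"
    show ?thesis
    proof (cases "k - i < i0")
      case True
      let ?b = "\<lambda>\<omega>. (1 / \<rho>2 ^ i0) powr p * (2 powr p *
          (\<bar>z n k (past (renewed {}) (int k) \<omega>)\<bar> powr p + \<bar>z n k (past (renewed ?A) (int k) \<omega>)\<bar> powr p))"
      have le: "?g \<omega> \<le> ?b \<omega>" for \<omega>
      proof -
        let ?x = "z n k (past \<epsilon> (int k) \<omega>)" and ?y = "z n k (past (renewed ?A) (int k) \<omega>)"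
        have "\<rho>2 ^ i0 \<le> \<rho>2 ^ (k - i)" using True \<rho>2 by (intro power_decreasing) auto
        then have "\<bar>?x - ?y\<bar> / \<rho>2 ^ (k - i) \<le> \<bar>?x - ?y\<bar> / \<rho>2 ^ i0"
          using \<rho>2 by (intro divide_left_mono mult_pos_pos) auto
        then have "(\<bar>?x - ?y\<bar> / \<rho>2 ^ (k - i)) powr p \<le> (1 / \<rho>2 ^ i0 * \<bar>?x - ?y\<bar>) powr p"
          using p \<rho>2 by (intro powr_mono2) auto
        also have "\<dots> = (1 / \<rho>2 ^ i0) powr p * \<bar>?x - ?y\<bar> powr p" by (rule powr_mult)
        also have "\<dots> \<le> ?b \<omega>"
          using powr_add_le[of p ?x "- ?y"] p by (intro mult_left_mono) auto
        finally show ?thesis .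
      qed
      have bi: "integrable M ?b" using z_moment(1)[of n k "{}"] z_moment(1)[of n k ?A] by auto
      have gi: "integrable M ?g"
        by (rule Bochner_Integration.integrable_bound[OF bi]) (auto intro!: AE_I2 order_trans[OF le])
      have "(\<integral>\<omega>. ?g \<omega> \<partial>M) \<le> (\<integral>\<omega>. ?b \<omega> \<partial>M)"
        by (rule integral_mono[OF gi bi]) (rule le)
      also have "\<dots> = (1 / \<rho>2 ^ i0) powr p * (2 powr p *
          ((\<integral>\<omega>. \<bar>z n k (past (renewed {}) (int k) \<omega>)\<bar> powr p \<partial>M) + (\<integral>\<omega>. \<bar>z n k (past (renewed ?A) (int k) \<omega>)\<bar> powr p \<partial>M)))"
        using z_moment(1)[of n k "{}"] z_moment(1)[of n k ?A] by simp
      also have "\<dots> \<le> B1"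
        unfolding B1_def using z_moment(2)[of n k "{}"] z_moment(2)[of n k ?A] by (intro mult_left_mono add_mono) auto
      finally show ?thesis using gi B_nonneg by simp
    next
      case False
      define a where "a = \<rho>1 ^ (k - i)"
      have a: "0 < a" "a \<le> 1" using \<rho>1 by (auto simp: a_def power_le_one)
      define D where "D \<omega> = \<bar>Y {} n k \<omega> - Y ?A n k \<omega>\<bar>" for \<omega>
      have [measurable]: "D \<in> borel_measurable M" unfolding D_def[abs_def] by measurable
      have "(\<integral>\<^sup>+\<omega>. ennreal (\<bar>pls_map n k (past \<epsilon> (int k) \<omega>) - pls_map n k (past (renewed ?A) (int k) \<omega>)\<bar> powr q2) \<partial>M)
          \<le> ennreal ((K1 / (1 - sqrt \<rho>1)\<^sup>2 * \<rho>1 ^ nat (int k - int i)) powr q2)"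
      proof (rule renewal_moment_bound[OF pls_map_measurable[OF k] _ \<rho>1(1,2) K(1)])
        fix j assume j: "j \<le> int i"
        then have "i0 \<le> nat (int k - j)" using False ik by linarith
        then show "(\<integral>\<^sup>+\<omega>. ennreal (\<bar>pls_map n k (past \<epsilon> (int k) \<omega>) - pls_map n k (past (renewed {j}) (int k) \<omega>)\<bar> powr q2) \<partial>M)
            \<le> ennreal ((K1 * \<rho>1 ^ nat (int k - j)) powr q2)"
          using j ik p K \<rho>1 by (intro single_renewal_moment[OF k] i0) auto
      qed (use p ik in auto)
      then have "(\<integral>\<^sup>+\<omega>. ennreal (D \<omega> powr q2) \<partial>M) \<le> ennreal ((K2 * a) powr q2)"
        using ik by (simp add: D_def Y_def K2_def a_def nat_diff_distrib)
      then have Dq: "integrable M (\<lambda>\<omega>. D \<omega> powr q2)" "(\<integral>\<omega>. D \<omega> powr q2 \<partial>M) \<le> (K2 * a) powr q2"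
        by (auto intro!: integrable_of_nn_integral_le)
      have Da: "(D \<omega> / a) powr q2 = D \<omega> powr q2 / a powr q2" for \<omega>
        by (rule powr_divide)
      have Da_le: "(\<integral>\<omega>. (D \<omega> / a) powr q2 \<partial>M) \<le> K2 powr q2"
        using Dq(2) a unfolding Da by (simp add: powr_mult field_simps)
      let ?b = "\<lambda>\<omega>. \<kappa> powr p * (20 powr p * (5 + (D \<omega> / a) powr q2 + \<bar>L' (Y {} n k \<omega>)\<bar> powr q1
          + \<bar>L' (Y ?A n k \<omega>)\<bar> powr q1 + \<bar>L (Y ?A n k \<omega>)\<bar> powr q1))"
      have le: "?g \<omega> \<le> ?b \<omega>" for \<omega>
      proof -
        let ?x = "Y {} n k \<omega>" and ?y = "Y ?A n k \<omega>"
        let ?I = "D \<omega> * (\<bar>L' ?x\<bar> + \<bar>L' ?y\<bar> + 1) + \<bar>L ?y\<bar> * D \<omega> powr \<eta>"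
        have "\<bar>z n k (past \<epsilon> (int k) \<omega>) - z n k (past (renewed ?A) (int k) \<omega>)\<bar> = \<bar>h n k ?x - h n k ?y\<bar>"
          using z_Y[OF k, of "{}" \<omega>] z_Y[OF k, of ?A \<omega>] by simp
        also have "\<dots> \<le> \<kappa> * ?I" unfolding D_def by (rule h_inc[OF k])
        finally have "?g \<omega>
            \<le> (\<kappa> * (?I / a powr \<eta>)) powr p"
          unfolding \<rho>2_power a_def[symmetric] using p a by (intro powr_mono2) (auto intro: divide_right_mono)
        also have "\<dots> = \<kappa> powr p * (?I / a powr \<eta>) powr p" by (rule powr_mult)
        also have "\<dots> \<le> ?b \<omega>"
          using a \<eta> p by (intro mult_left_mono kernel_increment_powr) (auto simp: D_def)
        finally show ?thesis .
      qed
      note li = mom(1)[OF k, of L' "{}"] mom(1)[OF k, of L' ?A] mom(1)[OF k, of L ?A]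
      have Dai: "integrable M (\<lambda>\<omega>. (D \<omega> / a) powr q2)" unfolding Da using Dq(1) by simp
      have bi: "integrable M ?b" using li Dai by (auto simp del: abs_divide)
      have gi: "integrable M ?g"
        by (rule Bochner_Integration.integrable_bound[OF bi]) (use le in \<open>auto intro!: AE_I2 intro: order_trans[OF le abs_ge_self]\<close>)
      have "(\<integral>\<omega>. ?g \<omega> \<partial>M) \<le> (\<integral>\<omega>. ?b \<omega> \<partial>M)"
        by (rule integral_mono[OF gi bi]) (rule le)
      also have "\<dots> = \<kappa> powr p * (20 powr p * (5 + (\<integral>\<omega>. (D \<omega> / a) powr q2 \<partial>M) + (\<integral>\<omega>. \<bar>L' (Y {} n k \<omega>)\<bar> powr q1 \<partial>M)
          + (\<integral>\<omega>. \<bar>L' (Y ?A n k \<omega>)\<bar> powr q1 \<partial>M) + (\<integral>\<omega>. \<bar>L (Y ?A n k \<omega>)\<bar> powr q1 \<partial>M)))"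
        using li Dai by (simp add: prob_space)
      also have "\<dots> \<le> B2"
        unfolding B2_def using Da_le mom(2)[OF k, of L' "{}"] mom(2)[OF k, of L' ?A] mom(2)[OF k, of L ?A]
        by (intro mult_left_mono add_mono) auto
      finally show ?thesis using gi B_nonneg by simp
    qed
  qed
  have "coupled_array M (\<lambda>n k \<omega>. z n k (past \<epsilon> (int k) \<omega>))
      (\<lambda>n i k \<omega>. z n k (past (renewed {..int i}) (int k) \<omega>)) p \<rho>2 (B0 + B1 + B2)"
  proof (rule coupled_arrayI[OF p(1,2) \<rho>2 z_meas])
    fix n k
    show "integrable M (\<lambda>\<omega>. \<bar>z n k (past \<epsilon> (int k) \<omega>)\<bar> powr p)"
      "(\<integral>\<omega>. \<bar>z n k (past \<epsilon> (int k) \<omega>)\<bar> powr p \<partial>M) \<le> B0 + B1 + B2"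
      using z_moment[of n k "{}"] B_nonneg by auto
    show "(\<integral>\<omega>. z n k (past \<epsilon> (int k) \<omega>) \<partial>M) = 0"
    proof (cases "1 \<le> k \<and> k \<le> n")
      case True
      then have k: "1 \<le> k" "k \<le> n" by auto
      have "z n k (past \<epsilon> (int k) \<omega>) = h n k (Y {} n k \<omega>) - \<mu> n k" for \<omega>
        using z_Y[OF k, of "{}"] by simp
      then show ?thesis using h_int[OF k, of "{}"] by (simp add: prob_space \<mu>_def)
    qed (simp add: z_0)
  qed (use gap in blast)+
  moreover have "(\<lambda>n k \<omega>. z n k (past \<epsilon> (int k) \<omega>))
      = (\<lambda>n k \<omega>. if 1 \<le> k \<and> k \<le> n then h n k (X n k \<omega>) - (\<integral>\<omega>. h n k (X n k \<omega>) \<partial>M) else 0)"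
    by (auto simp: fun_eq_iff z_def X_eq Y_def \<mu>_def)
  ultimately show ?thesis by metis
qed

end

section \<open>The central limit theorem\<close>

theorem theorem1:
  fixes M :: "'a measure" and \<epsilon> \<epsilon>' :: "int \<Rightarrow> 'a \<Rightarrow> real"
    and r :: nat and d :: "nat \<Rightarrow> real" and G :: "nat \<Rightarrow> real \<Rightarrow> (nat \<Rightarrow> real) \<Rightarrow> real"
    and X :: "nat \<Rightarrow> nat \<Rightarrow> 'a \<Rightarrow> real"
    and H :: "real \<Rightarrow> real \<Rightarrow> real" and W :: "nat \<Rightarrow> real \<Rightarrow> real \<Rightarrow> real"
    and N :: "nat \<Rightarrow> 'a \<Rightarrow> real"
    and L L' :: "real \<Rightarrow> real" and \<eta> C e1 e2 c \<rho> K :: real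
    and l m :: "nat \<Rightarrow> nat"
  defines "X \<equiv> pls_process \<epsilon> r d G"
    and "N \<equiv> N_stat M X H W"
  assumes model: "piecewise_locally_stationary M \<epsilon> \<epsilon>' r d G"
    and H_borel: "(\<lambda>(x, y). H x y) \<in> borel_measurable borel"
    and H_sym: "\<forall>x y. H x y = H y x"
    and W_borel: "\<forall>n\<ge>1. (\<lambda>(x, y). W n x y) \<in> borel_measurable (restrict_space borel ({0..1} \<times> {0..1}))"
    and W_sym: "\<forall>n\<ge>1. \<forall>x\<in>{0..1}. \<forall>y\<in>{0..1}. W n x y = W n y x"
    and eta: "0 < \<eta>" "\<eta> \<le> 1"
    and L_nonzero: "\<forall>x. L x \<noteq> 0"
    and H_wiener: "(\<lambda>t s. H t s / (L t * L s)) \<in> wiener_ring \<eta>"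
    and L_deriv: "\<forall>x. (L has_real_derivative L' x) (at x)"
    and L'_bound: "\<forall>a b. a \<le> b \<longrightarrow> (\<forall>t\<in>{a..b}. \<bar>L' t\<bar> \<le> C * (\<bar>L' a\<bar> + \<bar>L' b\<bar> + 1))"
    and e1: "0 < e1"
    and L_moment: "(SUP n\<in>{1..}. MAX j\<in>{1..n}. Lp_norm M (4 + 2 * e1) (\<lambda>\<omega>. L (X n j \<omega>))) < \<infinity>"
    and L'_moment: "(SUP n\<in>{1..}. MAX j\<in>{1..n}. Lp_norm M (4 + 2 * e1) (\<lambda>\<omega>. L' (X n j \<omega>))) < \<infinity>"
    and lm_pos: "\<forall>n\<ge>1. 0 < l n \<and> 0 < m n"
    and m_log: "filterlim (\<lambda>n. real (m n) / ln (real n)) at_top sequentially"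
    and l_n: "(\<lambda>n. real (l n) / real n) \<longlonglongrightarrow> 0"
    and m_l: "(\<lambda>n. real (m n) / real (l n)) \<longlonglongrightarrow> 0"
    and small_blocks: "(\<lambda>n. (\<Sum>j=1..block_count l m n. small_block W l m n j) / W_total W n) \<longlonglongrightarrow> 0"
    and big_blocks: "(\<lambda>n. (MAX j\<in>{1..block_count l m n}. big_block W l m n j) / W_total W n) \<longlonglongrightarrow> 0"
    and c: "0 < c"
    and var_lower: "\<forall>\<^sub>F n in sequentially. prob_space.variance M (N n) / W_total W n \<ge> c"
    and rho: "0 \<le> \<rho>" "\<rho> < 1"
    and e2: "0 < e2"
    and dep_decay: "\<forall>\<^sub>F k in sequentially. dep_measure M \<epsilon> \<epsilon>' r d G k (4 + 2 * e2) \<le> ennreal (K * \<rho> ^ k)"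
  shows "weak_conv_m (\<lambda>n. distr M borel (\<lambda>\<omega>. N n \<omega> / sqrt (prob_space.variance M (N n))))
           std_normal_distribution"
proof -
  interpret piecewise_locally_stationary M \<epsilon> \<epsilon>' r d G by (rule model)
  define q where "q = 4 + 2 * e1"
  have q: "1 \<le> q" using e1 by (simp add: q_def)
  define Hs where "Hs = (\<lambda>t s. H t s / (L t * L s))"
  have H_eq: "H x u = Hs x u * (L x * L u)" for x u
    using L_nonzero by (simp add: Hs_def)
  obtain A where A: "0 \<le> A" "\<And>x y. \<bar>Hs x y\<bar> \<le> A" "\<And>x x' y. \<bar>Hs x y - Hs x' y\<bar> \<le> A * \<bar>x - x'\<bar> powr \<eta>"
    using wiener_ring_bounded_hoelder[OF H_wiener eta] unfolding Hs_def by blast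
  have L_der: "\<And>x. (L has_real_derivative L' x) (at x)" using L_deriv by blast
  note [measurable] = measurable_derivative[OF L_der]
  have L_inc: "\<bar>L x - L y\<bar> \<le> \<bar>C\<bar> * (\<bar>x - y\<bar> * (\<bar>L' x\<bar> + \<bar>L' y\<bar> + 1))" for x y
    by (rule increment_le_of_derivative_bound[OF L_der]) (use L'_bound in blast)

  have uniform_moment: "\<exists>S\<ge>0. \<forall>n k. 1 \<le> k \<longrightarrow> k \<le> n \<longrightarrow> (\<integral>\<^sup>+\<omega>. ennreal (\<bar>g (X n k \<omega>)\<bar> powr q) \<partial>M) \<le> ennreal S"
    if fin: "(SUP n\<in>{1..}. MAX j\<in>{1..n}. Lp_norm M q (\<lambda>\<omega>. g (X n j \<omega>))) < \<infinity>" for g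
  proof -
    obtain S where S: "0 \<le> S" "(SUP n\<in>{1..}. MAX j\<in>{1..n}. Lp_norm M q (\<lambda>\<omega>. g (X n j \<omega>))) = ennreal S"
      using ennreal_enn2real[OF fin[unfolded infinity_ennreal_def], symmetric] enn2real_nonneg by blast
    have "(\<integral>\<^sup>+\<omega>. ennreal (\<bar>g (X n k \<omega>)\<bar> powr q) \<partial>M) \<le> ennreal (S powr q)" if k: "1 \<le> k" "k \<le> n" for n k
    proof (rule nn_integral_powr_le_of_Lp_norm_le[OF _ S(1)])
      have "Lp_norm M q (\<lambda>\<omega>. g (X n k \<omega>)) \<le> (MAX j\<in>{1..n}. Lp_norm M q (\<lambda>\<omega>. g (X n j \<omega>)))"
        using k by (intro Max_ge) auto
      also have "\<dots> \<le> (SUP n\<in>{1..}. MAX j\<in>{1..n}. Lp_norm M q (\<lambda>\<omega>. g (X n j \<omega>)))"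
        using k by (intro SUP_upper) auto
      finally show "Lp_norm M q (\<lambda>\<omega>. g (X n k \<omega>)) \<le> ennreal S" unfolding S(2) .
    qed (use q in simp)
    then show ?thesis by (intro exI[of _ "S powr q"]) auto
  qed
  obtain \<Lambda>1 where \<Lambda>1: "0 \<le> \<Lambda>1" "\<And>n k. 1 \<le> k \<Longrightarrow> k \<le> n \<Longrightarrow> (\<integral>\<^sup>+\<omega>. ennreal (\<bar>L (X n k \<omega>)\<bar> powr q) \<partial>M) \<le> ennreal \<Lambda>1"
    using uniform_moment[of L] L_moment unfolding q_def by blast
  obtain \<Lambda>2 where \<Lambda>2: "0 \<le> \<Lambda>2" "\<And>n k. 1 \<le> k \<Longrightarrow> k \<le> n \<Longrightarrow> (\<integral>\<^sup>+\<omega>. ennreal (\<bar>L' (X n k \<omega>)\<bar> powr q) \<partial>M) \<le> ennreal \<Lambda>2"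
    using uniform_moment[of L'] L'_moment unfolding q_def by blast
  define \<Lambda> where "\<Lambda> = max \<Lambda>1 \<Lambda>2"
  have \<Lambda>: "0 \<le> \<Lambda>"
    "\<And>n k. 1 \<le> k \<Longrightarrow> k \<le> n \<Longrightarrow> (\<integral>\<^sup>+\<omega>. ennreal (\<bar>L (X n k \<omega>)\<bar> powr q) \<partial>M) \<le> ennreal \<Lambda>"
    "\<And>n k. 1 \<le> k \<Longrightarrow> k \<le> n \<Longrightarrow> (\<integral>\<^sup>+\<omega>. ennreal (\<bar>L' (X n k \<omega>)\<bar> powr q) \<partial>M) \<le> ennreal \<Lambda>"
    using \<Lambda>1(1)
    by (auto simp: \<Lambda>_def intro!: order_trans[OF \<Lambda>1(2) ennreal_leI] order_trans[OF \<Lambda>2(2) ennreal_leI])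
  have X_meas [measurable]: "X n k \<in> borel_measurable M" if "1 \<le> k" "k \<le> n" for n k
  proof -
    note [measurable] = pls_map_measurable[OF that]
    have "X n k = (\<lambda>\<omega>. pls_map n k (past \<epsilon> (int k) \<omega>))" by (simp add: X_def pls_process_eq fun_eq_iff)
    then show ?thesis by simp
  qed
  have LX: "integrable M (\<lambda>\<omega>. L (X n k \<omega>))" "(\<integral>\<omega>. \<bar>L (X n k \<omega>)\<bar> \<partial>M) \<le> 1 + \<Lambda>" if k: "1 \<le> k" "k \<le> n" for n k
  proof -
    note [measurable] = X_meas[OF k]
    have i: "integrable M (\<lambda>\<omega>. \<bar>L (X n k \<omega>)\<bar> powr q)" "(\<integral>\<omega>. \<bar>L (X n k \<omega>)\<bar> powr q \<partial>M) \<le> \<Lambda>"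
      by (auto intro!: integrable_of_nn_integral_le[OF _ _ \<Lambda>(2)[OF k] \<Lambda>(1)])
    have le: "\<bar>L (X n k \<omega>)\<bar> \<le> 1 + \<bar>L (X n k \<omega>)\<bar> powr q" for \<omega>
      using powr_le_1_plus_powr[of "\<bar>L (X n k \<omega>)\<bar>" 1 q] q by simp
    have bi: "integrable M (\<lambda>\<omega>. 1 + \<bar>L (X n k \<omega>)\<bar> powr q)" using i(1) by simp
    show li: "integrable M (\<lambda>\<omega>. L (X n k \<omega>))"
      by (rule Bochner_Integration.integrable_bound[OF bi]) (auto intro!: AE_I2 order_trans[OF le])
    have "(\<integral>\<omega>. \<bar>L (X n k \<omega>)\<bar> \<partial>M) \<le> (\<integral>\<omega>. 1 + \<bar>L (X n k \<omega>)\<bar> powr q \<partial>M)"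
      by (rule integral_mono[OF integrable_abs[OF li] bi]) (rule le)
    also have "\<dots> \<le> 1 + \<Lambda>" using i by (simp add: prob_space)
    finally show "(\<integral>\<omega>. \<bar>L (X n k \<omega>)\<bar> \<partial>M) \<le> 1 + \<Lambda>" .
  qed

  define P where "P = H_proj M X H"
  define \<kappa> where "\<kappa> = A * (1 + \<Lambda>) * (1 + \<bar>C\<bar>)"
  have \<kappa>: "0 \<le> \<kappa>" using A \<Lambda> by (simp add: \<kappa>_def)
  have H_int: "integrable M (\<lambda>\<omega>. H x (X n j \<omega>))" if j: "1 \<le> j" "j \<le> n" for n j x
  proof -
    note [measurable] = X_meas[OF j]
    have [measurable]: "(\<lambda>\<omega>. H x (X n j \<omega>)) \<in> borel_measurable M"
      using H_borel unfolding borel_prod[symmetric] by measurable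
    have bi: "integrable M (\<lambda>\<omega>. A * \<bar>L x\<bar> * \<bar>L (X n j \<omega>)\<bar>)" using LX(1)[OF j] by simp
    have le: "\<bar>H x u\<bar> \<le> A * \<bar>L x\<bar> * \<bar>L u\<bar>" for u
      unfolding H_eq abs_mult mult.assoc using A by (intro mult_right_mono) auto
    show ?thesis
      by (rule Bochner_Integration.integrable_bound[OF bi]) (auto intro!: AE_I2 order_trans[OF le] simp: A)
  qed
  have P_le: "\<bar>P n j x\<bar> \<le> \<kappa> * \<bar>L x\<bar>" if j: "1 \<le> j" "j \<le> n" for n j x
  proof -
    have "\<bar>P n j x\<bar> \<le> (\<integral>\<omega>. \<bar>H x (X n j \<omega>)\<bar> \<partial>M)"
      unfolding P_def H_proj_def by (rule integral_abs_bound)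
    also have "\<dots> \<le> (\<integral>\<omega>. A * \<bar>L x\<bar> * \<bar>L (X n j \<omega>)\<bar> \<partial>M)"
    proof (rule integral_mono)
      show "\<bar>H x (X n j \<omega>)\<bar> \<le> A * \<bar>L x\<bar> * \<bar>L (X n j \<omega>)\<bar>" for \<omega>
        unfolding H_eq abs_mult mult.assoc using A by (intro mult_right_mono) auto
    qed (use H_int[OF j] LX(1)[OF j] in auto)
    also have "\<dots> = A * \<bar>L x\<bar> * (\<integral>\<omega>. \<bar>L (X n j \<omega>)\<bar> \<partial>M)" by simp
    also have "\<dots> \<le> A * \<bar>L x\<bar> * (1 + \<Lambda>)"
      using LX(2)[OF j] A by (intro mult_left_mono) auto
    also have "\<dots> = (A * (1 + \<Lambda>)) * 1 * \<bar>L x\<bar>" by (simp add: mult_ac)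
    also have "\<dots> \<le> \<kappa> * \<bar>L x\<bar>"
      unfolding \<kappa>_def using A \<Lambda> by (intro mult_right_mono mult_left_mono) auto
    finally show ?thesis .
  qed
  have P_inc: "\<bar>P n j x - P n j y\<bar> \<le> \<kappa> * (\<bar>x - y\<bar> * (\<bar>L' x\<bar> + \<bar>L' y\<bar> + 1) + \<bar>L y\<bar> * \<bar>x - y\<bar> powr \<eta>)"
    if j: "1 \<le> j" "j \<le> n" for n j x y
  proof -
    let ?I = "\<bar>x - y\<bar> * (\<bar>L' x\<bar> + \<bar>L' y\<bar> + 1)" and ?J = "\<bar>L y\<bar> * \<bar>x - y\<bar> powr \<eta>"
    let ?B = "A * (\<bar>C\<bar> * ?I + ?J)"
    have le: "\<bar>H x u - H y u\<bar> \<le> ?B * \<bar>L u\<bar>" for u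
    proof -
      have eq: "H x u - H y u = (Hs x u * (L x - L y) + (Hs x u - Hs y u) * L y) * L u"
        unfolding H_eq by (simp add: algebra_simps)
      have "\<bar>Hs x u * (L x - L y) + (Hs x u - Hs y u) * L y\<bar> \<le> A * (\<bar>C\<bar> * ?I) + (A * \<bar>x - y\<bar> powr \<eta>) * \<bar>L y\<bar>"
        using A(1) A(2)[of x u] A(3)[of x u y] L_inc[of x y]
        by (intro order_trans[OF abs_triangle_ineq] add_mono) (auto simp: abs_mult intro!: mult_mono)
      also have "\<dots> = ?B" by (simp only: distrib_left mult_ac)
      finally show ?thesis unfolding eq abs_mult[of _ "L u"] by (rule mult_right_mono) simp
    qed
    have "P n j x - P n j y = (\<integral>\<omega>. H x (X n j \<omega>) - H y (X n j \<omega>) \<partial>M)"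
      unfolding P_def H_proj_def using H_int[OF j] by simp
    then have "\<bar>P n j x - P n j y\<bar> \<le> (\<integral>\<omega>. \<bar>H x (X n j \<omega>) - H y (X n j \<omega>)\<bar> \<partial>M)"
      by (simp only: integral_abs_bound)
    also have "\<dots> \<le> (\<integral>\<omega>. ?B * \<bar>L (X n j \<omega>)\<bar> \<partial>M)"
      using H_int[OF j] LX(1)[OF j] le by (intro integral_mono) auto
    also have "\<dots> = ?B * (\<integral>\<omega>. \<bar>L (X n j \<omega>)\<bar> \<partial>M)" by (rule integral_mult_right_zero)
    also have "\<dots> \<le> ?B * (1 + \<Lambda>)"
      using LX(2)[OF j] A(1) by (intro mult_left_mono) auto
    also have "\<dots> = A * (1 + \<Lambda>) * (\<bar>C\<bar> * ?I + ?J)" by (simp add: mult_ac)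
    also have "\<dots> \<le> A * (1 + \<Lambda>) * ((1 + \<bar>C\<bar>) * (?I + ?J))"
      using A(1) \<Lambda>(1) by (intro mult_left_mono) (auto simp: algebra_simps)
    finally show ?thesis by (simp add: \<kappa>_def mult.assoc)
  qed

  let ?w = "\<lambda>n k j. W n (real k / real n) (real j / real n)"
  \<comment> \<open>Dividing by the row sum of the weights makes the functions \<open>h n k\<close> averages of the projections with signed weights, and gives them
      bounds that do not depend on \<open>n\<close> and \<open>k\<close>. A row whose sum is \<open>0\<close> has only zero weights, and \<open>h n k = 0\<close> there.\<close>
  define h where "h n k x = (\<Sum>j=1..n. ?w n k j * P n j x) / W_row W n k" for n k x
  have row: "W_row W n k = (\<Sum>j=1..n. \<bar>?w n k j\<bar>)" if "1 \<le> k" "k \<le> n" for n k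
    using that by (simp add: W_row_def)
  have row_nonneg: "0 \<le> W_row W n k" for n k
    by (auto simp: W_row_def intro: sum_nonneg)
  have average: "\<bar>(\<Sum>j=1..n. ?w n k j * g j) / W_row W n k\<bar> \<le> b"
    if k: "1 \<le> k" "k \<le> n" and g: "\<And>j. 1 \<le> j \<Longrightarrow> j \<le> n \<Longrightarrow> \<bar>g j\<bar> \<le> b" and b: "0 \<le> b" for n k g b
  proof -
    have "\<bar>\<Sum>j=1..n. ?w n k j * g j\<bar> \<le> (\<Sum>j=1..n. \<bar>?w n k j\<bar> * b)"
      using g by (intro order_trans[OF sum_abs] sum_mono) (auto simp: abs_mult intro!: mult_left_mono)
    then have "\<bar>\<Sum>j=1..n. ?w n k j * g j\<bar> \<le> b * W_row W n k"
      by (simp add: row[OF k] sum_distrib_left mult.commute)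
    then show ?thesis using row_nonneg[of n k] b
      by (cases "W_row W n k = 0") (auto simp: abs_divide divide_le_eq)
  qed
  have h_le: "\<bar>h n k x\<bar> \<le> \<kappa> * \<bar>L x\<bar>" if "1 \<le> k" "k \<le> n" for n k x
    unfolding h_def using \<kappa> by (intro average that P_le) auto
  have h_inc: "\<bar>h n k x - h n k y\<bar> \<le> \<kappa> * (\<bar>x - y\<bar> * (\<bar>L' x\<bar> + \<bar>L' y\<bar> + 1) + \<bar>L y\<bar> * \<bar>x - y\<bar> powr \<eta>)"
    if "1 \<le> k" "k \<le> n" for n k x y
  proof -
    have "h n k x - h n k y = (\<Sum>j=1..n. ?w n k j * (P n j x - P n j y)) / W_row W n k"
      unfolding h_def diff_divide_distrib[symmetric] by (simp add: right_diff_distrib sum_subtractf)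
    also have "\<bar>\<dots>\<bar> \<le> \<kappa> * (\<bar>x - y\<bar> * (\<bar>L' x\<bar> + \<bar>L' y\<bar> + 1) + \<bar>L y\<bar> * \<bar>x - y\<bar> powr \<eta>)"
      using \<kappa> by (intro average that P_inc mult_nonneg_nonneg add_nonneg_nonneg) auto
    finally show ?thesis .
  qed
  have P_meas: "P n j \<in> borel_measurable borel" if j: "1 \<le> j" "j \<le> n" for n j
  proof -
    note [measurable] = X_meas[OF j]
    have [measurable]: "(\<lambda>(x, y). H x y) \<in> borel_measurable (borel \<Otimes>\<^sub>M borel)"
      using H_borel unfolding borel_prod .
    have "(\<lambda>(x, \<omega>). H x (X n j \<omega>)) \<in> borel_measurable (borel \<Otimes>\<^sub>M M)" by measurable
    then show ?thesis
      unfolding P_def H_proj_def[abs_def] by (rule borel_measurable_lebesgue_integral)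
  qed
  have h_meas: "h n k \<in> borel_measurable borel" for n k
    unfolding h_def[abs_def] using P_meas
    by (intro borel_measurable_divide borel_measurable_sum borel_measurable_times borel_measurable_const) auto

  have "\<exists>Z' p \<rho>' B. coupled_array M
     (\<lambda>n k \<omega>. if 1 \<le> k \<and> k \<le> n then h n k (X n k \<omega>) - (\<integral>\<omega>. h n k (X n k \<omega>) \<partial>M) else 0) Z' p \<rho>' B"
    unfolding X_def
    by (rule coupled_array_of_smooth_functions[where h=h and L=L and L'=L' and \<kappa>=\<kappa> and \<Lambda>=\<Lambda>];
        fact h_meas measurable_derivative[OF L_der] \<kappa> eta h_le h_inc e1 e2 \<Lambda>(1)
          \<Lambda>(2)[unfolded X_def q_def] \<Lambda>(3)[unfolded X_def q_def] rho dep_decay)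
  then obtain Z' p \<rho>' B where array: "coupled_array M
     (\<lambda>n k \<omega>. if 1 \<le> k \<and> k \<le> n then h n k (X n k \<omega>) - (\<integral>\<omega>. h n k (X n k \<omega>) \<partial>M) else 0) Z' p \<rho>' B"
    by blast
  interpret CA: coupled_array M
     "\<lambda>n k \<omega>. if 1 \<le> k \<and> k \<le> n then h n k (X n k \<omega>) - (\<integral>\<omega>. h n k (X n k \<omega>) \<partial>M) else 0" Z' p \<rho>' B
    by (rule array)

  have P_int: "integrable M (\<lambda>\<omega>. P n j (X n k \<omega>))" if j: "1 \<le> j" "j \<le> n" and k: "1 \<le> k" "k \<le> n" for n j k
  proof -
    have m: "(\<lambda>\<omega>. P n j (X n k \<omega>)) \<in> borel_measurable M"
      by (rule measurable_compose[OF X_meas[OF k] P_meas[OF j]])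
    have bi: "integrable M (\<lambda>\<omega>. \<kappa> * \<bar>L (X n k \<omega>)\<bar>)" using LX(1)[OF k] by simp
    show ?thesis
      by (rule Bochner_Integration.integrable_bound[OF bi m]) (use \<kappa> in \<open>auto intro!: AE_I2 order_trans[OF P_le[OF j]]\<close>)
  qed
  have N_eq: "N n \<omega> = CA.wsum n (W_row W n) {1..n} \<omega>" for n \<omega>
    unfolding N_def N_stat_def CA.wsum_def P_def[symmetric]
  proof (rule sum.cong[OF refl])
    fix k assume "k \<in> {1..n}"
    then have k: "1 \<le> k" "k \<le> n" by auto
    have cancel: "W_row W n k * h n k x = (\<Sum>j=1..n. ?w n k j * P n j x)" for x
    proof (cases "W_row W n k = 0")
      case True
      then have "?w n k j = 0" if "j \<in> {1..n}" for j
        using that unfolding row[OF k] by (subst (asm) sum_nonneg_eq_0_iff) auto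
      then show ?thesis using True by simp
    qed (simp add: h_def)
    have "W_row W n k * (\<integral>\<omega>. h n k (X n k \<omega>) \<partial>M) = (\<integral>\<omega>. W_row W n k * h n k (X n k \<omega>) \<partial>M)"
      by simp
    also have "\<dots> = (\<Sum>j=1..n. ?w n k j * (\<integral>\<omega>. P n j (X n k \<omega>) \<partial>M))"
      unfolding cancel using P_int[OF _ _ k] by (subst Bochner_Integration.integral_sum) auto
    finally have "W_row W n k * (h n k (X n k \<omega>) - (\<integral>\<omega>. h n k (X n k \<omega>) \<partial>M))
       = (\<Sum>j=1..n. ?w n k j * (P n j (X n k \<omega>) - (\<integral>\<omega>. P n j (X n k \<omega>) \<partial>M)))"
      by (simp only: right_diff_distrib cancel sum_subtractf)
    then show "(\<Sum>j=1..n. ?w n k j * (P n j (X n k \<omega>) - (\<integral>\<omega>'. P n j (X n k \<omega>') \<partial>M)))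
      = W_row W n k * (if 1 \<le> k \<and> k \<le> n then h n k (X n k \<omega>) - (\<integral>\<omega>. h n k (X n k \<omega>) \<partial>M) else 0)"
      using k by simp
  qed
  have var_eq: "variance (N n) = (\<integral>\<omega>. (CA.wsum n (W_row W n) {1..n} \<omega>)\<^sup>2 \<partial>M)" for n
  proof -
    have "N n = CA.wsum n (W_row W n) {1..n}" by (rule ext) (rule N_eq)
    then show ?thesis by (simp only: CA.wsum_mean diff_zero)
  qed

  define \<alpha> where "\<alpha> n = \<bar>(\<Sum>j=1..block_count l m n. small_block W l m n j) / W_total W n\<bar>" for n
  define \<beta> where "\<beta> n = \<bar>(MAX j\<in>{1..block_count l m n}. big_block W l m n j) / W_total W n\<bar>" for n
  have total: "W_total W n = (\<Sum>k=1..n. (W_row W n k)\<^sup>2)" for n by (simp add: W_total_def)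
  have big_eq: "(\<Sum>k\<in>CA.big (l n) (m n) j. (W_row W n k)\<^sup>2) = big_block W l m n (Suc j)" for n j
    unfolding CA.big_def big_block_def
    by (rule sum.reindex_bij_witness[where i="\<lambda>k. (l n + m n) * j + k" and j="\<lambda>k. k - (l n + m n) * j"]) auto
  have small_eq: "(\<Sum>k\<in>CA.small (l n) (m n) j. (W_row W n k)\<^sup>2) = small_block W l m n (Suc j)" for n j
    unfolding CA.small_def small_block_def
    by (rule sum.reindex_bij_witness[where i="\<lambda>k. (l n + m n) * j + k" and j="\<lambda>k. k - (l n + m n) * j"]) auto
  have small_sum: "(\<Sum>k\<in>CA.smalls (l n) (m n) (block_count l m n). (W_row W n k)\<^sup>2)
      = (\<Sum>j=1..block_count l m n. small_block W l m n j)" for n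
  proof -
    have "(\<Sum>k\<in>CA.smalls (l n) (m n) (block_count l m n). (W_row W n k)\<^sup>2)
        = (\<Sum>j<block_count l m n. small_block W l m n (Suc j))"
      by (simp add: CA.sum_smalls small_eq)
    also have "\<dots> = (\<Sum>j=1..block_count l m n. small_block W l m n j)"
      by (rule sum.reindex_bij_witness[where i="\<lambda>j. j - 1" and j=Suc]) auto
    finally show ?thesis .
  qed
  have W_pos: "\<forall>\<^sub>F n in sequentially. 0 < W_total W n \<and> c * W_total W n \<le> variance (N n)"
    using var_lower
  proof eventually_elim
    case (elim n)
    have "0 \<le> W_total W n" unfolding W_total_def by (intro sum_nonneg) auto
    moreover have "W_total W n \<noteq> 0" using elim c by auto
    ultimately have "0 < W_total W n" by simp
    then show ?case using elim by (simp add: field_simps)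
  qed

  have "weak_conv_m (\<lambda>n. distr M borel (\<lambda>\<omega>. CA.wsum n (W_row W n) {1..n} \<omega>
      / sqrt (\<integral>\<omega>. (CA.wsum n (W_row W n) {1..n} \<omega>)\<^sup>2 \<partial>M))) std_normal_distribution"
  proof (rule CA.block_clt[where l=l and m=m and b="block_count l m" and \<alpha>=\<alpha> and \<beta>=\<beta> and c=c and w="W_row W"])
    show "W_row W n k = 0" if "k \<notin> {1..n}" for n k
      using that by (auto simp: W_row_def)
    show "\<forall>\<^sub>F n in sequentially. n \<le> (l n + m n) * block_count l m n"
      using eventually_ge_at_top[of 1]
    proof eventually_elim
      case (elim n)
      have s: "0 < real (l n + m n)" using lm_pos elim by (metis add_pos_pos of_nat_0_less_iff)
      have "real n / real (l n + m n) \<le> real (block_count l m n)"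
        unfolding block_count_def using s by (simp add: le_of_int_ceiling)
      then have "real n \<le> real ((l n + m n) * block_count l m n)"
        using s by (simp add: pos_divide_le_eq mult.commute)
      then show ?case by (simp only: of_nat_le_iff)
    qed
    show "\<forall>\<^sub>F n in sequentially. 1 \<le> m n"
      using eventually_ge_at_top[of 1] by eventually_elim (use lm_pos in \<open>force simp: Suc_le_eq\<close>)
    show "\<alpha> \<longlonglongrightarrow> 0" "\<beta> \<longlonglongrightarrow> 0"
      unfolding \<alpha>_def[abs_def] \<beta>_def[abs_def] by (intro tendsto_rabs_zero small_blocks big_blocks)+
    show "0 \<le> \<alpha> n" "0 \<le> \<beta> n" for n by (simp_all add: \<alpha>_def \<beta>_def)
    show "\<forall>\<^sub>F n in sequentially. (\<Sum>k\<in>CA.smalls (l n) (m n) (block_count l m n). (W_row W n k)\<^sup>2)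
        \<le> \<alpha> n * (\<Sum>k=1..n. (W_row W n k)\<^sup>2)"
      unfolding total[symmetric] small_sum using W_pos by eventually_elim (simp add: \<alpha>_def)
    show "\<forall>\<^sub>F n in sequentially. \<forall>j<block_count l m n. (\<Sum>k\<in>CA.big (l n) (m n) j. (W_row W n k)\<^sup>2)
        \<le> \<beta> n * (\<Sum>k=1..n. (W_row W n k)\<^sup>2)"
      using W_pos
    proof eventually_elim
      case (elim n)
      show ?case
      proof (intro allI impI)
        fix j assume "j < block_count l m n"
        then have "big_block W l m n (Suc j) \<le> (MAX j\<in>{1..block_count l m n}. big_block W l m n j)"
          by (intro Max_ge) auto
        then show "(\<Sum>k\<in>CA.big (l n) (m n) j. (W_row W n k)\<^sup>2) \<le> \<beta> n * (\<Sum>k=1..n. (W_row W n k)\<^sup>2)"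
          unfolding total[symmetric] big_eq using elim by (simp add: \<beta>_def)
      qed
    qed
    show "\<forall>\<^sub>F n in sequentially. 0 < (\<Sum>k=1..n. (W_row W n k)\<^sup>2)
        \<and> c * (\<Sum>k=1..n. (W_row W n k)\<^sup>2) \<le> (\<integral>\<omega>. (CA.wsum n (W_row W n) {1..n} \<omega>)\<^sup>2 \<partial>M)"
      using W_pos unfolding var_eq total .
  qed (use row_nonneg m_log c in auto)
  then show ?thesis unfolding var_eq unfolding N_eq .
qed

end
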